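(* Let $\Omega\subset\mathbb{R}^n$ be a bounded domain of class $C^2$. Let $F:\Omega\times\mathbb{R}^n\times\mathbb{S}^n\to\mathbb{R}$ be continuous and satisfy $F(x,p,X)\le F(x,p,Y)$ for all $x\in\Omega$, $p\in\mathbb{R}^n$ and $X,Y\in\mathbb{S}^n$ with $X\ge Y$. Assume moreover that for any $M>0$ there exist $a_F,L>0$, $\alpha\in(0,1]$ and $\beta\in(0,1)$, possibly depending on $M$, such that $$F(y,q,Y)-F(x,p,X)\le\beta a_F|x-y|^\alpha+L\delta$$ for any $\delta>0$, $x,y\in\Omega$ with $x\ne y$, $p,q\in\mathbb{R}^n$ and $X,Y\in\mathbb{S}^n$ provided that $$F(x,p,X)\le M,\qquad F(y,q,Y)\ge-M,$$ $$|p-\alpha a_F|x-y|^{\alpha-2}(x-y)|\le\delta\,d(x)^{-1},\qquad |q-\alpha a_F|x-y|^{\alpha-2}(x-y)|\le\delta\,d(y)^{-1},$$ and $$\begin{pmatrix}X&0\\0&-Y\end{pmatrix}\le\begin{pmatrix}A&-A\\-A&A\end{pmatrix}+\delta\begin{pmatrix}d(x)^{-2}I_n&0\\0&d(y)^{-2}I_n\end{pmatrix}+\delta I_{2n}$$ hold with some $A=A(x,y)\in\mathbb{S}^n$ satisfying $A\le\alpha a_F|x-y|^{\alpha-2}I_n$. Let $u\in C(\Omega)$ be a bounded viscosity solution of $u+F(x,\nabla u,\nabla^2u)=0$ in $\Omega$, set $M=\sup_{x\in\Omega}|u(x)|$, and let $a_F>0$ and $\alpha\in(0,1]$ be constants for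 which, together with some $L>0$ and $\beta\in(0,1)$, the inequality $$F(y,q,Y)-F(x,p,X)\le\beta a_F|x-y|^\alpha+L\delta$$ holds for any $\delta>0$, $x,y\in\Omega$ with $x\ne y$, $p,q\in\mathbb{R}^n$ and $X,Y\in\mathbb{S}^n$ provided that $$F(x,p,X)\le \sup_{\Omega}|u|,\qquad F(y,q,Y)\ge-\sup_{\Omega}|u|,$$ $$|p-\alpha a_F|x-y|^{\alpha-2}(x-y)|\le\delta\,d(x)^{-1},\qquad |q-\alpha a_F|x-y|^{\alpha-2}(x-y)|\le\delta\,d(y)^{-1},$$ and $$\begin{pmatrix}X&0\\0&-Y\end{pmatrix}\le\begin{pmatrix}A&-A\\-A&A\end{pmatrix}+\delta\begin{pmatrix}d(x)^{-2}I_n&0\\0&d(y)^{-2}I_n\end{pmatrix}+\delta I_{2n}$$ hold with some $A=A(x,y)\in\mathbb{S}^n$ satisfying $A\le\alpha a_F|x-y|^{\alpha-2}I_n$. Then $$|u(x)-u(y)|\le a_F|x-y|^\alpha\quad\text{for all }x,y\in\Omega.$$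
   Context: $\mathbb{S}^n$ is the set of all real symmetric $n\times n$ matrices with the usual partial order; $I_k$ is the $k\times k$ identity matrix; $d(x)$ denotes the distance from $x\in\overline{\Omega}$ to $\partial\Omega$. Viscosity solutions. A locally bounded upper (resp. lower) semicontinuous function $u$ in $\Omega$ is a viscosity subsolution (resp. supersolution) of $u+F(x,\nabla u,\nabla^2u)=0$ in $\Omega$ if whenever $x_0\in\Omega$ and $\varphi\in C^2(\Omega)$ are such that $u-\varphi$ attains a local maximum (resp. minimum) at $x_0$, one has $u(x_0)+F(x_0,\nabla\varphi(x_0),\nabla^2\varphi(x_0))\le0$ (resp. $\ge0$). A function $u\in C(\Omega)$ is a viscosity solution if it is both a viscosity subsolution and a viscosity supersolution. *)

theory Defs
  imports "HOL-Analysis.Analysis"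
begin

subsection \<open>Symmetric matrices\<close>

definition sym_matrices :: "(real^'k^'k) set" where
  "sym_matrices = {X. transpose X = X}"

text \<open>The usual partial order on symmetric matrices; the library order on vectors is componentwise.\<close>

definition matrix_le :: "real^'k^'k \<Rightarrow> real^'k^'k \<Rightarrow> bool" (infix "\<preceq>" 50) where
  "X \<preceq> Y \<longleftrightarrow> (\<forall>\<xi>. \<xi> \<bullet> (X *v \<xi>) \<le> \<xi> \<bullet> (Y *v \<xi>))"

definition block_matrix ::
    "real^'n^'n \<Rightarrow> real^'n^'n \<Rightarrow> real^'n^'n \<Rightarrow> real^'n^'n \<Rightarrow> real^('n + 'n)^('n + 'n)" where
  "block_matrix A B C D = (\<chi> i j.
     case i of
       Inl k \<Rightarrow> (case j of Inl l \<Rightarrow> A $ k $ l | Inr l \<Rightarrow> B $ k $ l)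
     | Inr k \<Rightarrow> (case j of Inl l \<Rightarrow> C $ k $ l | Inr l \<Rightarrow> D $ k $ l))"


subsection \<open>Functions and domains of class C2\<close>

definition gradient :: "(real^'n \<Rightarrow> real) \<Rightarrow> real^'n \<Rightarrow> real^'n" where
  "gradient f x = (\<chi> i. frechet_derivative f (at x) (axis i 1))"

definition hessian :: "(real^'n \<Rightarrow> real) \<Rightarrow> real^'n \<Rightarrow> real^'n^'n" where
  "hessian f x = jacobian (gradient f) (at x)"

text \<open>Meant for open sets \<open>S\<close>; the values of \<open>f\<close> outside \<open>S\<close> are then irrelevant.\<close>

definition C2_on :: "(real^'n) set \<Rightarrow> (real^'n \<Rightarrow> real) \<Rightarrow> bool" where
  "C2_on S f \<longleftrightarrow>
     (\<forall>x\<in>S. f differentiable (at x)) \<and>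
     (\<forall>x\<in>S. gradient f differentiable (at x)) \<and>
     continuous_on S (hessian f)"

text \<open>
  Near each boundary point, after a choice of axes, the set is the part of a ball lying strictly
  above the graph of a C2 function of \<open>n - 1\<close> variables. The unit vector \<open>e\<close> is the last axis; a
  function of the remaining coordinates is a function on the whole space that is invariant under
  translations along \<open>e\<close>.
\<close>

definition C2_boundary :: "(real^'n) set \<Rightarrow> bool" where
  "C2_boundary \<Omega> \<longleftrightarrow>
     (\<forall>z\<in>frontier \<Omega>. \<exists>r>0. \<exists>e g.
        norm e = 1 \<and> C2_on UNIV g \<and> (\<forall>x t. g (x + t *\<^sub>R e) = g x) \<and>
        \<Omega> \<inter> ball z r = {x \<in> ball z r. g x < x \<bullet> e})"

definition bounded_C2_domain :: "(real^'n) set \<Rightarrow> bool" where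
  "bounded_C2_domain \<Omega> \<longleftrightarrow>
     open \<Omega> \<and> connected \<Omega> \<and> \<Omega> \<noteq> {} \<and> bounded \<Omega> \<and> C2_boundary \<Omega>"


subsection \<open>Viscosity solutions\<close>

definition locally_bounded_on :: "(real^'n) set \<Rightarrow> (real^'n \<Rightarrow> real) \<Rightarrow> bool" where
  "locally_bounded_on \<Omega> u \<longleftrightarrow> (\<forall>x\<in>\<Omega>. \<exists>r>0. bounded (u ` (ball x r \<inter> \<Omega>)))"

definition usc_on :: "(real^'n) set \<Rightarrow> (real^'n \<Rightarrow> real) \<Rightarrow> bool" where
  "usc_on \<Omega> u \<longleftrightarrow> (\<forall>x\<in>\<Omega>. \<forall>c>u x. \<forall>\<^sub>F y in at x within \<Omega>. u y < c)"

definition lsc_on :: "(real^'n) set \<Rightarrow> (real^'n \<Rightarrow> real) \<Rightarrow> bool" where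
  "lsc_on \<Omega> u \<longleftrightarrow> (\<forall>x\<in>\<Omega>. \<forall>c<u x. \<forall>\<^sub>F y in at x within \<Omega>. c < u y)"

definition local_max_at :: "(real^'n) set \<Rightarrow> (real^'n \<Rightarrow> real) \<Rightarrow> real^'n \<Rightarrow> bool" where
  "local_max_at \<Omega> f x \<longleftrightarrow> (\<forall>\<^sub>F y in at x within \<Omega>. f y \<le> f x)"

definition local_min_at :: "(real^'n) set \<Rightarrow> (real^'n \<Rightarrow> real) \<Rightarrow> real^'n \<Rightarrow> bool" where
  "local_min_at \<Omega> f x \<longleftrightarrow> (\<forall>\<^sub>F y in at x within \<Omega>. f x \<le> f y)"

definition viscosity_subsolution ::
    "(real^'n) set \<Rightarrow> (real^'n \<Rightarrow> real^'n \<Rightarrow> real^'n^'n \<Rightarrow> real) \<Rightarrow> (real^'n \<Rightarrow> real) \<Rightarrow> bool" where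
  "viscosity_subsolution \<Omega> F u \<longleftrightarrow>
     locally_bounded_on \<Omega> u \<and> usc_on \<Omega> u \<and>
     (\<forall>x\<in>\<Omega>. \<forall>\<phi>. C2_on \<Omega> \<phi> \<longrightarrow> local_max_at \<Omega> (\<lambda>y. u y - \<phi> y) x \<longrightarrow>
        u x + F x (gradient \<phi> x) (hessian \<phi> x) \<le> 0)"

definition viscosity_supersolution ::
    "(real^'n) set \<Rightarrow> (real^'n \<Rightarrow> real^'n \<Rightarrow> real^'n^'n \<Rightarrow> real) \<Rightarrow> (real^'n \<Rightarrow> real) \<Rightarrow> bool" where
  "viscosity_supersolution \<Omega> F u \<longleftrightarrow>
     locally_bounded_on \<Omega> u \<and> lsc_on \<Omega> u \<and>
     (\<forall>x\<in>\<Omega>. \<forall>\<phi>. C2_on \<Omega> \<phi> \<longrightarrow> local_min_at \<Omega> (\<lambda>y. u y - \<phi> y) x \<longrightarrow>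
        u x + F x (gradient \<phi> x) (hessian \<phi> x) \<ge> 0)"

definition viscosity_solution ::
    "(real^'n) set \<Rightarrow> (real^'n \<Rightarrow> real^'n \<Rightarrow> real^'n^'n \<Rightarrow> real) \<Rightarrow> (real^'n \<Rightarrow> real) \<Rightarrow> bool" where
  "viscosity_solution \<Omega> F u \<longleftrightarrow>
     continuous_on \<Omega> u \<and> viscosity_subsolution \<Omega> F u \<and> viscosity_supersolution \<Omega> F u"


subsection \<open>The structure condition on F\<close>

definition bdist :: "(real^'n) set \<Rightarrow> real^'n \<Rightarrow> real" where
  "bdist \<Omega> x = infdist x (frontier \<Omega>)"

text \<open>
  The operator is a function on all square matrices, but only its values at symmetric ones are
  ever constrained. The matrix \<open>A\<close> belongs to the premises: the bound on \<open>F\<close> is required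
  whenever some admissible \<open>A\<close> exists.
\<close>

definition structure_condition ::
    "(real^'n) set \<Rightarrow> (real^'n \<Rightarrow> real^'n \<Rightarrow> real^'n^'n \<Rightarrow> real) \<Rightarrow>
     real \<Rightarrow> real \<Rightarrow> real \<Rightarrow> real \<Rightarrow> real \<Rightarrow> bool" where
  "structure_condition \<Omega> F M a L \<alpha> \<beta> \<longleftrightarrow>
     (\<forall>\<delta>>0. \<forall>x\<in>\<Omega>. \<forall>y\<in>\<Omega>. \<forall>p q. \<forall>X\<in>sym_matrices. \<forall>Y\<in>sym_matrices.
        x \<noteq> y \<longrightarrow>
        F x p X \<le> M \<longrightarrow> F y q Y \<ge> - M \<longrightarrow>
        norm (p - (\<alpha> * a * norm (x - y) powr (\<alpha> - 2)) *\<^sub>R (x - y)) \<le> \<delta> / bdist \<Omega> x \<longrightarrow>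
        norm (q - (\<alpha> * a * norm (x - y) powr (\<alpha> - 2)) *\<^sub>R (x - y)) \<le> \<delta> / bdist \<Omega> y \<longrightarrow>
        (\<exists>A\<in>sym_matrices.
           A \<preceq> (\<alpha> * a * norm (x - y) powr (\<alpha> - 2)) *\<^sub>R mat 1 \<and>
           block_matrix X 0 0 (- Y) \<preceq>
             block_matrix A (- A) (- A) A
             + \<delta> *\<^sub>R block_matrix ((1 / (bdist \<Omega> x)\<^sup>2) *\<^sub>R mat 1) 0 0 ((1 / (bdist \<Omega> y)\<^sup>2) *\<^sub>R mat 1)
             + \<delta> *\<^sub>R mat 1) \<longrightarrow>
        F y q Y - F x p X \<le> \<beta> * a * norm (x - y) powr \<alpha> + L * \<delta>)"

end

theory Submission
  imports Defs
begin

text \<open>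
  Doubling of variables. If \<open>u x - u y > a |x - y|\<^sup>\<alpha>\<close> somewhere, then
  \<open>u x - u y - a |x - y|\<^sup>\<alpha>\<close>, penalised by a small multiple of a logarithmic barrier at the boundary,
  has an interior maximum with \<open>x \<noteq> y\<close>. The power \<open>|w|\<^sup>\<alpha>\<close> is concave in \<open>|w|\<^sup>2\<close>, so
  it is touched from above by a paraboloid whose Hessian is exactly the largest matrix \<open>A\<close> that the
  structure condition allows. The theorem on sums then gives matrices for which the two viscosity
  inequalities and the structure condition contradict each other. The barrier is a supremum of
  paraboloids centred at interior points, comparable to the distance to the boundary.

  The theorem on sums is reduced, by sup-convolution, to a pair of convex functions whose sum is touched
  from above by a quadratic form. The resolvent of a convex function is Lipschitz, hence differentiable
  almost everywhere by Rademacher's theorem, and its derivative is invertible where the function is touched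
  from above; there the function has a second-order expansion. Jensen's perturbation of the maximum
  reaches such points.
\<close>

section \<open>Rademacher's theorem\<close>

text \<open>The slack in the structure condition dictates the penalty: gradient errors \<delta>/d
  and Hessian errors \<delta>/d^2 are the size of the first two derivatives of \<epsilon> log d. As
  d itself need not be twice differentiable, log d is replaced at the maximum by the logarithm of a
  single paraboloid, selected by the maximisation; a quadratic lower bound for it is all that a
  maximum needs. The bounds 2/d and 38/d^2 in that expansion lead to \<delta> = 40 \<epsilon>, and
  \<epsilon> is small against \<theta>, half the assumed excess of u x - u y over a |x -
  y|^\<alpha>, so that L \<delta> \<le> \<theta>/2. The theorem on sums is needed only
  approximately, with jets at nearby points and an additive error. Every inequality fed to the
  structure condition is strict at the maximum point, so it persists nearby and no limit of jets or
  matrices is taken. Since the matrix A is a multiple of the identity, all forms involved are of the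
  simple type \<open>sum_form\<close>.\<close>

lemma negligible_Lipschitz_image:
  fixes f :: "'a::euclidean_space \<Rightarrow> 'a"
  assumes "negligible S" and "\<And>x y. norm (f x - f y) \<le> B * norm (x - y)"
  shows "negligible (f ` S)"
  using assms by (intro negligible_locally_Lipschitz_image) (auto intro!: exI[of _ UNIV] exI[of _ B])

section \<open>Almost everywhere differentiability on the real line\<close>

text \<open>After adding slope \<open>L + 1\<close>, the function \<open>F\<close> is a bijection
  with slopes between 1 and 2L + 1, so its inverse \<open>G\<close> is 1-Lipschitz. The image of
  Lebesgue measure under \<open>G\<close> gives \<open>{a..b}\<close> the mass
  \<open>F b - F a\<close>, and it is absolutely continuous because \<open>F\<close> maps null sets
  to null sets. Its Radon-Nikodym density, minus the added slope, is the density sought.\<close>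

lemma lipschitz_real_density:
  fixes g :: "real \<Rightarrow> real"
  assumes lip: "\<And>x y. \<bar>g x - g y\<bar> \<le> L * \<bar>x - y\<bar>"
  obtains k where "\<And>a b. a \<le> b \<Longrightarrow> (k has_integral g b - g a) {a..b}"
proof -
  have L0: "L \<ge> 0"
    using lip[of 0 1] by (auto intro: order_trans[OF abs_ge_zero])
  define F where "F t = g t + (L + 1) * t" for t
  have F_lower: "y - x \<le> F y - F x" if "x \<le> y" for x y
    using lip[of x y] that by (auto simp: F_def algebra_simps abs_if split: if_splits)
  have F_upper: "\<bar>F y - F x\<bar> \<le> (2 * L + 1) * \<bar>y - x\<bar>" for x y
  proof -
    have "\<bar>F y - F x\<bar> = \<bar>(g y - g x) + (L + 1) * (y - x)\<bar>"
      by (simp add: F_def algebra_simps)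
    also have "\<dots> \<le> \<bar>g y - g x\<bar> + (L + 1) * \<bar>y - x\<bar>"
      using L0 by (intro order_trans[OF abs_triangle_ineq]) (simp add: abs_mult)
    also have "\<dots> \<le> (2 * L + 1) * \<bar>y - x\<bar>"
      using lip[of y x] by (simp add: algebra_simps)
    finally show ?thesis .
  qed
  have mono: "strict_mono F"
    proof (rule strict_monoI)
    show "F x < F y" if "x < y" for x y
      using F_lower[of x y] that by linarith
  qed
  have cont: "continuous_on UNIV F"
  proof (rule lipschitz_on_continuous_on)
    show "(2 * L + 1)-lipschitz_on UNIV F"
      using F_upper L0 by (auto simp: lipschitz_on_def dist_real_def abs_minus_commute)
  qed
  have "\<exists>x. F x = c" for c
  proof -
    have "\<exists>x\<ge>- \<bar>c - F 0\<bar>. x \<le> \<bar>c - F 0\<bar> \<and> F x = c"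
    proof (rule IVT')
    show "F (- \<bar>c - F 0\<bar>) \<le> c" using F_lower[of "- \<bar>c - F 0\<bar>" 0] by linarith
    show "c \<le> F \<bar>c - F 0\<bar>" using F_lower[of 0 "\<bar>c - F 0\<bar>"] by linarith
    show "continuous_on {- \<bar>c - F 0\<bar>..\<bar>c - F 0\<bar>} F" using cont continuous_on_subset by blast
    qed simp
    then show ?thesis by blast
  qed
  then have bij: "bij F"
    using strict_mono_imp_inj_on[OF mono] by (metis bij_betw_def surj_def)
  define G where "G = inv F"
  have FG: "F (G c) = c" and GF: "G (F c) = c" for c
    using bij by (auto simp: G_def bij_is_surj surj_f_inv_f bij_is_inj)
  have "1-lipschitz_on UNIV G"
  proof (rule lipschitz_onI)
    fix c d
    have "\<bar>G c - G d\<bar> \<le> \<bar>c - d\<bar>"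
      using F_lower[of "G c" "G d"] F_lower[of "G d" "G c"] FG by (cases "G c \<le> G d") (auto simp: abs_if)
    then show "dist (G c) (G d) \<le> 1 * dist c d" by (simp add: dist_real_def)
  qed simp
  then have [measurable]: "G \<in> borel_measurable borel"
    using borel_measurable_continuous_onI lipschitz_on_continuous_on by blast
  have G_vimage: "G -` S = F ` S" for S
    by (metis bij bij_vimage_eq_inv_image bij_imp_bij_inv G_def inv_inv_eq)
  define \<mu> where "\<mu> = distr lborel borel G"
  have "absolutely_continuous lborel \<mu>"
    unfolding absolutely_continuous_def
  proof
    fix S :: "real set" assume S: "S \<in> null_sets lborel"
    then have "negligible S"
      by (simp add: negligible_iff_null_sets null_sets_completionI)
    then have "negligible (F ` S)"
      by (rule negligible_Lipschitz_image[where B = "2 * L + 1"]) (use F_upper in simp)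
    then have "G -` S \<in> null_sets lebesgue"
      by (simp add: G_vimage negligible_iff_null_sets)
    moreover have "G -` S \<in> sets borel"
      using S measurable_sets_borel[of G borel S] by (auto simp: null_sets_def)
    ultimately show "S \<in> null_sets \<mu>"
      using S by (auto simp: \<mu>_def null_sets_def emeasure_distr)
  qed
  then obtain h where h [measurable]: "h \<in> borel_measurable lborel" and dens: "density lborel h = \<mu>"
    using sigma_finite_measure.Radon_Nikodym[OF sigma_finite_lborel, of \<mu>] by (auto simp: \<mu>_def)
  define k where "k x = enn2real (h x)" for x
  have h_int: "(\<integral>\<^sup>+ x. h x * indicator {a..b} x \<partial>lborel) = ennreal (F b - F a)" if "a \<le> b" for a b
  proof -
    have "(\<integral>\<^sup>+ x. h x * indicator {a..b} x \<partial>lborel) = emeasure \<mu> {a..b}"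
      by (simp add: dens[symmetric] emeasure_density)
    also have "\<dots> = emeasure lborel (G -` {a..b})"
      by (simp add: \<mu>_def emeasure_distr)
    also have "G -` {a..b} = {F a..F b}"
    proof -
      have "a \<le> G x \<longleftrightarrow> F a \<le> x" "G x \<le> b \<longleftrightarrow> x \<le> F b" for x
        using strict_mono_less_eq[OF mono, of a "G x"] strict_mono_less_eq[OF mono, of "G x" b] FG by simp_all
      then show ?thesis by auto
    qed
    finally show ?thesis
      using that mono by (simp add: strict_mono_less_eq)
  qed
  \<comment> \<open>\<open>enn2real\<close> sends \<open>\<infinity>\<close> to 0, so infinite
    values of \<open>h\<close> would be lost; the finite integrals over all
    \<open>{- real n..real n}\<close> confine them to a null set.\<close>
  have finite_ae: "AE x in lborel. h x \<noteq> \<infinity>"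
  proof -
    have "AE x in lborel. h x * indicator {- real n..real n} x \<noteq> \<infinity>" for n
      by (rule nn_integral_noteq_infinite) (use h_int[of "- real n" "real n"] in auto)
    then have "AE x in lborel. \<forall>n. h x * indicator {- real n..real n} x \<noteq> \<infinity>"
      by (simp add: AE_all_countable)
    then show ?thesis
    proof (eventually_elim)
      case (elim x)
      obtain n where "\<bar>x\<bar> \<le> real n" using real_arch_simple by blast
      then show ?case using elim[rule_format, of n] by (auto simp: abs_le_iff)
    qed
  qed
  have "((\<lambda>x. k x * indicator {a..b} x) has_integral (F b - F a)) UNIV" if "a \<le> b" for a b
  proof (rule nn_integral_has_integral)
    have "(\<integral>\<^sup>+ x. ennreal (k x * indicator {a..b} x) \<partial>lborel) = (\<integral>\<^sup>+ x. h x * indicator {a..b} x \<partial>lborel)"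
      by (rule nn_integral_cong_AE) (use finite_ae in eventually_elim, auto simp: k_def indicator_def less_top)
    then show "(\<integral>\<^sup>+ x. ennreal (k x * indicator {a..b} x) \<partial>lborel) = ennreal (F b - F a)"
      using h_int that by simp
  qed (use that F_lower[OF that] in \<open>auto simp: k_def\<close>)
  moreover have "(\<lambda>x. k x * indicator {a..b} x) = (\<lambda>x. if x \<in> {a..b} then k x else 0)" for a b
    by auto
  ultimately have k_int: "(k has_integral (F b - F a)) {a..b}" if "a \<le> b" for a b
    using that by (simp only: has_integral_restrict_UNIV)
  show thesis
  proof (rule that)
    show "((\<lambda>x. k x - (L + 1)) has_integral g b - g a) {a..b}" if "a \<le> b" for a b
    proof -
      have "((\<lambda>x. k x - (L + 1)) has_integral (F b - F a) - (b - a) *\<^sub>R (L + 1)) {a..b}"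
        using that has_integral_const_real by (intro has_integral_diff k_int) (auto intro!: has_integral_const_real[THEN has_integral_eq_rhs])
      then show ?thesis by (simp add: F_def algebra_simps)
    qed
  qed
qed

text \<open>\<open>integrable_ccontinuous_explicit\<close> handles averages over
  \<open>[x, x + h]\<close>, which gives the right-hand derivative of \<open>g\<close>; the
  reflected density \<open>k (- x)\<close> turns left-hand increments into averages of the same
  kind.\<close>

lemma lipschitz_real_differentiable_ae:
  fixes g :: "real \<Rightarrow> real"
  assumes lip: "\<And>x y. \<bar>g x - g y\<bar> \<le> L * \<bar>x - y\<bar>"
  obtains N where "negligible N"
    "\<And>x. x \<notin> N \<Longrightarrow> \<exists>D. \<forall>e>0. \<exists>d>0. \<forall>t. \<bar>t\<bar> < d \<longrightarrow> \<bar>g (x + t) - g x - t * D\<bar> \<le> e * \<bar>t\<bar>"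
proof -
  obtain k where k: "\<And>a b. a \<le> b \<Longrightarrow> (k has_integral g b - g a) {a..b}"
    using lipschitz_real_density[OF lip] by blast
  have k': "((\<lambda>x. k (- x)) has_integral g (- a) - g (- b)) {a..b}" if "a \<le> b" for a b
    using k[of "- b" "- a"] that has_integral_reflect_real[of k _ "- a" "- b"] by (simp del: has_integral_reflect_real)
  have int1: "k integrable_on cbox a b" for a b
    using k[of a b] by (cases "a \<le> b") (auto intro: has_integral_integrable)
  have int2: "(\<lambda>x. k (- x)) integrable_on cbox a b" for a b
    using k'[of a b] by (cases "a \<le> b") (auto intro: has_integral_integrable)
  obtain N1 where N1: "negligible N1" "\<And>x e. \<lbrakk>x \<notin> N1; 0 < e\<rbrakk> \<Longrightarrow>
      \<exists>d>0. \<forall>h. 0 < h \<and> h < d \<longrightarrow> norm (integral (cbox x (x + h *\<^sub>R One)) k /\<^sub>R h ^ DIM(real) - k x) < e"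
    using integrable_ccontinuous_explicit[OF int1] by blast
  obtain N2 where N2: "negligible N2" "\<And>x e. \<lbrakk>x \<notin> N2; 0 < e\<rbrakk> \<Longrightarrow>
      \<exists>d>0. \<forall>h. 0 < h \<and> h < d \<longrightarrow> norm (integral (cbox x (x + h *\<^sub>R One)) (\<lambda>x. k (- x)) /\<^sub>R h ^ DIM(real) - k (- x)) < e"
    using integrable_ccontinuous_explicit[OF int2] by blast
  show thesis
  proof
    show "negligible (N1 \<union> uminus ` N2)"
      using N1(1) negligible_Lipschitz_image[OF N2(1), of uminus 1] by (simp add: norm_minus_commute)
    fix x assume "x \<notin> N1 \<union> uminus ` N2"
    then have x: "x \<notin> N1" "- x \<notin> N2" by force+
    show "\<exists>D. \<forall>e>0. \<exists>d>0. \<forall>t. \<bar>t\<bar> < d \<longrightarrow> \<bar>g (x + t) - g x - t * D\<bar> \<le> e * \<bar>t\<bar>"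
    proof (rule exI[of _ "k x"], intro allI impI)
      fix e :: real assume "e > 0"
      from N1(2)[OF x(1) this] N2(2)[OF x(2) this] obtain d1 d2
        where d1: "d1 > 0" "\<And>h. 0 < h \<Longrightarrow> h < d1 \<Longrightarrow> norm (integral (cbox x (x + h *\<^sub>R One)) k /\<^sub>R h ^ DIM(real) - k x) < e"
          and d2: "d2 > 0" "\<And>h. 0 < h \<Longrightarrow> h < d2 \<Longrightarrow> norm (integral (cbox (- x) (- x + h *\<^sub>R One)) (\<lambda>x. k (- x)) /\<^sub>R h ^ DIM(real) - k x) < e"
        by auto
      have r: "\<bar>g (x + h) - g x - h * k x\<bar> \<le> e * h" if "0 < h" "h < d1" for h
      proof -
        have "\<bar>(g (x + h) - g x) / h - k x\<bar> < e"
          using d1(2)[OF that] that integral_unique[OF k[of x "x + h"]] by (simp add: divide_inverse mult.commute)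
        then have "\<bar>(g (x + h) - g x) / h - k x\<bar> * h \<le> e * h" using that by simp
        moreover have "g (x + h) - g x - h * k x = ((g (x + h) - g x) / h - k x) * h"
          using that by (simp add: field_simps)
        ultimately show ?thesis using that by (simp add: abs_mult)
      qed
      have l: "\<bar>g (x - h) - g x + h * k x\<bar> \<le> e * h" if "0 < h" "h < d2" for h
      proof -
        have "\<bar>(g x - g (x - h)) / h - k x\<bar> < e"
          using d2(2)[OF that] that integral_unique[OF k'[of "- x" "- x + h"]] by (simp add: divide_inverse mult.commute)
        then have "\<bar>(g x - g (x - h)) / h - k x\<bar> * h \<le> e * h" using that by simp
        moreover have "g (x - h) - g x + h * k x = - (((g x - g (x - h)) / h - k x) * h)"
          using that by (simp add: field_simps)
        ultimately show ?thesis using that by (simp add: abs_mult)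
      qed
      show "\<exists>d>0. \<forall>t. \<bar>t\<bar> < d \<longrightarrow> \<bar>g (x + t) - g x - t * k x\<bar> \<le> e * \<bar>t\<bar>"
      proof (intro exI conjI allI impI)
        show "min d1 d2 > 0" using d1 d2 by simp
        fix t assume "\<bar>t\<bar> < min d1 d2"
        then show "\<bar>g (x + t) - g x - t * k x\<bar> \<le> e * \<bar>t\<bar>"
          using r[of t] l[of "- t"] by (cases t "0::real" rule: linorder_cases) auto
      qed
    qed
  qed
qed

section \<open>Fubini along lines and density points\<close>

text \<open>Translation invariance replaces a change of coordinates: the measure of \<open>S\<close>
  is the average of the measures of its translates along \<open>v\<close> for \<open>t\<close> in
  \<open>[0, 1]\<close>, and Fubini turns this into an integral of line measures, all zero.\<close>

lemma negligible_if_negligible_lines: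
  fixes S :: "'a::euclidean_space set"
  assumes [measurable]: "S \<in> sets borel"
    and lines: "\<And>z. negligible {t::real. z + t *\<^sub>R v \<in> S}"
  shows "negligible S"
proof -
  have line0: "(\<integral>\<^sup>+t. indicator {0..1} t * indicator S (z + t *\<^sub>R v) \<partial>lborel) = 0" for z :: 'a
  proof -
    have meas: "{t::real. z + t *\<^sub>R v \<in> S} \<in> sets borel"
      by measurable
    have "{t::real. z + t *\<^sub>R v \<in> S} \<in> null_sets lborel"
      using lines[of z] meas by (simp add: negligible_iff_null_sets null_sets_def)
    then have "AE t in lborel. t \<notin> {t::real. z + t *\<^sub>R v \<in> S}"
      by (rule AE_not_in)
    then have "AE t in lborel. indicator {0..1} t * indicator S (z + t *\<^sub>R v) = (0::ennreal)"
      by eventually_elim auto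
    then show ?thesis
      by (subst nn_integral_0_iff_AE) auto
  qed
  have transl: "(\<integral>\<^sup>+z. indicator S (z + t *\<^sub>R v) \<partial>lborel) = emeasure lborel S" for t :: real
  proof -
    have "emeasure lborel S = emeasure (distr lborel borel ((+) (t *\<^sub>R v))) S"
      by (simp add: lborel_distr_plus)
    also have "\<dots> = (\<integral>\<^sup>+z. indicator S z \<partial>distr lborel borel ((+) (t *\<^sub>R v)))"
      by simp
    also have "\<dots> = (\<integral>\<^sup>+z. indicator S (t *\<^sub>R v + z) \<partial>lborel)"
      by (subst nn_integral_distr) auto
    finally show ?thesis by (simp add: add.commute)
  qed
  have "emeasure lborel S = (\<integral>\<^sup>+t. indicator {0..1::real} t * emeasure lborel S \<partial>lborel)"
    by (simp add: nn_integral_multc)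
  also have "\<dots> = (\<integral>\<^sup>+t. \<integral>\<^sup>+z. indicator {0..1::real} t * indicator S (z + t *\<^sub>R v) \<partial>lborel \<partial>lborel)"
    by (subst nn_integral_cmult) (auto simp: transl)
  also have "\<dots> = (\<integral>\<^sup>+z. \<integral>\<^sup>+t. indicator {0..1::real} t * indicator S (z + t *\<^sub>R v) \<partial>lborel \<partial>lborel)"
    by (rule lborel_pair.Fubini') measurable
  also have "\<dots> = 0"
    by (simp add: line0)
  finally have "S \<in> null_sets lborel"
    by (simp add: null_sets_def)
  then show ?thesis
    by (simp add: negligible_iff_null_sets null_sets_completionI)
qed

definition reflect_along :: "'a::euclidean_space set \<Rightarrow> 'a \<Rightarrow> 'a" where
  "reflect_along B x = (\<Sum>b\<in>Basis. (if b \<in> B then - (x \<bullet> b) else x \<bullet> b) *\<^sub>R b)"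

lemma inner_reflect_along:
  "b \<in> Basis \<Longrightarrow> reflect_along B x \<bullet> b = (if b \<in> B then - (x \<bullet> b) else x \<bullet> b)"
  unfolding reflect_along_def by (simp add: inner_sum_left_Basis)

lemma reflect_along_involution [simp]: "reflect_along B (reflect_along B x) = x"
  by (rule euclidean_eqI) (simp add: inner_reflect_along)

lemma reflect_along_diff: "reflect_along B x - reflect_along B y = reflect_along B (x - y)"
  by (rule euclidean_eqI) (simp add: inner_reflect_along inner_diff_left)

lemma norm_reflect_along [simp]: "norm (reflect_along B x) = norm x"
  by (subst (1 2) norm_eq_sqrt_inner, subst (1 2) euclidean_inner) (auto intro!: sum.cong simp: inner_reflect_along)

lemma continuous_on_reflect_along: "continuous_on S (reflect_along B)"
proof (rule lipschitz_on_continuous_on)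
  show "1-lipschitz_on S (reflect_along B)"
    by (rule lipschitz_onI) (simp_all add: dist_norm reflect_along_diff)
qed

text \<open>The library's differentiation theorem averages over cubes that have the point as a corner;
  the reflections give all the corners.\<close>

lemma closed_set_thick_ae:
  fixes C :: "'a::euclidean_space set"
  assumes "closed C"
  obtains N where "negligible N"
    "\<And>z e. z \<in> C \<Longrightarrow> z \<notin> N \<Longrightarrow> e > 0 \<Longrightarrow>
       \<exists>d>0. \<forall>h. norm h < d \<longrightarrow> (\<exists>c\<in>C. norm (z + h - c) \<le> e * norm h)"
proof -
  define D where "D B = {x. reflect_along B x \<in> C}" for B :: "'a set"
  have closed: "closed (D B)" for B
  proof -
    have "D B = reflect_along B -` C" by (auto simp: D_def)
    then show ?thesis
      using continuous_closed_vimage[OF assms, of "reflect_along B"] continuous_on_reflect_along[of UNIV B]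
      by (simp add: continuous_on_eq_continuous_at)
  qed
  have int: "indicat_real (D B) integrable_on cbox a b" for B a b
    unfolding integrable_on_indicator
    by (rule lmeasurable_compact) (use closed[of B] in \<open>simp add: closed_Int_compact\<close>)
  have "\<forall>B. \<exists>N. negligible N \<and> (\<forall>x e. x \<notin> N \<longrightarrow> 0 < e \<longrightarrow> (\<exists>d>0. \<forall>h. 0 < h \<and> h < d \<longrightarrow>
      norm (integral (cbox x (x + h *\<^sub>R One)) (indicat_real (D B)) /\<^sub>R h ^ DIM('a) - indicat_real (D B) x) < e))"
    using integrable_ccontinuous_explicit[OF int] by metis
  then obtain N where N: "\<And>B. negligible (N B)"
    "\<And>B x e. x \<notin> N B \<Longrightarrow> 0 < e \<Longrightarrow> \<exists>d>0. \<forall>h. 0 < h \<and> h < d \<longrightarrow>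
      norm (integral (cbox x (x + h *\<^sub>R One)) (indicat_real (D B)) /\<^sub>R h ^ DIM('a) - indicat_real (D B) x) < e"
    by metis
  define N' where "N' = (\<Union>B\<in>Pow Basis. reflect_along B ` N B)"
  show thesis
  proof
    show "negligible N'"
      unfolding N'_def
      by (intro negligible_Union) (auto intro!: negligible_Lipschitz_image[OF N(1), where B = 1] simp: reflect_along_diff)
    fix z and e :: real assume z: "z \<in> C" "z \<notin> N'" and "e > 0"
    define e1 where "e1 = min e 1"
    have e1: "0 < e1" "e1 \<le> 1" "e1 \<le> e" using \<open>e > 0\<close> by (auto simp: e1_def)
    define n where "n = real DIM('a)"
    have n1: "n \<ge> 1" using DIM_positive[where 'a='a] unfolding n_def by linarith
    \<comment> \<open>The volume fraction of a cube of side \<open>t\<close> inside one of side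
      \<open>H\<close> (both below): if the small cube missed the set, the average would drop to
      \<open>1 - \<epsilon>\<close>.\<close>
    define \<epsilon> where "\<epsilon> = (e1 / (2 * n)) ^ DIM('a)"
    have "\<epsilon> > 0" using e1 n1 by (simp add: \<epsilon>_def)
    have "\<forall>B\<in>Pow Basis. \<exists>d>0. \<forall>h. 0 < h \<and> h < d \<longrightarrow>
      norm (integral (cbox (reflect_along B z) (reflect_along B z + h *\<^sub>R One)) (indicat_real (D B)) /\<^sub>R h ^ DIM('a) - indicat_real (D B) (reflect_along B z)) < \<epsilon>"
    proof
      fix B :: "'a set" assume B: "B \<in> Pow Basis"
      have "reflect_along B z \<notin> N B"
        using z(2) B unfolding N'_def by (metis UN_I image_eqI reflect_along_involution)
      from N(2)[OF this \<open>\<epsilon> > 0\<close>] show "\<exists>d>0. \<forall>h. 0 < h \<and> h < d \<longrightarrow>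
      norm (integral (cbox (reflect_along B z) (reflect_along B z + h *\<^sub>R One)) (indicat_real (D B)) /\<^sub>R h ^ DIM('a) - indicat_real (D B) (reflect_along B z)) < \<epsilon>" .
    qed
    then obtain d where d: "\<And>B. B \<in> Pow Basis \<Longrightarrow> d B > 0"
      "\<And>B h. B \<in> Pow Basis \<Longrightarrow> 0 < h \<Longrightarrow> h < d B \<Longrightarrow>
       norm (integral (cbox (reflect_along B z) (reflect_along B z + h *\<^sub>R One)) (indicat_real (D B)) /\<^sub>R h ^ DIM('a) - indicat_real (D B) (reflect_along B z)) < \<epsilon>"
      by metis
    define d0 where "d0 = Min (d ` Pow Basis)"
    have d0: "d0 > 0" "\<And>B. B \<in> Pow Basis \<Longrightarrow> d0 \<le> d B"
      using d(1) unfolding d0_def by (subst Min_gr_iff) auto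
    show "\<exists>d>0. \<forall>h. norm h < d \<longrightarrow> (\<exists>c\<in>C. norm (z + h - c) \<le> e * norm h)"
    proof (intro exI[of _ "d0 / 2"] conjI allI impI)
      show "d0 / 2 > 0" using d0 by simp
      fix h :: 'a assume h: "norm h < d0 / 2"
      show "\<exists>c\<in>C. norm (z + h - c) \<le> e * norm h"
      proof (cases "h = 0")
        case True then show ?thesis using z by (intro bexI[of _ z]) auto
      next
        case False
        \<comment> \<open>Reflecting the coordinates in which \<open>h\<close> is negative makes all
          coordinates of \<open>k\<close> nonnegative, so the cube of side \<open>t\<close> at
          \<open>w + k\<close> fits into the averaging cube of side \<open>H\<close> at
          \<open>w\<close>. This uses \<open>t \<le> norm h\<close>, hence
          \<open>e1 \<le> 1\<close>.\<close>
        define B where "B = {b\<in>Basis. h \<bullet> b < 0}"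
        have B: "B \<in> Pow Basis" by (auto simp: B_def)
        define w where "w = reflect_along B z"
        define k where "k = reflect_along B h"
        have k0: "0 \<le> k \<bullet> b" "k \<bullet> b \<le> norm h" if "b \<in> Basis" for b
          using that Basis_le_norm[OF that, of h] by (auto simp: k_def inner_reflect_along B_def)
        define t where "t = e1 / n * norm h"
        define H where "H = 2 * norm h"
        have tH: "0 < t" "t \<le> norm h" "0 < H" "H < d B"
          using e1 n1 False h d0(2)[OF B] by (auto simp: t_def H_def mult_le_cancel_right1 divide_le_eq)
        have small: "cbox (w + k) (w + k + t *\<^sub>R One) \<subseteq> cbox w (w + H *\<^sub>R One)"
          using k0 tH(2) unfolding subset_box by (force simp: inner_add_left H_def)
        have "\<exists>p \<in> cbox (w + k) (w + k + t *\<^sub>R One). p \<in> D B"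
        proof (rule ccontr)
          assume "\<not> ?thesis"
          then have out: "\<And>p. p \<in> cbox (w + k) (w + k + t *\<^sub>R One) \<Longrightarrow> p \<notin> D B" by blast
          let ?big = "cbox w (w + H *\<^sub>R One)" and ?sm = "cbox (w + k) (w + k + t *\<^sub>R One)"
          have "((\<lambda>x. 1) has_integral H ^ DIM('a)) ?big"
            using has_integral_const[of "1::real" w "w + H *\<^sub>R One"] tH by (simp add: content_cbox inner_add_left)
          moreover have "((\<lambda>x. if x \<in> ?sm then 1 else 0) has_integral t ^ DIM('a)) ?big"
            using has_integral_const[of "1::real" "w + k" "w + k + t *\<^sub>R One"] tH
            by (subst has_integral_restrict[OF small]) (simp add: content_cbox inner_add_left)
          ultimately have "((\<lambda>x. 1 - (if x \<in> ?sm then 1 else 0)) has_integral H ^ DIM('a) - t ^ DIM('a)) ?big"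
            by (rule has_integral_diff)
          then have "integral ?big (indicat_real (D B)) \<le> H ^ DIM('a) - t ^ DIM('a)"
            by (rule has_integral_le[OF integrable_integral[OF int]]) (use out in \<open>auto simp: indicator_def\<close>)
          then have "integral ?big (indicat_real (D B)) / H ^ DIM('a) \<le> (H ^ DIM('a) - t ^ DIM('a)) / H ^ DIM('a)"
            using tH by (intro divide_right_mono) auto
          also have "\<dots> = 1 - (t / H) ^ DIM('a)"
            using tH by (simp add: diff_divide_distrib power_divide)
          also have "t / H = e1 / (2 * n)"
            using False by (simp add: t_def H_def)
          finally have "integral ?big (indicat_real (D B)) / H ^ DIM('a) \<le> 1 - \<epsilon>"
            by (simp add: \<epsilon>_def)
          moreover have "norm (integral ?big (indicat_real (D B)) /\<^sub>R H ^ DIM('a) - 1) < \<epsilon>"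
            using d(2)[OF B tH(3,4)] z(1) by (simp add: w_def D_def)
          ultimately show False
            by (simp add: divide_inverse mult.commute abs_less_iff)
        qed
        then obtain p where p: "p \<in> cbox (w + k) (w + k + t *\<^sub>R One)" "reflect_along B p \<in> C"
          by (auto simp: D_def)
        have "z + h - reflect_along B p = reflect_along B (w + k - p)"
          unfolding w_def k_def
          by (rule euclidean_eqI) (auto simp: inner_reflect_along inner_add_left inner_diff_left)
        then have "norm (z + h - reflect_along B p) = norm (w + k - p)" by simp
        also have "\<dots> \<le> (\<Sum>b\<in>Basis. \<bar>(w + k - p) \<bullet> b\<bar>)" by (rule norm_le_l1)
        also have "\<dots> \<le> (\<Sum>b\<in>(Basis :: 'a set). t)"
          using p(1) by (intro sum_mono) (force simp: mem_box inner_add_left inner_diff_left)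
        also have "\<dots> = e1 * norm h"
          using n1 by (simp add: t_def n_def)
        also have "\<dots> \<le> e * norm h"
          using e1 by (simp add: mult_right_mono)
        finally show ?thesis using p(2) by blast
      qed
    qed
  qed
qed

section \<open>From partial approximations to the gradient\<close>

text \<open>The vector \<open>q\<close> serves as gradient along the directions in \<open>B\<close>,
  with accuracy 1/(k+1) for all steps up to 1/(m+1). Fixing accuracy and scale makes the set closed,
  so that countable unions are Borel and density points can be taken.\<close>

definition partial_approx :: "('a::euclidean_space \<Rightarrow> real) \<Rightarrow> 'a set \<Rightarrow> 'a \<Rightarrow> nat \<Rightarrow> nat \<Rightarrow> 'a set" where
  "partial_approx f B q k m = {z. \<forall>b\<in>B. \<forall>t. \<bar>t\<bar> \<le> 1 / Suc m \<longrightarrow>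
     \<bar>f (z + t *\<^sub>R b) - f z - t * (q \<bullet> b)\<bar> \<le> \<bar>t\<bar> / Suc k}"

lemma closed_partial_approx:
  assumes "continuous_on UNIV f"
  shows "closed (partial_approx f B q k m)"
proof -
  have "continuous_on UNIV (\<lambda>z. f (z + t *\<^sub>R b))" for t b
    by (rule continuous_on_compose2[OF assms]) (auto intro!: continuous_intros)
  then have "closed {z. \<bar>f (z + t *\<^sub>R b) - f z - t * (q \<bullet> b)\<bar> \<le> \<bar>t\<bar> / Suc k}" for t b
    using assms by (intro closed_Collect_le continuous_intros)
  then have "closed (\<Inter>b\<in>B. \<Inter>t\<in>{t. \<bar>t\<bar> \<le> 1 / Suc m}. {z. \<bar>f (z + t *\<^sub>R b) - f z - t * (q \<bullet> b)\<bar> \<le> \<bar>t\<bar> / Suc k})"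
    by (intro closed_INT ballI)
  moreover have "partial_approx f B q k m = (\<Inter>b\<in>B. \<Inter>t\<in>{t. \<bar>t\<bar> \<le> 1 / Suc m}. {z. \<bar>f (z + t *\<^sub>R b) - f z - t * (q \<bullet> b)\<bar> \<le> \<bar>t\<bar> / Suc k})"
    by (auto simp: partial_approx_def)
  ultimately show ?thesis by simp
qed

text \<open>On each line in direction \<open>b\<close> the one-dimensional theorem gives a
  derivative almost everywhere, and a rational \<open>r\<close> approximates it. Rational slopes
  keep the union countable, hence Borel, as the Fubini argument requires.\<close>

lemma lipschitz_partial_approx_ae:
  fixes f :: "'a::euclidean_space \<Rightarrow> real"
  assumes lip: "\<And>x y. \<bar>f x - f y\<bar> \<le> L * norm (x - y)" and "L \<ge> 0" and b: "b \<in> Basis"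
  shows "negligible (- (\<Union>r\<in>\<rat>. \<Union>m. partial_approx f {b} (r *\<^sub>R b) k m))"
proof (rule negligible_if_negligible_lines)
  have cont: "continuous_on UNIV f"
    by (rule lipschitz_on_continuous_on[of L]) (use lip \<open>L \<ge> 0\<close> in \<open>auto simp: lipschitz_on_def dist_norm\<close>)
  show "- (\<Union>r\<in>\<rat>. \<Union>m. partial_approx f {b} (r *\<^sub>R b) k m) \<in> sets borel"
  proof -
    have "(\<Union>m. partial_approx f {b} (r *\<^sub>R b) k m) \<in> sets borel" for r
      by (intro sets.countable_UN) (auto intro!: borel_closed closed_partial_approx cont)
    then show ?thesis
      using countable_rat by (intro borel_comp sets.countable_UN') auto
  qed
  show "negligible {t. z + t *\<^sub>R b \<in> - (\<Union>r\<in>\<rat>. \<Union>m. partial_approx f {b} (r *\<^sub>R b) k m)}" for z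
  proof -
    have "\<bar>f (z + s *\<^sub>R b) - f (z + t *\<^sub>R b)\<bar> \<le> L * \<bar>s - t\<bar>" for s t
      using lip[of "z + s *\<^sub>R b" "z + t *\<^sub>R b"] b by (simp flip: scaleR_diff_left)
    from lipschitz_real_differentiable_ae[where g = "\<lambda>t. f (z + t *\<^sub>R b)", OF this]
    obtain N where N: "negligible N" and der: "\<And>x. x \<notin> N \<Longrightarrow>
      \<exists>D. \<forall>e>0. \<exists>d>0. \<forall>t. \<bar>t\<bar> < d \<longrightarrow> \<bar>f (z + (x + t) *\<^sub>R b) - f (z + x *\<^sub>R b) - t * D\<bar> \<le> e * \<bar>t\<bar>"
      by blast
    have "{t. z + t *\<^sub>R b \<in> - (\<Union>r\<in>\<rat>. \<Union>m. partial_approx f {b} (r *\<^sub>R b) k m)} \<subseteq> N"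
    proof (clarify, rule ccontr)
      fix x assume x: "x \<notin> N" and bad: "z + x *\<^sub>R b \<notin> (\<Union>r\<in>\<rat>. \<Union>m. partial_approx f {b} (r *\<^sub>R b) k m)"
      obtain D where D: "\<And>e. e > 0 \<Longrightarrow> \<exists>d>0. \<forall>t. \<bar>t\<bar> < d \<longrightarrow>
          \<bar>f (z + (x + t) *\<^sub>R b) - f (z + x *\<^sub>R b) - t * D\<bar> \<le> e * \<bar>t\<bar>"
        using der[OF x] by blast
      \<comment> \<open>Half of the tolerance 1/(k+1): one half pays for the difference quotient,
        the other for replacing \<open>D\<close> by the rational \<open>r\<close>.\<close>
      define e where "e = 1 / (2 * real (Suc k))"
      have "e > 0" by (simp add: e_def)
      obtain d where d: "d > 0" "\<And>t. \<bar>t\<bar> < d \<Longrightarrow>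
          \<bar>f (z + (x + t) *\<^sub>R b) - f (z + x *\<^sub>R b) - t * D\<bar> \<le> e * \<bar>t\<bar>"
        using D[OF \<open>e > 0\<close>] by blast
      obtain r where r: "r \<in> \<rat>" "D - e < r" "r < D + e"
        using Rats_dense_in_real[of "D - e" "D + e"] \<open>e > 0\<close> by auto
      obtain m where m: "1 / real (Suc m) < d"
        using nat_approx_posE[OF d(1)] by blast
      have "z + x *\<^sub>R b \<in> partial_approx f {b} (r *\<^sub>R b) k m"
        unfolding partial_approx_def
      proof (clarsimp simp: b inner_commute)
        fix t :: real assume "\<bar>t\<bar> \<le> 1 / (1 + real m)"
        then have "\<bar>t\<bar> < d" using m by simp
        have "\<bar>t * D - t * r\<bar> \<le> \<bar>t\<bar> * e"
          unfolding right_diff_distrib[symmetric] abs_mult using r by (intro mult_left_mono) auto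
        then have "\<bar>f (z + (x + t) *\<^sub>R b) - f (z + x *\<^sub>R b) - t * r\<bar> \<le> e * \<bar>t\<bar> + \<bar>t\<bar> * e"
          using d(2)[OF \<open>\<bar>t\<bar> < d\<close>] by linarith
        also have "\<dots> = \<bar>t\<bar> * (2 * e)" by simp
        also have "2 * e = 1 / real (Suc k)" by (simp add: e_def del: of_nat_Suc)
        also have "\<bar>t\<bar> * (1 / real (Suc k)) = \<bar>t\<bar> / (1 + real k)" by simp
        finally show "\<bar>f (z + x *\<^sub>R b + t *\<^sub>R b) - f (z + x *\<^sub>R b) - t * r\<bar> \<le> \<bar>t\<bar> / (1 + real k)"
          by (simp add: scaleR_add_left add.assoc)
      qed
      then show False using bad r by blast
    qed
    then show ?thesis using N negligible_subset by blast
  qed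
qed

text \<open>The partial slopes at a point are collected into one vector, which is then moved into
  the dense set \<open>Q\<close>. The index \<open>Suc (2 * k)\<close> means accuracy 1/(2(k+1)),
  leaving an equal amount for the move.\<close>

lemma lipschitz_gradient_approx_ae:
  fixes f :: "'a::euclidean_space \<Rightarrow> real"
  assumes lip: "\<And>x y. \<bar>f x - f y\<bar> \<le> L * norm (x - y)" and "L \<ge> 0"
    and Q: "\<And>X. open X \<Longrightarrow> X \<noteq> {} \<Longrightarrow> \<exists>d\<in>Q. d \<in> (X :: 'a set)"
  shows "negligible (- (\<Union>q\<in>Q. \<Union>m. partial_approx f Basis q k m))"
proof (rule negligible_subset)
  show "negligible (\<Union>b\<in>Basis. - (\<Union>r\<in>\<rat>. \<Union>m. partial_approx f {b} (r *\<^sub>R b) (Suc (2 * k)) m))"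
  proof (rule negligible_Union)
    fix T assume "T \<in> (\<lambda>b. - (\<Union>r\<in>\<rat>. \<Union>m. partial_approx f {b} (r *\<^sub>R b) (Suc (2 * k)) m)) ` Basis"
    then show "negligible T"
      using lipschitz_partial_approx_ae[OF lip \<open>L \<ge> 0\<close>] by (elim imageE) (simp only:)
  qed simp
  show "- (\<Union>q\<in>Q. \<Union>m. partial_approx f Basis q k m) \<subseteq>
    (\<Union>b\<in>Basis. - (\<Union>r\<in>\<rat>. \<Union>m. partial_approx f {b} (r *\<^sub>R b) (Suc (2 * k)) m))"
  proof (rule ccontr)
    assume "\<not> ?thesis"
    then obtain z where z0: "z \<in> - (\<Union>q\<in>Q. \<Union>m. partial_approx f Basis q k m)"
      and z': "z \<notin> (\<Union>b\<in>Basis. - (\<Union>r\<in>\<rat>. \<Union>m. partial_approx f {b} (r *\<^sub>R b) (Suc (2 * k)) m))"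
      by (meson subsetI)
    have z: "z \<notin> (\<Union>q\<in>Q. \<Union>m. partial_approx f Basis q k m)"
      using z0 by (rule ComplD)
    have "\<forall>b\<in>Basis. \<exists>r m. z \<in> partial_approx f {b} (r *\<^sub>R b) (Suc (2 * k)) m"
    proof
      fix b :: 'a assume "b \<in> Basis"
      then have "z \<in> (\<Union>r\<in>\<rat>. \<Union>m. partial_approx f {b} (r *\<^sub>R b) (Suc (2 * k)) m)"
        using z' by (metis (no_types, lifting) ComplI UN_I)
      then show "\<exists>r m. z \<in> partial_approx f {b} (r *\<^sub>R b) (Suc (2 * k)) m" by (elim UN_E) iprover
    qed
    then obtain r m where rm: "\<And>b. b \<in> Basis \<Longrightarrow> z \<in> partial_approx f {b} (r b *\<^sub>R b) (Suc (2 * k)) (m b)"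
      by metis
    define q where "q = (\<Sum>b\<in>Basis. r b *\<^sub>R b)"
    obtain p where p: "p \<in> Q" "norm (q - p) < 1 / (2 * real (Suc k))"
      using Q[of "ball q (1 / (2 * real (Suc k)))"] by (auto simp: dist_norm)
    define M where "M = Max (m ` Basis)"
    have "z \<in> partial_approx f Basis p k M"
      unfolding partial_approx_def
    proof clarify
      fix b t assume b: "b \<in> (Basis :: 'a set)" and t: "\<bar>t\<bar> \<le> 1 / real (Suc M)"
      have "m b \<le> M" using b by (simp add: M_def)
      then have "1 / real (Suc M) \<le> 1 / real (Suc (m b))"
        by (intro divide_left_mono) auto
      then have "\<bar>f (z + t *\<^sub>R b) - f z - t * r b\<bar> \<le> \<bar>t\<bar> / real (Suc (Suc (2 * k)))"
        using rm[OF b] t b unfolding partial_approx_def by auto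
      also have "\<dots> = \<bar>t\<bar> * (1 / (2 * real (Suc k)))" by simp
      finally have 1: "\<bar>f (z + t *\<^sub>R b) - f z - t * r b\<bar> \<le> \<bar>t\<bar> * (1 / (2 * real (Suc k)))" .
      have "r b - p \<bullet> b = (q - p) \<bullet> b"
        using b by (simp add: q_def inner_diff_left inner_sum_left_Basis)
      then have "\<bar>r b - p \<bullet> b\<bar> \<le> 1 / (2 * real (Suc k))"
        using p(2) Basis_le_norm[OF b, of "q - p"] by simp
      then have "\<bar>t * r b - t * (p \<bullet> b)\<bar> \<le> \<bar>t\<bar> * (1 / (2 * real (Suc k)))"
        unfolding right_diff_distrib[symmetric] abs_mult by (intro mult_left_mono) auto
      with 1 have "\<bar>f (z + t *\<^sub>R b) - f z - t * (p \<bullet> b)\<bar> \<le> \<bar>t\<bar> * (1 / (2 * real (Suc k))) + \<bar>t\<bar> * (1 / (2 * real (Suc k)))"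
        by linarith
      also have "\<dots> = \<bar>t\<bar> / Suc k" by (simp del: of_nat_Suc)
      finally show "\<bar>f (z + t *\<^sub>R b) - f z - t * (p \<bullet> b)\<bar> \<le> \<bar>t\<bar> / Suc k" .
    qed
    then show False using z p(1) by blast
  qed
qed

text \<open>The increment \<open>h\<close> is walked one coordinate at a time. Corners of the path
  may leave the set, but thickness puts a point \<open>c\<close> of the set so near that the
  Lipschitz bound pays for the replacement. In units of |h|/(k+1), each end of a step costs 1/2 and
  the step itself 1, hence the factor 2 per coordinate.\<close>

lemma gradient_approx_at_thick_point:
  fixes f :: "'a::euclidean_space \<Rightarrow> real"
  assumes lip: "\<And>x y. \<bar>f x - f y\<bar> \<le> L * norm (x - y)" and "L \<ge> 0"
    and z: "z \<in> partial_approx f Basis q k m"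
    and thick: "\<And>e. e > 0 \<Longrightarrow> \<exists>d>0. \<forall>h. norm h < d \<longrightarrow> (\<exists>c\<in>partial_approx f Basis q k m. norm (z + h - c) \<le> e * norm h)"
  obtains d where "d > 0"
    "\<And>h. norm h < d \<Longrightarrow> \<bar>f (z + h) - f z - q \<bullet> h\<bar> \<le> 2 * real DIM('a) / Suc k * norm h"
proof -
  define n where "n = real DIM('a)"
  have n1: "n \<ge> 1" using DIM_positive[where 'a='a] unfolding n_def by linarith
  define K where "K = L + 1"
  have K: "K > 0" "L \<le> K" using \<open>L \<ge> 0\<close> by (auto simp: K_def)
  \<comment> \<open>Chosen so that \<open>K * (e * (n * norm h))\<close>, the cost of replacing a
    corner, equals |h|/(2(k+1)); \<open>K = L + 1\<close> avoids a division by zero when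
    \<open>L = 0\<close>.\<close>
  define e where "e = 1 / (2 * K * n * Suc k)"
  have "e > 0" using n1 K by (simp add: e_def)
  obtain d where d: "d > 0" "\<And>h. norm h < d \<Longrightarrow> \<exists>c\<in>partial_approx f Basis q k m. norm (z + h - c) \<le> e * norm h"
    using thick[OF \<open>e > 0\<close>] by blast
  define d' where "d' = min (d / n) (1 / Suc m)"
  show thesis
  proof
    show "d' > 0" using d(1) n1 by (simp add: d'_def)
    fix h :: 'a assume h: "norm h < d'"
    define hs where "hs S = (\<Sum>b\<in>S. (h \<bullet> b) *\<^sub>R b)" for S :: "'a set"
    have hs_bound: "norm (hs S) \<le> n * norm h" if "S \<subseteq> Basis" for S
    proof -
      have "norm (hs S) \<le> (\<Sum>b\<in>S. norm h)"
        unfolding hs_def by (rule sum_norm_le) (use that Basis_le_norm[of _ h] in auto)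
      also have "\<dots> \<le> n * norm h"
        using card_mono[OF finite_Basis that] by (simp add: n_def mult_right_mono)
      finally show ?thesis .
    qed
    have "\<bar>f (z + hs S) - f z - q \<bullet> hs S\<bar> \<le> card S * (2 * norm h / Suc k)" if "S \<subseteq> Basis" for S
      using finite_subset[OF that finite_Basis] that
    proof (induction S rule: finite_induct)
      case empty
      then show ?case by (simp add: hs_def)
    next
      case (insert b S)
      then have b: "b \<in> Basis" and S: "S \<subseteq> Basis" by auto
      have hs_insert: "hs (insert b S) = hs S + (h \<bullet> b) *\<^sub>R b"
        using insert.hyps by (simp add: hs_def add.commute)
      have "norm (hs S) < d"
        using hs_bound[OF S] h n1 by (auto simp: d'_def field_simps)
      then obtain c where c: "c \<in> partial_approx f Basis q k m" "norm (z + hs S - c) \<le> e * norm (hs S)"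
        using d(2) by blast
      have "norm (z + hs S - c) \<le> e * (n * norm h)"
        using c(2) hs_bound[OF S] \<open>e > 0\<close> by (meson mult_left_mono less_imp_le order_trans)
      then have "L * norm (z + hs S - c) \<le> K * (e * (n * norm h))"
        using K \<open>e > 0\<close> n1 by (intro mult_mono) auto
      also have "\<dots> = norm h / Suc k / 2"
        using K n1 by (simp add: e_def del: of_nat_Suc)
      finally have err: "L * norm (z + hs S - c) \<le> norm h / Suc k / 2" .
      define t where "t = h \<bullet> b"
      have t: "\<bar>t\<bar> \<le> norm h" using Basis_le_norm[OF b] by (simp add: t_def)
      then have "\<bar>t\<bar> \<le> 1 / Suc m" using h by (simp add: d'_def)
      then have "\<bar>f (c + t *\<^sub>R b) - f c - t * (q \<bullet> b)\<bar> \<le> \<bar>t\<bar> / Suc k"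
        using c(1) b by (simp add: partial_approx_def)
      also have "\<dots> \<le> norm h / Suc k" using t by (intro divide_right_mono) auto
      finally have 1: "\<bar>f (c + t *\<^sub>R b) - f c - t * (q \<bullet> b)\<bar> \<le> norm h / Suc k" .
      have 2: "\<bar>f (z + hs S) - f c\<bar> \<le> norm h / Suc k / 2"
        using lip[of "z + hs S" c] err by linarith
      have 3: "\<bar>f (z + hs (insert b S)) - f (c + t *\<^sub>R b)\<bar> \<le> norm h / Suc k / 2"
        using lip[of "z + hs (insert b S)" "c + t *\<^sub>R b"] err
        by (simp add: hs_insert t_def algebra_simps)
      have 4: "\<bar>f (z + hs S) - f z - q \<bullet> hs S\<bar> \<le> card S * (2 * norm h / Suc k)"
        using insert.IH S by blast
      have "q \<bullet> hs (insert b S) = q \<bullet> hs S + t * (q \<bullet> b)"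
        by (simp add: hs_insert inner_add_right t_def)
      then have eq: "f (z + hs (insert b S)) - f z - q \<bullet> hs (insert b S) =
          (f (z + hs (insert b S)) - f (c + t *\<^sub>R b)) + (f (c + t *\<^sub>R b) - f c - t * (q \<bullet> b))
          - (f (z + hs S) - f c) + (f (z + hs S) - f z - q \<bullet> hs S)"
        by simp
      have sum4: "\<bar>x1 + x2 - x3 + x4\<bar> \<le> y4 + 2 * y"
        if "\<bar>x1\<bar> \<le> y / 2" "\<bar>x2\<bar> \<le> y" "\<bar>x3\<bar> \<le> y / 2" "\<bar>x4\<bar> \<le> y4" for x1 x2 x3 x4 y y4 :: real
        using that by linarith
      have "\<bar>f (z + hs (insert b S)) - f z - q \<bullet> hs (insert b S)\<bar>
         \<le> card S * (2 * norm h / Suc k) + 2 * (norm h / Suc k)"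
        unfolding eq by (rule sum4[OF 3 1 2 4])
      also have "\<dots> = card (insert b S) * (2 * norm h / Suc k)"
        using insert.hyps by (simp add: algebra_simps add_divide_distrib)
      finally show ?case .
    qed
    from this[of Basis] have "\<bar>f (z + hs Basis) - f z - q \<bullet> hs Basis\<bar> \<le> n * (2 * norm h / Suc k)"
      by (simp add: n_def)
    moreover have "hs Basis = h" by (simp add: hs_def euclidean_representation)
    ultimately show "\<bar>f (z + h) - f z - q \<bullet> h\<bar> \<le> 2 * real DIM('a) / Suc k * norm h"
      by (simp add: n_def mult_ac)
  qed
qed

text \<open>The approximating vector may change with the accuracy. Two of them, tested on a short
  multiple of their difference, differ by at most the sum of their accuracies; so they form a Cauchy
  sequence, and its limit is the gradient.\<close>

lemma differentiable_if_affine_approx: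
  fixes f :: "'a::euclidean_space \<Rightarrow> real"
  assumes "\<And>e. e > 0 \<Longrightarrow> \<exists>q. \<exists>d>0. \<forall>h. norm h < d \<longrightarrow> \<bar>f (z + h) - f z - q \<bullet> h\<bar> \<le> e * norm h"
  shows "f differentiable (at z)"
proof -
  have "\<forall>j. \<exists>q d. d > 0 \<and> (\<forall>h. norm h < d \<longrightarrow> \<bar>f (z + h) - f z - q \<bullet> h\<bar> \<le> 1 / Suc j * norm h)"
    using assms[of "1 / Suc _"] by (metis of_nat_0_less_iff zero_less_Suc zero_less_divide_1_iff)
  then obtain q d where d: "\<And>j. d j > 0"
    and q: "\<And>j h. norm h < d j \<Longrightarrow> \<bar>f (z + h) - f z - q j \<bullet> h\<bar> \<le> 1 / Suc j * norm h"
    by metis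
  have qd: "norm (q i - q j) \<le> 1 / Suc i + 1 / Suc j" for i j
  proof (cases "q i = q j")
    case False
    define v where "v = q i - q j"
    have "v \<noteq> 0" using False by (simp add: v_def)
    define s where "s = min (d i) (d j) / (2 * norm v)"
    have s: "s > 0" using d[of i] d[of j] \<open>v \<noteq> 0\<close> by (simp add: s_def)
    have "norm (s *\<^sub>R v) = min (d i) (d j) / 2"
    proof -
      have "norm (s *\<^sub>R v) = s * norm v" using s by simp
      also have "\<dots> = min (d i) (d j) / 2" using \<open>v \<noteq> 0\<close> by (simp add: s_def)
      finally show ?thesis .
    qed
    then have "norm (s *\<^sub>R v) < d i" "norm (s *\<^sub>R v) < d j"
      using d[of i] d[of j] by auto
    from q[OF this(1)] q[OF this(2)]
    have "\<bar>q i \<bullet> (s *\<^sub>R v) - q j \<bullet> (s *\<^sub>R v)\<bar> \<le> (1 / Suc i + 1 / Suc j) * norm (s *\<^sub>R v)"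
      unfolding distrib_right by linarith
    also have "q i \<bullet> (s *\<^sub>R v) - q j \<bullet> (s *\<^sub>R v) = s * (norm v * norm v)"
      by (simp add: v_def inner_diff_left[symmetric] right_diff_distrib[symmetric] dot_square_norm power2_eq_square del: inner_diff_left)
    finally have "s * (norm v * norm v) \<le> (1 / Suc i + 1 / Suc j) * (s * norm v)"
      using s by simp
    then have "(s * norm v) * norm v \<le> (s * norm v) * (1 / Suc i + 1 / Suc j)"
      by (simp add: mult_ac)
    then show ?thesis
      using s \<open>v \<noteq> 0\<close> unfolding v_def[symmetric] by (subst (asm) mult_le_cancel_left_pos) auto
  qed simp
  have "Cauchy q"
  proof (rule CauchyI)
    fix e :: real assume "e > 0"
    then obtain M where M: "1 / real (Suc M) < e / 2"
      using nat_approx_posE[of "e / 2"] by auto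
    have "norm (q m - q n) < e" if "m \<ge> M" "n \<ge> M" for m n
    proof -
      have "1 / real (Suc m) \<le> 1 / Suc M" "1 / real (Suc n) \<le> 1 / Suc M"
        using that by (auto intro!: divide_left_mono)
      then show ?thesis using qd[of m n] M by linarith
    qed
    then show "\<exists>M. \<forall>m\<ge>M. \<forall>n\<ge>M. norm (q m - q n) < e" by blast
  qed
  then obtain p where p: "q \<longlonglongrightarrow> p"
    using Cauchy_convergent convergent_def by blast
  have pq: "norm (p - q i) \<le> 1 / Suc i + 0" for i
  proof (rule LIMSEQ_le)
    show "(\<lambda>j. norm (q j - q i)) \<longlonglongrightarrow> norm (p - q i)"
      by (intro tendsto_intros p)
    show "(\<lambda>j. 1 / Suc i + 1 / Suc j) \<longlonglongrightarrow> 1 / Suc i + 0"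
      using LIMSEQ_inverse_real_of_nat by (intro tendsto_intros) (simp add: inverse_eq_divide)
    show "\<exists>N. \<forall>n\<ge>N. norm (q n - q i) \<le> 1 / Suc i + 1 / Suc n"
      using qd by (metis add.commute)
  qed
  have "(f has_derivative (\<lambda>h. p \<bullet> h)) (at z)"
    unfolding has_derivative_at_alt
  proof (intro conjI allI impI)
    show "bounded_linear ((\<bullet>) p)" by (rule bounded_linear_inner_right)
    fix e :: real assume "e > 0"
    then obtain j where j: "1 / real (Suc j) < e / 2"
      using nat_approx_posE[of "e / 2"] by auto
    have "norm (f y - f z - p \<bullet> (y - z)) \<le> e * norm (y - z)" if "norm (y - z) < d j" for y
    proof -
      have "\<bar>(p - q j) \<bullet> (y - z)\<bar> \<le> 1 / Suc j * norm (y - z)"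
        using pq[of j] by (intro order_trans[OF Cauchy_Schwarz_ineq2] mult_right_mono) auto
      moreover have "\<bar>f y - f z - q j \<bullet> (y - z)\<bar> \<le> 1 / Suc j * norm (y - z)"
        using q[OF that] by simp
      ultimately have "\<bar>f y - f z - p \<bullet> (y - z)\<bar> \<le> (1 / Suc j + 1 / Suc j) * norm (y - z)"
        unfolding distrib_right inner_diff_left by linarith
      also have "\<dots> \<le> e * norm (y - z)"
        using j by (intro mult_right_mono) auto
      finally show ?thesis by simp
    qed
    then show "\<exists>d>0. \<forall>y. norm (y - z) < d \<longrightarrow> norm (f y - f z - p \<bullet> (y - z)) \<le> e * norm (y - z)"
      using d by blast
  qed
  then show ?thesis by (auto simp: differentiable_def)
qed

text \<open>The exceptional set collects the points without an approximant at some accuracy and the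
  thin points of each \<open>partial_approx f Basis q k m\<close>. Taking \<open>q\<close> from a
  countable dense \<open>Q\<close> makes it a countable union of null sets.\<close>

lemma Rademacher_real:
  fixes f :: "'a::euclidean_space \<Rightarrow> real"
  assumes lip: "\<And>x y. \<bar>f x - f y\<bar> \<le> L * norm (x - y)" and "L \<ge> 0"
  shows "negligible {z. \<not> f differentiable (at z)}"
proof -
  obtain Q :: "'a set" where Q: "countable Q" "\<And>X. open X \<Longrightarrow> X \<noteq> {} \<Longrightarrow> \<exists>d\<in>Q. d \<in> X"
    using countable_dense_setE by blast
  have cont: "continuous_on UNIV f"
    by (rule lipschitz_on_continuous_on[of L]) (use lip \<open>L \<ge> 0\<close> in \<open>auto simp: lipschitz_on_def dist_norm\<close>)
  have "\<forall>q k m. \<exists>N. negligible N \<and> (\<forall>z e. z \<in> partial_approx f Basis q k m \<longrightarrow> z \<notin> N \<longrightarrow> e > 0 \<longrightarrow>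
       (\<exists>d>0. \<forall>h. norm h < d \<longrightarrow> (\<exists>c\<in>partial_approx f Basis q k m. norm (z + h - c) \<le> e * norm h)))"
    using closed_set_thick_ae[OF closed_partial_approx[OF cont]] by metis
  then obtain N where N: "\<And>q k m. negligible (N q k m)"
    and thick: "\<And>q k m z e. z \<in> partial_approx f Basis q k m \<Longrightarrow> z \<notin> N q k m \<Longrightarrow> e > 0 \<Longrightarrow>
       \<exists>d>0. \<forall>h. norm h < d \<longrightarrow> (\<exists>c\<in>partial_approx f Basis q k m. norm (z + h - c) \<le> e * norm h)"
    by metis
  define N' where "N' = (\<Union>k. - (\<Union>q\<in>Q. \<Union>m. partial_approx f Basis q k m)) \<union> (\<Union>q\<in>Q. \<Union>k. \<Union>m. N q k m)"
  have "negligible N'"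
    unfolding N'_def
  proof (rule negligible_Un)
    show "negligible (\<Union>k. - (\<Union>q\<in>Q. \<Union>m. partial_approx f Basis q k m))"
      using lipschitz_gradient_approx_ae[OF lip \<open>L \<ge> 0\<close> Q(2)]
      by (intro negligible_countable_Union) blast+
    have 1: "negligible (\<Union>m. N q k m)" for q k
      using N by (intro negligible_countable_Union) auto
    have 2: "negligible (\<Union>k. \<Union>m. N q k m)" for q
      using 1 by (intro negligible_countable_Union) auto
    show "negligible (\<Union>q\<in>Q. \<Union>k. \<Union>m. N q k m)"
      using 2 Q(1) by (intro negligible_countable_Union) auto
  qed
  moreover have "f differentiable (at z)" if z: "z \<notin> N'" for z
  proof (rule differentiable_if_affine_approx)
    fix e :: real assume "e > 0"
    then have "e / (2 * real DIM('a)) > 0" by simp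
    then obtain k where k: "1 / real (Suc k) < e / (2 * real DIM('a))"
      using nat_approx_posE by blast
    obtain q m where qm: "q \<in> Q" "z \<in> partial_approx f Basis q k m"
      using z unfolding N'_def by blast
    then have "z \<notin> N q k m" using z unfolding N'_def by blast
    from gradient_approx_at_thick_point[OF lip \<open>L \<ge> 0\<close> qm(2) thick[OF qm(2) this]]
    obtain d where d: "d > 0" "\<And>h. norm h < d \<Longrightarrow> \<bar>f (z + h) - f z - q \<bullet> h\<bar> \<le> 2 * real DIM('a) / Suc k * norm h"
      by blast
    have "2 * real DIM('a) / Suc k \<le> e"
      using k DIM_positive[where 'a='a] by (simp add: field_simps)
    then have "\<bar>f (z + h) - f z - q \<bullet> h\<bar> \<le> e * norm h" if "norm h < d" for h
      using d(2)[OF that] by (meson mult_right_mono norm_ge_zero order_trans)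
    then show "\<exists>q. \<exists>d>0. \<forall>h. norm h < d \<longrightarrow> \<bar>f (z + h) - f z - q \<bullet> h\<bar> \<le> e * norm h"
      using d(1) by blast
  qed
  then have "{z. \<not> f differentiable (at z)} \<subseteq> N'" by blast
  ultimately show ?thesis by (rule negligible_subset)
qed

theorem Rademacher:
  fixes f :: "'a::euclidean_space \<Rightarrow> 'b::euclidean_space"
  assumes lip: "\<And>x y. norm (f x - f y) \<le> L * norm (x - y)" and "L \<ge> 0"
  shows "negligible {z. \<not> f differentiable (at z)}"
proof (rule negligible_subset)
  have "negligible {z. \<not> (\<lambda>x. f x \<bullet> b) differentiable (at z)}" if "b \<in> Basis" for b
  proof (rule Rademacher_real[OF _ \<open>L \<ge> 0\<close>])
    show "\<bar>f x \<bullet> b - f y \<bullet> b\<bar> \<le> L * norm (x - y)" for x y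
      using Basis_le_norm[OF that, of "f x - f y"] lip[of x y] by (simp add: inner_diff_left)
  qed
  then show "negligible (\<Union>b\<in>Basis. {z. \<not> (\<lambda>x. f x \<bullet> b) differentiable (at z)})"
    by (intro negligible_Union) auto
  show "{z. \<not> f differentiable (at z)} \<subseteq> (\<Union>b\<in>Basis. {z. \<not> (\<lambda>x. f x \<bullet> b) differentiable (at z)})"
    by (subst differentiable_componentwise_within) blast
qed

section \<open>Second-order expansions of convex functions\<close>

text \<open>Convexity is expressed throughout as the existence of a subgradient at every point,
  which is what sup-convolutions provide directly.\<close>

definition subgradient :: "('a::euclidean_space \<Rightarrow> real) \<Rightarrow> 'a \<Rightarrow> 'a \<Rightarrow> bool" where
  "subgradient f x y \<longleftrightarrow> (\<forall>x'. f x + y \<bullet> (x' - x) \<le> f x')"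

lemma subgradientD: "subgradient f x y \<Longrightarrow> f x + y \<bullet> (x' - x) \<le> f x'"
  by (simp add: subgradient_def)

lemma subgradient_monotone:
  assumes "subgradient f x y" "subgradient f x' y'"
  shows "0 \<le> (y' - y) \<bullet> (x' - x)"
  using subgradientD[OF assms(1), of x'] subgradientD[OF assms(2), of x]
  by (simp add: inner_diff_left inner_diff_right)

text \<open>The minimiser of f(x) + |x - z|^2/2 has this property. A supporting plane at
  \<open>z\<close> with slope \<open>y0\<close> keeps the values outside the ball of radius 2|y0|
  above the value at \<open>z\<close>, so minimising over a compact ball suffices.\<close>

lemma resolvent_exists:
  fixes f :: "'a::euclidean_space \<Rightarrow> real"
  assumes cont: "continuous_on UNIV f" and sub: "\<And>x. \<exists>y. subgradient f x y"
  shows "\<exists>x. subgradient f x (z - x)"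
proof -
  define h where "h x = f x + (x - z) \<bullet> (x - z) / 2" for x
  obtain y0 where y0: "subgradient f z y0" using sub by blast
  have "continuous_on UNIV h"
    unfolding h_def by (intro continuous_intros cont) auto
  then have "continuous_on (cball z (2 * norm y0)) h"
    using continuous_on_subset by blast
  moreover have "cball z (2 * norm y0) \<noteq> {}" by simp
  ultimately obtain x where x: "\<And>w. w \<in> cball z (2 * norm y0) \<Longrightarrow> h x \<le> h w"
    using continuous_attains_inf[OF compact_cball] by blast
  have min: "h x \<le> h w" for w
  proof (cases "w \<in> cball z (2 * norm y0)")
    case False
    then have "2 * norm y0 \<le> norm (w - z)" by (simp add: dist_norm norm_minus_commute)
    then have "2 * norm y0 * norm (w - z) \<le> norm (w - z) * norm (w - z)"
      by (intro mult_right_mono) auto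
    moreover have "- (norm y0 * norm (w - z)) \<le> y0 \<bullet> (w - z)"
      using Cauchy_Schwarz_ineq2[of y0 "w - z"] by linarith
    ultimately have "h z \<le> h w"
      using subgradientD[OF y0, of w]
      by (simp add: h_def power2_norm_eq_inner[symmetric] power2_eq_square)
    moreover have "h x \<le> h z" by (rule x) simp
    ultimately show ?thesis by simp
  qed (use x in auto)
  have "subgradient f x (z - x)"
    unfolding subgradient_def
  proof (rule allI, rule ccontr)
    \<comment> \<open>On the segment towards \<open>x'\<close> the linear gain \<open>t * K\<close>
      beats the quadratic cost \<open>t * t * c / 2\<close> for small \<open>t\<close>. Convexity on
      the segment is recovered from a subgradient \<open>s\<close> at the intermediate point
      \<open>w\<close>.\<close>
    fix x' assume neg: "\<not> f x + (z - x) \<bullet> (x' - x) \<le> f x'"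
    define K where "K = f x + (z - x) \<bullet> (x' - x) - f x'"
    define c where "c = (x' - x) \<bullet> (x' - x)"
    have "K > 0" "c \<ge> 0" using neg by (auto simp: K_def c_def)
    have ineq: "K \<le> t * c / 2" if t: "0 < t" "t \<le> 1" for t
    proof -
      define w where "w = x + t *\<^sub>R (x' - x)"
      obtain s where s: "subgradient f w s" using sub by blast
      have "(1 - t) * (f w + s \<bullet> (x - w)) + t * (f w + s \<bullet> (x' - w)) \<le> (1 - t) * f x + t * f x'"
        using t by (intro add_mono mult_left_mono subgradientD[OF s]) auto
      moreover have "(1 - t) * (f w + s \<bullet> (x - w)) + t * (f w + s \<bullet> (x' - w)) = f w"
        by (simp add: w_def inner_simps algebra_simps)
      ultimately have "f w \<le> (1 - t) * f x + t * f x'" by simp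
      moreover have "(w - z) \<bullet> (w - z) = (x - z) \<bullet> (x - z) + 2 * t * ((x - z) \<bullet> (x' - x)) + t * t * c"
        by (simp add: w_def c_def inner_simps inner_commute algebra_simps)
      moreover have "t * K = t * f x - t * ((x - z) \<bullet> (x' - x)) - t * f x'"
        by (simp add: K_def inner_diff_left algebra_simps)
      ultimately have "t * K \<le> t * (t * c / 2)"
        using min[of w] unfolding h_def left_diff_distrib mult_1_left mult.assoc times_divide_eq_right
        by argo
      then show ?thesis using t by simp
    qed
    define t where "t = min 1 (K / (c + 1))"
    have "0 < t" "t \<le> 1" using \<open>K > 0\<close> \<open>c \<ge> 0\<close> by (auto simp: t_def)
    have "t * c \<le> K / (c + 1) * c" using \<open>c \<ge> 0\<close> by (intro mult_right_mono) (auto simp: t_def)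
    also have "\<dots> \<le> K" using \<open>K > 0\<close> \<open>c \<ge> 0\<close> by (simp add: divide_le_eq)
    finally show False using ineq[OF \<open>0 < t\<close> \<open>t \<le> 1\<close>] \<open>K > 0\<close> by simp
  qed
  then show ?thesis by blast
qed

text \<open>The proximal map: the inverse of the identity plus the subdifferential.\<close>

definition resolvent :: "('a::euclidean_space \<Rightarrow> real) \<Rightarrow> 'a \<Rightarrow> 'a" where
  "resolvent f z = (SOME x. subgradient f x (z - x))"

text \<open>Monotonicity of subgradients bounds |x' - x|^2 by the inner product of z' - z and x' -
  x. For \<open>z' = z\<close> this is uniqueness, so the choice in \<open>resolvent\<close> is
  immaterial.\<close>

lemma resolvent_nonexpansive_aux:
  assumes "subgradient f x (z - x)" "subgradient f x' (z' - x')"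
  shows "norm (x' - x) \<le> norm (z' - z)"
proof (cases "x' = x")
  case False
  have "norm (x' - x) * norm (x' - x) \<le> (z' - z) \<bullet> (x' - x)"
    using subgradient_monotone[OF assms]
    by (simp add: inner_diff_left inner_diff_right power2_norm_eq_inner power2_eq_square[symmetric])
  also have "\<dots> \<le> norm (z' - z) * norm (x' - x)" by (rule norm_cauchy_schwarz)
  finally show ?thesis using False by simp
qed simp

lemma resolvent_eq:
  assumes "subgradient f x y"
  shows "resolvent f (x + y) = x"
proof -
  have *: "subgradient f x (x + y - x)" using assms by simp
  then have "subgradient f (resolvent f (x + y)) (x + y - resolvent f (x + y))"
    unfolding resolvent_def by (rule someI)
  from resolvent_nonexpansive_aux[OF * this] show ?thesis by simp
qed

text \<open>The supporting plane at \<open>x'\<close> stays below the paraboloid above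
  \<open>f\<close>. They are compared at \<open>x + (1 / C) *\<^sub>R (y' - y)\<close>, where the
  plane of slope \<open>y'\<close> gains most on the paraboloid.\<close>

lemma subgradient_growth:
  fixes f :: "'a::euclidean_space \<Rightarrow> real"
  assumes "C > 0" and up: "\<And>h. f (x + h) \<le> f x + y \<bullet> h + C / 2 * (norm h)\<^sup>2"
    and sub: "subgradient f x y" and sub': "subgradient f x' y'"
  shows "norm (y' - y) \<le> 2 * C * norm (x' - x)"
proof (cases "y' = y")
  case False
  define m where "m = norm (y' - y)"
  have "m > 0" using False by (simp add: m_def)
  have mm: "(y' - y) \<bullet> (y' - y) = m * m" by (simp add: m_def power2_norm_eq_inner[symmetric] power2_eq_square)
  have "f x + y \<bullet> (x' - x) + y' \<bullet> (x + (1 / C) *\<^sub>R (y' - y) - x') \<le>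
     f x + y \<bullet> ((1 / C) *\<^sub>R (y' - y)) + C / 2 * (norm ((1 / C) *\<^sub>R (y' - y)))\<^sup>2"
    using up[of "(1 / C) *\<^sub>R (y' - y)"] subgradientD[OF sub, of x']
      subgradientD[OF sub', of "x + (1 / C) *\<^sub>R (y' - y)"] by linarith
  also have "C / 2 * (norm ((1 / C) *\<^sub>R (y' - y)))\<^sup>2 = m * m / (2 * C)"
  proof -
    have "norm ((1 / C) *\<^sub>R (y' - y)) = m / C" using \<open>C > 0\<close> by (simp add: m_def)
    then show ?thesis using \<open>C > 0\<close> by (simp only:) (simp add: power2_eq_square field_simps)
  qed
  finally have "(y' - y) \<bullet> ((1 / C) *\<^sub>R (y' - y)) - (y' - y) \<bullet> (x' - x) \<le> m * m / (2 * C)"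
    by (simp add: inner_add_right inner_diff_right inner_diff_left algebra_simps)
  then have "m * m / C - (y' - y) \<bullet> (x' - x) \<le> m * m / (2 * C)"
    by (simp add: mm)
  moreover have "(y' - y) \<bullet> (x' - x) \<le> m * norm (x' - x)"
    unfolding m_def by (rule norm_cauchy_schwarz)
  moreover have "m * m / C = m * m / (2 * C) + m * m / (2 * C)" using \<open>C > 0\<close> by (simp add: field_simps)
  ultimately have "m * m / (2 * C) \<le> m * norm (x' - x)" by linarith
  then have "m * m \<le> m * (2 * C * norm (x' - x))"
    using \<open>C > 0\<close> by (simp add: field_simps)
  then show ?thesis using \<open>m > 0\<close> unfolding m_def[symmetric] by (subst (asm) mult_le_cancel_left_pos) auto
qed (use \<open>C > 0\<close> in simp)

text \<open>Touching from above makes the resolvent expand distances at \<open>x + y\<close>, so that its derivative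
  is invertible there.\<close>

lemma subgradient_differentiable:
  fixes f :: "'a::euclidean_space \<Rightarrow> real"
  assumes cont: "continuous_on UNIV f" and subs: "\<And>x. \<exists>y. subgradient f x y"
    and "C > 0" and up: "\<And>h. f (x + h) \<le> f x + y \<bullet> h + C / 2 * (norm h)\<^sup>2"
    and sub: "subgradient f x y" and diff: "resolvent f differentiable (at (x + y))"
  obtains A where "linear A"
    "\<And>e. e > 0 \<Longrightarrow> \<exists>d>0. \<forall>x' y'. subgradient f x' y' \<longrightarrow> norm (x' - x) < d \<longrightarrow>
        norm (y' - y - A (x' - x)) \<le> e * norm (x' - x)"
proof -
  define J where "J = resolvent f"
  define z where "z = x + y"
  define K where "K = 1 + 2 * C"
  have "K > 0" using \<open>C > 0\<close> by (simp add: K_def)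
  have Jz: "J z = x" unfolding J_def z_def by (rule resolvent_eq[OF sub])
  have expand: "norm (x' + y' - z) \<le> K * norm (x' - x)" if "subgradient f x' y'" for x' y'
  proof -
    have "norm (x' + y' - z) \<le> norm (x' - x) + norm (y' - y)"
      using norm_triangle_ineq[of "x' - x" "y' - y"] by (simp add: z_def algebra_simps)
    then show ?thesis
      using subgradient_growth[OF \<open>C > 0\<close> up sub that] by (simp add: K_def algebra_simps)
  qed
  have expandJ: "norm k \<le> K * norm (J (z + k) - J z)" for k
  proof -
    obtain x' where x': "subgradient f x' (z + k - x')"
      using resolvent_exists[OF cont subs] by blast
    then have "J (z + k) = x'"
      using resolvent_eq[OF x'] by (simp add: J_def)
    then show ?thesis using expand[OF x'] by (simp add: Jz)
  qed
  obtain B where B: "(J has_derivative B) (at z)"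
    using diff unfolding differentiable_def J_def z_def by blast
  then have linB: "linear B" using has_derivative_linear by blast
  have Bapprox: "\<exists>d>0. \<forall>k. norm k < d \<longrightarrow> norm (J (z + k) - J z - B k) \<le> e * norm k" if "e > 0" for e
  proof -
    obtain d where d: "d > 0" "\<And>w. norm (w - z) < d \<Longrightarrow> norm (J w - J z - B (w - z)) \<le> e * norm (w - z)"
      using B \<open>e > 0\<close> unfolding has_derivative_at_alt by blast
    show ?thesis using d(1) d(2)[of "z + _"] by (intro exI[of _ d]) auto
  qed
  \<comment> \<open>Along a kernel vector the increment of \<open>J\<close> would be at most 1/(2K)
    times the step, against the lower bound 1/K from \<open>expandJ\<close>.\<close>
  have "k = 0" if "B k = 0" for k
  proof -
    have "1 / (2 * K) > 0" using \<open>K > 0\<close> by simp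
    then obtain d where d: "d > 0" "\<And>k. norm k < d \<Longrightarrow> norm (J (z + k) - J z - B k) \<le> 1 / (2 * K) * norm k"
      using Bapprox by blast
    define t where "t = d / (2 * (norm k + 1))"
    have "t > 0" using d(1) by (simp add: t_def add_nonneg_pos)
    have "t * norm k < d"
    proof -
      have "d * norm k < d * (2 * (norm k + 1))" using d(1) by (intro mult_strict_left_mono) (auto intro: add_nonneg_pos order.strict_trans1[of _ "2 * norm k"])
      then show ?thesis by (simp add: t_def divide_less_eq add_nonneg_pos)
    qed
    then have "norm (J (z + t *\<^sub>R k) - J z) \<le> 1 / (2 * K) * norm (t *\<^sub>R k)"
      using d(2)[of "t *\<^sub>R k"] \<open>t > 0\<close> that linear_scale[OF linB, of t k] by simp
    then have "K * norm (J (z + t *\<^sub>R k) - J z) \<le> K * (1 / (2 * K) * norm (t *\<^sub>R k))"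
      using \<open>K > 0\<close> by (intro mult_left_mono) auto
    also have "\<dots> = norm (t *\<^sub>R k) / 2" using \<open>K > 0\<close> by simp
    finally have "norm (t *\<^sub>R k) \<le> norm (t *\<^sub>R k) / 2"
      using expandJ[of "t *\<^sub>R k"] by linarith
    then show ?thesis using \<open>t > 0\<close> by simp
  qed
  then have "inj B" using linB by (simp add: linear_injective_0)
  then obtain B' where B': "linear B'" "B' \<circ> B = id"
    using linear_injective_left_inverse[OF linB] by blast
  obtain b where b: "b > 0" "\<And>v. norm (B' v) \<le> b * norm v"
    using linear_bounded_pos[OF B'(1)] by blast
  show thesis
  proof
    \<comment> \<open>For \<open>k = (x' - x) + (y' - y)\<close> the resolvent gives x' - x = B k up
      to a small error. Applying \<open>B'\<close> yields y' - y = B'(x' - x) - (x' - x) up to a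
      small error.\<close>
    show "linear (\<lambda>v. B' v - v)"
      using B'(1) by (intro linear_compose_sub) (auto simp: linear_id[unfolded id_def])
    fix e :: real assume "e > 0"
    then have "e / (b * K) > 0" using b \<open>K > 0\<close> by simp
    then obtain d where d: "d > 0" "\<And>k. norm k < d \<Longrightarrow> norm (J (z + k) - J z - B k) \<le> e / (b * K) * norm k"
      using Bapprox by blast
    have "norm (y' - y - (B' (x' - x) - (x' - x))) \<le> e * norm (x' - x)"
      if sub': "subgradient f x' y'" and near: "norm (x' - x) < d / K" for x' y'
    proof -
      define k where "k = x' + y' - z"
      have k: "norm k \<le> K * norm (x' - x)" unfolding k_def by (rule expand[OF sub'])
      also have "\<dots> < d" using near \<open>K > 0\<close> by (simp add: field_simps)
      finally have "norm (J (z + k) - J z - B k) \<le> e / (b * K) * norm k" by (rule d(2))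
      moreover have "J (z + k) = x'" using resolvent_eq[OF sub'] by (simp add: J_def k_def)
      ultimately have rho: "norm (x' - x - B k) \<le> e / (b * K) * norm k" by (simp add: Jz)
      have "B' (x' - x - B k) = B' (x' - x) - k"
        using B' by (simp add: linear_diff o_def id_def fun_eq_iff)
      then have "y' - y - (B' (x' - x) - (x' - x)) = - B' (x' - x - B k)"
        by (simp add: k_def z_def)
      then have "norm (y' - y - (B' (x' - x) - (x' - x))) \<le> b * norm (x' - x - B k)"
        using b(2) by simp
      also have "\<dots> \<le> b * (e / (b * K) * (K * norm (x' - x)))"
        using rho k b \<open>e > 0\<close> \<open>K > 0\<close>
        by (intro mult_left_mono order_trans[OF rho]) auto
      also have "\<dots> = e * norm (x' - x)" using b \<open>K > 0\<close> by simp
      finally show ?thesis .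
    qed
    then show "\<exists>d>0. \<forall>x' y'. subgradient f x' y' \<longrightarrow> norm (x' - x) < d \<longrightarrow>
        norm (y' - y - (B' (x' - x) - (x' - x))) \<le> e * norm (x' - x)"
      using d(1) \<open>K > 0\<close> by (intro exI[of _ "d / K"]) auto
  qed
qed

text \<open>Subgradients act as the derivative of \<open>f\<close> along the segment from
  \<open>x\<close> to \<open>x + h\<close>. Instead of an integral, \<open>n\<close> equal pieces
  are summed: the subgradients at the two ends of a piece bound the increment from both sides, and
  the resulting sums of \<open>a\<close> differ from \<open>a / 2\<close> by
  \<open>a / (2 * n)\<close>, which vanishes in the limit.\<close>

lemma second_order_expansion_from_subgradients:
  fixes f :: "'a::euclidean_space \<Rightarrow> real"
  assumes subs: "\<And>x. \<exists>y. subgradient f x y" and A: "linear A"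
    and approx: "\<And>x' y'. subgradient f x' y' \<Longrightarrow> norm (x' - x) < d \<Longrightarrow>
        norm (y' - y - A (x' - x)) \<le> e * norm (x' - x)"
    and h: "norm h < d" and "e \<ge> 0"
  shows "\<bar>f (x + h) - f x - y \<bullet> h - A h \<bullet> h / 2\<bar> \<le> e * (norm h)\<^sup>2"
proof -
  define a where "a = A h \<bullet> h"
  define s where "s = y \<bullet> h"
  define E where "E = e * (norm h)\<^sup>2"
  obtain g where g: "\<And>x. subgradient f x (g x)" using subs by metis
  have bound: "\<bar>g (x + t *\<^sub>R h) \<bullet> h - s - t * a\<bar> \<le> E" if t: "0 \<le> t" "t \<le> 1" for t
  proof -
    have th: "norm (t *\<^sub>R h) \<le> norm h" using t by (simp add: mult_left_le_one_le)
    then have "norm (g (x + t *\<^sub>R h) - y - A (t *\<^sub>R h)) \<le> e * norm (t *\<^sub>R h)"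
      using approx[OF g, of "x + t *\<^sub>R h"] h by simp
    also have "\<dots> \<le> e * norm h" using th \<open>e \<ge> 0\<close> by (rule mult_left_mono)
    finally have "norm (g (x + t *\<^sub>R h) - y - A (t *\<^sub>R h)) * norm h \<le> E"
      unfolding E_def power2_eq_square mult.assoc[symmetric] by (rule mult_right_mono) simp
    then have "\<bar>(g (x + t *\<^sub>R h) - y - A (t *\<^sub>R h)) \<bullet> h\<bar> \<le> E"
      using Cauchy_Schwarz_ineq2[of "g (x + t *\<^sub>R h) - y - A (t *\<^sub>R h)" h] by linarith
    then show ?thesis
      using linear_scale[OF A] by (simp add: inner_diff_left s_def a_def)
  qed
  have main: "\<bar>f (x + h) - f x - s - a / 2\<bar> \<le> E + \<bar>a\<bar> / (2 * real n)" if "n > 0" for n :: nat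
  proof -
    define w where "w j = x + (real j / real n) *\<^sub>R h" for j
    have wS: "w (Suc j) - w j = (1 / real n) *\<^sub>R h" for j
      by (simp add: w_def add_divide_distrib scaleR_add_left)
    \<comment> \<open>The coefficients of \<open>a\<close> are the sums of i/n^2 over i = 1, ..., j
      (right ends) and over i = 0, ..., j - 1 (left ends).\<close>
    have "f (w j) - f x \<le> real j / n * (s + E) + a * (real j * (real j + 1) / (2 * n * n)) \<and>
          real j / n * (s - E) + a * (real j * (real j - 1) / (2 * n * n)) \<le> f (w j) - f x" if "j \<le> n" for j
      using that
    proof (induction j)
      case 0 then show ?case by (simp add: w_def)
    next
      case (Suc j)
      then have j: "j \<le> n" "j < n" by auto
      have t: "0 \<le> real j / real n" "real j / real n \<le> 1" "0 \<le> real (Suc j) / real n" "real (Suc j) / real n \<le> 1"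
        using j \<open>n > 0\<close> by (auto simp: divide_le_eq_1)
      have "f (w (Suc j)) - f (w j) \<le> g (w (Suc j)) \<bullet> ((1 / real n) *\<^sub>R h)"
        using subgradientD[OF g, of "w (Suc j)" "w j"] wS[of j]
        by (metis (no_types, lifting) add_le_cancel_left diff_le_eq inner_minus_right le_diff_eq minus_diff_eq uminus_add_conv_diff add.commute diff_conv_add_uminus)
      also have "\<dots> \<le> (1 / n) * (s + real (Suc j) / n * a + E)"
        using bound[OF t(3,4)] by (simp add: w_def divide_right_mono)
      finally have up: "f (w (Suc j)) - f (w j) \<le> (1 / n) * (s + real (Suc j) / n * a + E)" .
      have "(1 / n) * (s + real j / n * a - E) \<le> g (w j) \<bullet> ((1 / real n) *\<^sub>R h)"
        using bound[OF t(1,2)] by (simp add: w_def divide_right_mono)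
      also have "\<dots> \<le> f (w (Suc j)) - f (w j)"
        using subgradientD[OF g, of "w j" "w (Suc j)"] wS[of j] by simp
      finally have lo: "(1 / n) * (s + real j / n * a - E) \<le> f (w (Suc j)) - f (w j)" .
      have "real j / n * (s + E) + a * (real j * (real j + 1) / (2 * n * n)) + (1 / n) * (s + real (Suc j) / n * a + E)
         = real (Suc j) / n * (s + E) + a * (real (Suc j) * (real (Suc j) + 1) / (2 * n * n))"
        using \<open>n > 0\<close> by (simp add: divide_simps) (simp add: algebra_simps)
      moreover have "real j / n * (s - E) + a * (real j * (real j - 1) / (2 * n * n)) + (1 / n) * (s + real j / n * a - E)
         = real (Suc j) / n * (s - E) + a * (real (Suc j) * (real (Suc j) - 1) / (2 * n * n))"
        using \<open>n > 0\<close> by (simp add: divide_simps) (simp add: algebra_simps)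
      ultimately show ?case using Suc.IH[OF j(1)] up lo by linarith
    qed
    from this[of n] have "f (x + h) - f x \<le> s + E + a * ((real n + 1) / (2 * n))"
       "s - E + a * ((real n - 1) / (2 * n)) \<le> f (x + h) - f x"
      using \<open>n > 0\<close> by (auto simp: w_def)
    moreover have "a * ((real n + 1) / (2 * n)) = a / 2 + a / (2 * real n)" "a * ((real n - 1) / (2 * n)) = a / 2 - a / (2 * real n)"
      using \<open>n > 0\<close> by (simp_all add: field_simps)
    moreover have "a / (2 * real n) \<le> \<bar>a\<bar> / (2 * real n)"
      using \<open>n > 0\<close> by (intro divide_right_mono) auto
    ultimately show ?thesis by linarith
  qed
  have "\<bar>f (x + h) - f x - s - a / 2\<bar> \<le> E + 0"
  proof (rule LIMSEQ_le_const)
    have "(\<lambda>n. \<bar>a\<bar> / 2 * inverse (real n)) \<longlonglongrightarrow> \<bar>a\<bar> / 2 * 0"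
      by (intro tendsto_intros lim_inverse_n)
    then show "(\<lambda>n. E + \<bar>a\<bar> / (2 * real n)) \<longlonglongrightarrow> E + 0"
      by (intro tendsto_intros) (simp add: field_simps)
    show "\<exists>N. \<forall>n\<ge>N. \<bar>f (x + h) - f x - s - a / 2\<bar> \<le> E + \<bar>a\<bar> / (2 * real n)"
      using main by (intro exI[of _ 1]) auto
  qed
  then show ?thesis by (simp add: s_def a_def E_def)
qed

lemma negligible_Times:
  fixes S :: "'a::euclidean_space set" and T :: "'b::euclidean_space set"
  assumes "negligible S \<or> negligible T"
  shows "negligible (S \<times> T)"
proof -
  have null: "N1 \<times> N2 \<in> null_sets (lborel :: ('a \<times> 'b) measure)"
    if "N1 \<in> sets lborel" "N2 \<in> sets lborel" "emeasure lborel N1 = 0 \<or> emeasure lborel N2 = 0" for N1 N2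
  proof -
    have "N1 \<times> N2 \<in> sets (lborel \<Otimes>\<^sub>M lborel)" using that by (intro pair_measureI)
    moreover have "emeasure (lborel \<Otimes>\<^sub>M lborel) (N1 \<times> N2) = 0"
      using that by (subst lborel.emeasure_pair_measure_Times) auto
    ultimately show ?thesis
      unfolding lborel_prod by (rule null_setsI[rotated])
  qed
  show ?thesis
    using assms
  proof
    assume "negligible S"
    then obtain N where "N \<in> null_sets lborel" "S \<subseteq> N"
      unfolding negligible_iff_null_sets null_sets_completion_iff2 by blast
    then have "N \<times> UNIV \<in> null_sets (lborel :: ('a \<times> 'b) measure)" "S \<times> T \<subseteq> N \<times> UNIV"
      using null[of N UNIV] by (auto simp: null_sets_def)
    then show ?thesis
      unfolding negligible_iff_null_sets null_sets_completion_iff2 by blast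
  next
    assume "negligible T"
    then obtain N where "N \<in> null_sets lborel" "T \<subseteq> N"
      unfolding negligible_iff_null_sets null_sets_completion_iff2 by blast
    then have "UNIV \<times> N \<in> null_sets (lborel :: ('a \<times> 'b) measure)" "S \<times> T \<subseteq> UNIV \<times> N"
      using null[of UNIV N] by (auto simp: null_sets_def)
    then show ?thesis
      unfolding negligible_iff_null_sets null_sets_completion_iff2 by blast
  qed
qed

lemma resolvent_nonexpansive:
  assumes "continuous_on UNIV f" "\<And>x. \<exists>y. subgradient f x y"
  shows "norm (resolvent f z' - resolvent f z) \<le> norm (z' - z)"
proof -
  have "subgradient f (resolvent f w) (w - resolvent f w)" for w
    unfolding resolvent_def by (rule someI_ex[OF resolvent_exists[OF assms]])
  then show ?thesis by (intro resolvent_nonexpansive_aux)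
qed

lemma norm_fst_snd_le: "norm (fst z) \<le> norm z" "norm (snd z) \<le> norm z"
  by (metis norm_fst_le prod.collapse) (metis norm_snd_le prod.collapse)

text \<open>Trapped between a supporting plane and a paraboloid, \<open>f\<close> is differentiable
  at \<open>x\<close>. The test increment (y - g)/C maximises the linear gap minus the quadratic
  bound.\<close>

lemma subgradient_eq_of_touching_above:
  fixes f :: "'a::euclidean_space \<Rightarrow> real"
  assumes "C > 0" and up: "\<And>h. f (x + h) \<le> f x + g \<bullet> h + C / 2 * (norm h)\<^sup>2"
    and sub: "subgradient f x y"
  shows "y = g"
proof (rule ccontr)
  assume "y \<noteq> g"
  define m where "m = (y - g) \<bullet> (y - g)"
  have "m > 0" using \<open>y \<noteq> g\<close> by (simp add: m_def)
  define h where "h = (1 / C) *\<^sub>R (y - g)"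
  have "(y - g) \<bullet> h = m / C" by (simp add: h_def m_def)
  moreover have "(norm h)\<^sup>2 = m / C / C" unfolding power2_norm_eq_inner by (simp add: h_def m_def)
  moreover have "(y - g) \<bullet> h \<le> C / 2 * (norm h)\<^sup>2"
    using up[of h] subgradientD[OF sub, of "x + h"] by (simp add: inner_diff_left)
  ultimately have "m / C \<le> C / 2 * (m / C / C)" by simp
  also have "\<dots> = m / C / 2" using \<open>C > 0\<close> by simp
  finally have "m / C \<le> 0" by simp
  then show False using divide_pos_pos[OF \<open>m > 0\<close> \<open>C > 0\<close>] by simp
qed

section \<open>Quadratic forms in two variables and Jensen's perturbation\<close>

text \<open>The form of the block matrix (kI, -kI; -kI, kI) plus diag(c1 I, c2 I): the shape of the
  right-hand side of the structure condition when A = kI.\<close>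

definition sum_form :: "real \<Rightarrow> real \<Rightarrow> real \<Rightarrow> 'a::euclidean_space \<Rightarrow> 'a \<Rightarrow> real" where
  "sum_form k c1 c2 x y = k * (norm (x - y))\<^sup>2 + c1 * (norm x)\<^sup>2 + c2 * (norm y)\<^sup>2"

lemma sum_form_add:
  "sum_form k c1 c2 (x + h1) (y + h2) = sum_form k c1 c2 x y
     + 2 * ((k *\<^sub>R (x - y) + c1 *\<^sub>R x) \<bullet> h1) + 2 * ((k *\<^sub>R (y - x) + c2 *\<^sub>R y) \<bullet> h2)
     + sum_form k c1 c2 h1 h2"
  unfolding sum_form_def power2_norm_eq_inner
  by (simp add: inner_simps inner_commute algebra_simps)

lemma sum_form_scaleR: "sum_form k c1 c2 (t *\<^sub>R x) (t *\<^sub>R y) = t\<^sup>2 * sum_form k c1 c2 x y"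
  unfolding sum_form_def by (simp add: scaleR_diff_right[symmetric] power_mult_distrib algebra_simps del: scaleR_diff_right)

text \<open>The second derivative is a linear map that enters only through
  \<open>A h \<bullet> h\<close>; \<open>symmetrize_linear\<close> later replaces it by a symmetric
  matrix.\<close>

definition peano2 :: "('a::euclidean_space \<Rightarrow> real) \<Rightarrow> 'a \<Rightarrow> 'a \<Rightarrow> ('a \<Rightarrow> 'a) \<Rightarrow> bool" where
  "peano2 f x g A \<longleftrightarrow> linear A \<and>
     (\<forall>e>0. \<exists>d>0. \<forall>h. norm h < d \<longrightarrow> \<bar>f (x + h) - f x - g \<bullet> h - A h \<bullet> h / 2\<bar> \<le> e * (norm h)\<^sup>2)"

lemma peano2_exists:
  fixes f :: "'a::euclidean_space \<Rightarrow> real"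
  assumes cont: "continuous_on UNIV f" and subs: "\<And>x. \<exists>y. subgradient f x y"
    and C: "C > 0" and up: "\<And>h. f (x + h) \<le> f x + g \<bullet> h + C / 2 * (norm h)\<^sup>2"
    and diff: "resolvent f differentiable (at (x + g))"
  obtains A where "peano2 f x g A"
proof -
  have sub: "subgradient f x g"
    using subs[of x] subgradient_eq_of_touching_above[OF C up] by metis
  obtain A where A: "linear A"
    "\<And>e. e > 0 \<Longrightarrow> \<exists>d>0. \<forall>x' y'. subgradient f x' y' \<longrightarrow> norm (x' - x) < d \<longrightarrow>
        norm (y' - g - A (x' - x)) \<le> e * norm (x' - x)"
    using subgradient_differentiable[OF cont subs C up sub diff] by blast
  have "\<exists>d>0. \<forall>h. norm h < d \<longrightarrow> \<bar>f (x + h) - f x - g \<bullet> h - A h \<bullet> h / 2\<bar> \<le> e * (norm h)\<^sup>2" if e: "e > 0" for e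
  proof -
    obtain d where d: "d > 0" "\<And>x' y'. subgradient f x' y' \<Longrightarrow> norm (x' - x) < d \<Longrightarrow>
        norm (y' - g - A (x' - x)) \<le> e * norm (x' - x)"
      using A(2)[OF e] by blast
    show ?thesis
      using second_order_expansion_from_subgradients[OF subs A(1) d(2)] d(1) e by (metis less_imp_le)
  qed
  then show thesis using that A(1) by (auto simp: peano2_def)
qed

text \<open>Both sides are homogeneous of degree 2, so the inequality is read off at
  \<open>t *\<^sub>R h1\<close> and \<open>t *\<^sub>R h2\<close> for small \<open>t\<close> and
  divided by t^2.\<close>

lemma peano2_sum_le:
  fixes f1 f2 :: "'a::euclidean_space \<Rightarrow> real"
  assumes p1: "peano2 f1 x g1 A1" and p2: "peano2 f2 y g2 A2"
    and up: "\<And>h1 h2. f1 (x + h1) + f2 (y + h2) \<le> f1 x + f2 y + g1 \<bullet> h1 + g2 \<bullet> h2 + sum_form k c1 c2 h1 h2 / 2"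
  shows "A1 h1 \<bullet> h1 + A2 h2 \<bullet> h2 \<le> sum_form k c1 c2 h1 h2"
proof (rule field_le_epsilon)
  fix e :: real assume "e > 0"
  define S where "S = (norm h1)\<^sup>2 + (norm h2)\<^sup>2"
  have "S \<ge> 0" by (simp add: S_def)
  define e' where "e' = e / (2 * (S + 1))"
  have "e' > 0" using \<open>e > 0\<close> \<open>S \<ge> 0\<close> by (simp add: e'_def)
  obtain d1 where d1: "d1 > 0" "\<And>h. norm h < d1 \<Longrightarrow> \<bar>f1 (x + h) - f1 x - g1 \<bullet> h - A1 h \<bullet> h / 2\<bar> \<le> e' * (norm h)\<^sup>2"
    using p1 \<open>e' > 0\<close> unfolding peano2_def by blast
  obtain d2 where d2: "d2 > 0" "\<And>h. norm h < d2 \<Longrightarrow> \<bar>f2 (y + h) - f2 y - g2 \<bullet> h - A2 h \<bullet> h / 2\<bar> \<le> e' * (norm h)\<^sup>2"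
    using p2 \<open>e' > 0\<close> unfolding peano2_def by blast
  have lin: "linear A1" "linear A2" using p1 p2 by (auto simp: peano2_def)
  define t where "t = min d1 d2 / (norm h1 + norm h2 + 1)"
  have pos: "norm h1 + norm h2 + 1 > 0" by (intro add_nonneg_pos) auto
  have "t > 0" using d1(1) d2(1) pos by (simp add: t_def)
  have "t * norm h1 < t * (norm h1 + norm h2 + 1)" "t * norm h2 < t * (norm h1 + norm h2 + 1)"
    using \<open>t > 0\<close> by (intro mult_strict_left_mono; simp add: add_nonneg_pos add.commute add_strict_increasing)+
  moreover have "t * (norm h1 + norm h2 + 1) = min d1 d2" using pos by (simp add: t_def)
  ultimately have small: "norm (t *\<^sub>R h1) < d1" "norm (t *\<^sub>R h2) < d2" using \<open>t > 0\<close> by auto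
  have A: "A1 (t *\<^sub>R h1) \<bullet> (t *\<^sub>R h1) = t\<^sup>2 * (A1 h1 \<bullet> h1)" "A2 (t *\<^sub>R h2) \<bullet> (t *\<^sub>R h2) = t\<^sup>2 * (A2 h2 \<bullet> h2)"
    using lin by (simp_all add: linear_scale power2_eq_square)
  have "t\<^sup>2 * (A1 h1 \<bullet> h1) / 2 + t\<^sup>2 * (A2 h2 \<bullet> h2) / 2 - e' * (norm (t *\<^sub>R h1))\<^sup>2 - e' * (norm (t *\<^sub>R h2))\<^sup>2
      \<le> sum_form k c1 c2 (t *\<^sub>R h1) (t *\<^sub>R h2) / 2"
    using d1(2)[OF small(1)] d2(2)[OF small(2)] up[of "t *\<^sub>R h1" "t *\<^sub>R h2"] unfolding A by linarith
  then have "t\<^sup>2 * (A1 h1 \<bullet> h1 + A2 h2 \<bullet> h2) \<le> t\<^sup>2 * (sum_form k c1 c2 h1 h2 + 2 * e' * S)"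
    unfolding sum_form_scaleR S_def by (simp add: power_mult_distrib algebra_simps)
  then have "A1 h1 \<bullet> h1 + A2 h2 \<bullet> h2 \<le> sum_form k c1 c2 h1 h2 + 2 * e' * S"
    using \<open>t > 0\<close> by (subst (asm) mult_le_cancel_left_pos) auto
  also have "2 * e' * S \<le> e"
    using \<open>e > 0\<close> \<open>S \<ge> 0\<close> by (simp add: e'_def divide_simps)
  finally show "A1 h1 \<bullet> h1 + A2 h2 \<bullet> h2 \<le> sum_form k c1 c2 h1 h2 + e" by simp
qed

text \<open>Jensen's perturbation argument: the perturbations \<open>p\<close> to be avoided are the image, under the
  Lipschitz map \<open>T\<close>, of the null set where one of the resolvents is not differentiable.\<close>

lemma sum_of_convex_touched:
  fixes f1 f2 :: "'a::euclidean_space \<Rightarrow> real"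
  assumes cont: "continuous_on UNIV f1" "continuous_on UNIV f2"
    and subs: "\<And>x. \<exists>y. subgradient f1 x y" "\<And>x. \<exists>y. subgradient f2 x y"
    and pos: "k \<ge> 0" "c1 > 0" "c2 > 0" "\<eta> > 0" "\<delta> > 0"
    and max: "\<And>x y. f1 x + f2 y \<le> f1 0 + f2 0 + sum_form k c1 c2 x y / 2 - \<eta> * ((norm x)\<^sup>2 + (norm y)\<^sup>2)"
  obtains x y g1 g2 A1 A2 where "norm x \<le> \<delta>" "norm y \<le> \<delta>"
    "norm (g1 - (k *\<^sub>R (x - y) + c1 *\<^sub>R x)) \<le> \<delta>" "norm (g2 - (k *\<^sub>R (y - x) + c2 *\<^sub>R y)) \<le> \<delta>"
    "\<And>y'. subgradient f1 x y' \<Longrightarrow> y' = g1" "\<And>y'. subgradient f2 y y' \<Longrightarrow> y' = g2"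
    "peano2 f1 x g1 A1" "peano2 f2 y g2 A2"
    "\<And>h1 h2. A1 h1 \<bullet> h1 + A2 h2 \<bullet> h2 \<le> sum_form k c1 c2 h1 h2"
proof -
  define J1 where "J1 = resolvent f1"
  define J2 where "J2 = resolvent f2"
  define G1 where "G1 x y = k *\<^sub>R (x - y) + c1 *\<^sub>R x" for x y :: 'a
  define G2 where "G2 x y = k *\<^sub>R (y - x) + c2 *\<^sub>R y" for x y :: 'a
  \<comment> \<open>If \<open>g1\<close>, \<open>g2\<close> are subgradients at \<open>x\<close>,
    \<open>y\<close>, the value at \<open>(x + g1, y + g2)\<close> is the gap between (g1, g2) and
    the gradient (G1, G2) of half the form. At a maximum of the function tilted by \<open>p\<close>
    this gap is \<open>p\<close>.\<close>
  define T where "T w = (fst w - J1 (fst w) - G1 (J1 (fst w)) (J2 (snd w)),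
                         snd w - J2 (snd w) - G2 (J1 (fst w)) (J2 (snd w)))" for w
  have lip: "norm (J1 z' - J1 z) \<le> norm (z' - z)" "norm (J2 z' - J2 z) \<le> norm (z' - z)" for z z'
    unfolding J1_def J2_def by (intro resolvent_nonexpansive cont subs)+
  define B where "B = (2 + 2 * k + c1) + (2 + 2 * k + c2)"
  have T_lip: "norm (T w - T w') \<le> B * norm (w - w')" for w w'
  proof -
    define a where "a = fst w - fst w'"
    define b where "b = snd w - snd w'"
    define j1 where "j1 = J1 (fst w) - J1 (fst w')"
    define j2 where "j2 = J2 (snd w) - J2 (snd w')"
    define n where "n = norm (w - w')"
    have n: "norm a \<le> n" "norm b \<le> n"
      using norm_fst_snd_le[of "w - w'"] by (auto simp: a_def b_def n_def)
    then have nj: "norm j1 \<le> n" "norm j2 \<le> n"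
      using lip(1)[of "fst w" "fst w'"] lip(2)[of "snd w" "snd w'"] by (auto simp: a_def b_def j1_def j2_def)
    have k2: "k * norm (j1 - j2) \<le> k * (2 * n)" "k * norm (j2 - j1) \<le> k * (2 * n)"
      using nj norm_triangle_ineq4[of j1 j2] pos by (auto intro!: mult_left_mono simp: norm_minus_commute)
    have c: "c1 * norm j1 \<le> c1 * n" "c2 * norm j2 \<le> c2 * n" using nj pos by auto
    have "T w - T w' = (a - j1 - G1 j1 j2, b - j2 - G2 j1 j2)"
      by (simp add: T_def G1_def G2_def a_def b_def j1_def j2_def algebra_simps)
    then have "norm (T w - T w') \<le> norm (a - j1 - G1 j1 j2) + norm (b - j2 - G2 j1 j2)"
      using norm_Pair_le by metis
    also have "norm (a - j1 - G1 j1 j2) \<le> norm a + norm j1 + (k * norm (j1 - j2) + c1 * norm j1)"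
      unfolding G1_def using pos
      by (intro order_trans[OF norm_triangle_ineq4] add_mono order_trans[OF norm_triangle_ineq]) auto
    also have "\<dots> \<le> (2 + 2 * k + c1) * n"
      using n nj k2 c by (simp add: algebra_simps)
    also have "norm (b - j2 - G2 j1 j2) \<le> norm b + norm j2 + (k * norm (j2 - j1) + c2 * norm j2)"
      unfolding G2_def using pos
      by (intro order_trans[OF norm_triangle_ineq4] add_mono order_trans[OF norm_triangle_ineq]) auto
    also have "\<dots> \<le> (2 + 2 * k + c2) * n"
      using n nj k2 c by (simp add: algebra_simps)
    finally show ?thesis by (simp add: B_def n_def distrib_right)
  qed
  define N where "N = {z. \<not> J1 differentiable (at z)} \<times> UNIV \<union> UNIV \<times> {z. \<not> J2 differentiable (at z)}"
  have "negligible {z. \<not> J1 differentiable (at z)}" "negligible {z. \<not> J2 differentiable (at z)}"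
    using Rademacher[of J1 1] Rademacher[of J2 1] lip by auto
  then have "negligible N"
    unfolding N_def by (intro negligible_Un negligible_Times) auto
  then have negT: "negligible (T ` N)"
    by (rule negligible_Lipschitz_image) (rule T_lip)
  \<comment> \<open>The bound \<delta> keeps the tilt of the gradients small; \<delta> \<eta> does
    the same for the maximum point, which lies within |p|/\<eta> of 0.\<close>
  define \<delta>' where "\<delta>' = min \<delta> (\<delta> * \<eta>)"
  have "\<delta>' > 0" using pos by (simp add: \<delta>'_def)
  then have "\<not> negligible (ball (0 :: 'a \<times> 'a) \<delta>')"
    by (intro open_not_negligible) auto
  then have "\<not> ball 0 \<delta>' \<subseteq> T ` N"
    using negligible_subset[OF negT] by blast
  then obtain p where "p \<in> ball 0 \<delta>'" and pT: "p \<notin> T ` N" by blast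
  then have p: "norm p < \<delta>'" by simp
  define p1 where "p1 = fst p"
  define p2 where "p2 = snd p"
  define \<Phi> where "\<Phi> w = f1 (fst w) + f2 (snd w) - sum_form k c1 c2 (fst w) (snd w) / 2 - p \<bullet> w" for w
  have "continuous_on UNIV \<Phi>"
    unfolding \<Phi>_def sum_form_def
    by (intro continuous_intros continuous_on_compose2[OF cont(1)] continuous_on_compose2[OF cont(2)]) auto
  then have "continuous_on (cball 0 (norm p / \<eta>)) \<Phi>" using continuous_on_subset by blast
  moreover have "cball 0 (norm p / \<eta>) \<noteq> ({} :: ('a \<times> 'a) set)" using pos by (simp add: not_less)
  ultimately obtain \<xi> where \<xi>: "\<xi> \<in> cball 0 (norm p / \<eta>)" "\<And>w. w \<in> cball 0 (norm p / \<eta>) \<Longrightarrow> \<Phi> w \<le> \<Phi> \<xi>"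
    using continuous_attains_sup[OF compact_cball] by blast
  \<comment> \<open>The strict gap \<eta> makes \<open>\<Phi>\<close> at most
    \<open>\<Phi> 0\<close> outside the ball of radius |p|/\<eta>, so the maximum over the ball is
    global.\<close>
  have \<xi>_max: "\<Phi> w \<le> \<Phi> \<xi>" for w
  proof (cases "w \<in> cball 0 (norm p / \<eta>)")
    case False
    then have "norm p \<le> \<eta> * norm w" using pos by (simp add: not_le pos_divide_less_eq mult.commute)
    then have "norm p * norm w \<le> \<eta> * norm w * norm w" by (rule mult_right_mono) simp
    moreover have "- (p \<bullet> w) \<le> norm p * norm w"
      using Cauchy_Schwarz_ineq2[of p w] by linarith
    moreover have "(norm (fst w))\<^sup>2 + (norm (snd w))\<^sup>2 = norm w * norm w"
      by (simp add: norm_prod_def power2_eq_square[symmetric])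
    ultimately have "\<Phi> w \<le> f1 0 + f2 0"
      using max[of "fst w" "snd w"] by (simp add: \<Phi>_def mult.assoc)
    also have "\<dots> = \<Phi> 0" by (simp add: \<Phi>_def sum_form_def)
    also have "\<dots> \<le> \<Phi> \<xi>" using pos by (intro \<xi>) auto
    finally show ?thesis .
  qed (use \<xi> in auto)
  define x where "x = fst \<xi>"
  define y where "y = snd \<xi>"
  define g1 where "g1 = G1 x y + p1"
  define g2 where "g2 = G2 x y + p2"
  have touch: "f1 (x + h1) + f2 (y + h2) \<le> f1 x + f2 y + g1 \<bullet> h1 + g2 \<bullet> h2 + sum_form k c1 c2 h1 h2 / 2" for h1 h2
    using \<xi>_max[of "(x + h1, y + h2)"]
    unfolding \<Phi>_def
    by (simp add: sum_form_add x_def[symmetric] y_def[symmetric] g1_def g2_def G1_def[symmetric] G2_def[symmetric]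
        inner_prod_def p1_def[symmetric] p2_def[symmetric] inner_add_left inner_add_right add_divide_distrib)
  have up1: "f1 (x + h) \<le> f1 x + g1 \<bullet> h + (k + c1) / 2 * (norm h)\<^sup>2" for h
    using touch[of h 0] by (simp add: sum_form_def algebra_simps add_divide_distrib)
  have up2: "f2 (y + h) \<le> f2 y + g2 \<bullet> h + (k + c2) / 2 * (norm h)\<^sup>2" for h
    using touch[of 0 h] by (simp add: sum_form_def algebra_simps add_divide_distrib)
  have C: "k + c1 > 0" "k + c2 > 0" using pos by auto
  have eq1: "y' = g1" if "subgradient f1 x y'" for y'
    by (rule subgradient_eq_of_touching_above[OF C(1) up1 that])
  have eq2: "y' = g2" if "subgradient f2 y y'" for y'
    by (rule subgradient_eq_of_touching_above[OF C(2) up2 that])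
  have sub1: "subgradient f1 x g1" using subs(1)[of x] eq1 by metis
  have sub2: "subgradient f2 y g2" using subs(2)[of y] eq2 by metis
  have "T (x + g1, y + g2) = p"
    unfolding T_def J1_def J2_def using resolvent_eq[OF sub1] resolvent_eq[OF sub2]
    by (simp add: g1_def g2_def p1_def p2_def)
  then have "(x + g1, y + g2) \<notin> N" using pT by blast
  then have diff: "J1 differentiable (at (x + g1))" "J2 differentiable (at (y + g2))"
    by (auto simp: N_def)
  obtain A1 where A1: "peano2 f1 x g1 A1"
    using peano2_exists[OF cont(1) subs(1) C(1) up1] diff by (auto simp: J1_def)
  obtain A2 where A2: "peano2 f2 y g2 A2"
    using peano2_exists[OF cont(2) subs(2) C(2) up2] diff by (auto simp: J2_def)
  have "norm \<xi> \<le> norm p / \<eta>" using \<xi>(1) by simp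
  also have "\<dots> \<le> \<delta>" using p pos by (simp add: \<delta>'_def divide_le_eq)
  finally have "norm \<xi> \<le> \<delta>" .
  moreover have "norm p \<le> \<delta>" using p by (simp add: \<delta>'_def)
  ultimately have "norm x \<le> \<delta>" "norm y \<le> \<delta>" "norm p1 \<le> \<delta>" "norm p2 \<le> \<delta>"
    using norm_fst_snd_le[of \<xi>] norm_fst_snd_le[of p]
    by (auto simp: x_def y_def p1_def p2_def)
  then show thesis
    using that[of x y g1 g2 A1 A2] eq1 eq2 A1 A2 peano2_sum_le[OF A1 A2 touch]
    by (simp add: g1_def g2_def G1_def G2_def)
qed

section \<open>The theorem on sums\<close>

lemma young_norm:
  fixes a b :: "'a::euclidean_space"
  assumes "\<tau> > 0"
  shows "(norm a)\<^sup>2 \<le> (1 + \<tau>) * (norm b)\<^sup>2 + (1 + 1 / \<tau>) * (norm (a - b))\<^sup>2"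
proof -
  define c where "c = a - b"
  have "0 \<le> (\<tau> * norm b - norm c)\<^sup>2 / \<tau>" using assms by simp
  also have "\<dots> = \<tau> * (norm b)\<^sup>2 + 1 / \<tau> * (norm c)\<^sup>2 - 2 * (norm b * norm c)"
    using assms by (simp add: power2_eq_square field_simps)
  finally have "2 * (b \<bullet> c) \<le> \<tau> * (norm b)\<^sup>2 + 1 / \<tau> * (norm c)\<^sup>2"
    using norm_cauchy_schwarz[of b c] by linarith
  moreover have "(norm a)\<^sup>2 = (norm b)\<^sup>2 + 2 * (b \<bullet> c) + (norm c)\<^sup>2"
  proof -
    have "a = b + c" by (simp add: c_def)
    then show ?thesis by (simp add: power2_norm_eq_inner inner_simps inner_commute)
  qed
  ultimately show ?thesis unfolding c_def[symmetric] distrib_right by linarith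
qed

lemma sum_form_bound:
  assumes "k \<ge> 0" "c1 \<ge> 0" "c2 \<ge> 0"
  shows "sum_form k c1 c2 x y \<le> (2 * k + c1 + c2) * ((norm x)\<^sup>2 + (norm y)\<^sup>2)"
proof -
  have "(norm (x - y))\<^sup>2 \<le> 2 * ((norm x)\<^sup>2 + (norm y)\<^sup>2)"
    using zero_le_power2[of "norm (x + y)"] unfolding power2_norm_eq_inner
    by (simp add: inner_simps inner_commute)
  then have "k * (norm (x - y))\<^sup>2 \<le> k * (2 * ((norm x)\<^sup>2 + (norm y)\<^sup>2))"
    using assms(1) by (rule mult_left_mono)
  moreover have "0 \<le> c1 * (norm y)\<^sup>2" "0 \<le> c2 * (norm x)\<^sup>2" using assms by auto
  ultimately show ?thesis unfolding sum_form_def by (simp add: algebra_simps)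
qed

text \<open>Moves a bound from the points where sup-convolutions are attained to the points where
  they are evaluated. The price is a factor 1 + \<tau> and a multiple of the squared displacement,
  which the quadratic term of the convolution absorbs.\<close>

lemma sum_form_young:
  assumes "\<tau> > 0" and pos: "k \<ge> 0" "c1 \<ge> 0" "c2 \<ge> 0"
  shows "sum_form k c1 c2 a b \<le> (1 + \<tau>) * sum_form k c1 c2 x y
           + (1 + 1 / \<tau>) * ((2 * k + c1 + c2) * ((norm (a - x))\<^sup>2 + (norm (b - y))\<^sup>2))"
proof -
  have "sum_form k c1 c2 a b \<le> (1 + \<tau>) * sum_form k c1 c2 x y + (1 + 1 / \<tau>) * sum_form k c1 c2 (a - x) (b - y)"
  proof -
    have "k * (norm (a - b))\<^sup>2 \<le> k * ((1 + \<tau>) * (norm (x - y))\<^sup>2 + (1 + 1 / \<tau>) * (norm ((a - b) - (x - y)))\<^sup>2)"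
      "c1 * (norm a)\<^sup>2 \<le> c1 * ((1 + \<tau>) * (norm x)\<^sup>2 + (1 + 1 / \<tau>) * (norm (a - x))\<^sup>2)"
      "c2 * (norm b)\<^sup>2 \<le> c2 * ((1 + \<tau>) * (norm y)\<^sup>2 + (1 + 1 / \<tau>) * (norm (b - y))\<^sup>2)"
      by (intro mult_left_mono young_norm assms)+
    moreover have "(a - b) - (x - y) = (a - x) - (b - y)" by simp
    ultimately show ?thesis unfolding sum_form_def by (simp add: algebra_simps)
  qed
  also have "(1 + 1 / \<tau>) * sum_form k c1 c2 (a - x) (b - y)
      \<le> (1 + 1 / \<tau>) * ((2 * k + c1 + c2) * ((norm (a - x))\<^sup>2 + (norm (b - y))\<^sup>2))"
    using assms by (intro mult_left_mono sum_form_bound) auto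
  finally show ?thesis by simp
qed

text \<open>Here \<open>f\<close> is the sup-convolution of \<open>u\<close> over the ball plus \<open>\<mu>/2\<close> times the squared norm.\<close>

lemma sup_convolution_exists:
  fixes u :: "'a::euclidean_space \<Rightarrow> real"
  assumes cont: "continuous_on (cball 0 r) u" and "r \<ge> 0" "\<mu> \<ge> 0"
  obtains f m where "\<And>x. m x \<in> cball 0 r"
    "\<And>x k. k \<in> cball 0 r \<Longrightarrow> u k - \<mu> / 2 * (norm k)\<^sup>2 + \<mu> * (x \<bullet> k) \<le> f x"
    "\<And>x. f x = u (m x) - \<mu> / 2 * (norm (m x))\<^sup>2 + \<mu> * (x \<bullet> m x)"
    "\<And>x. subgradient f x (\<mu> *\<^sub>R m x)" "continuous_on UNIV f"
proof -
  define g where "g x k = u k - \<mu> / 2 * (norm k)\<^sup>2 + \<mu> * (x \<bullet> k)" for x k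
  have "\<exists>k\<in>cball 0 r. \<forall>k'\<in>cball 0 r. g x k' \<le> g x k" for x
    using \<open>r \<ge> 0\<close> unfolding g_def
    by (intro continuous_attains_sup continuous_intros cont) auto
  then obtain m where m: "\<And>x. m x \<in> cball 0 r" "\<And>x k. k \<in> cball 0 r \<Longrightarrow> g x k \<le> g x (m x)"
    by metis
  define f where "f x = g x (m x)" for x
  \<comment> \<open>\<open>f\<close> is a supremum of affine functions of \<open>x\<close> with
    slopes \<open>\<mu> *\<^sub>R k\<close>; the one active at \<open>x\<close> supports it.\<close>
  have sub: "subgradient f x (\<mu> *\<^sub>R m x)" for x
    unfolding subgradient_def
  proof
    fix x'
    have "f x + (\<mu> *\<^sub>R m x) \<bullet> (x' - x) = g x' (m x)"
      by (simp add: f_def g_def inner_diff_right inner_commute algebra_simps)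
    also have "\<dots> \<le> f x'" unfolding f_def by (intro m)
    finally show "f x + (\<mu> *\<^sub>R m x) \<bullet> (x' - x) \<le> f x'" .
  qed
  have lip: "f x - f x' \<le> \<mu> * r * norm (x - x')" for x x'
  proof -
    have "f x - f x' \<le> (\<mu> *\<^sub>R m x) \<bullet> (x - x')"
      using subgradientD[OF sub, of x x'] by (simp add: inner_diff_right right_diff_distrib)
    also have "\<dots> \<le> norm (\<mu> *\<^sub>R m x) * norm (x - x')" by (rule norm_cauchy_schwarz)
    also have "\<dots> \<le> \<mu> * r * norm (x - x')"
      using m(1)[of x] \<open>\<mu> \<ge> 0\<close> by (intro mult_right_mono) (auto intro: mult_left_mono)
    finally show ?thesis .
  qed
  have "(\<mu> * r)-lipschitz_on UNIV f"
  proof (rule lipschitz_onI)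
    show "dist (f x) (f x') \<le> \<mu> * r * dist x x'" for x x'
      using lip[of x x'] lip[of x' x] by (auto simp: dist_norm norm_minus_commute abs_le_iff)
  qed (use assms in auto)
  then have "continuous_on UNIV f" by (rule lipschitz_on_continuous_on)
  then show thesis
    using that[of m f] m sub by (simp add: f_def g_def)
qed

text \<open>There is no little-o: the remainder is absorbed into \<open>A\<close>, so the quadratic
  itself is an admissible test function.\<close>

definition upper_jet :: "('a::euclidean_space \<Rightarrow> real) \<Rightarrow> 'a \<Rightarrow> 'a \<Rightarrow> ('a \<Rightarrow> 'a) \<Rightarrow> bool" where
  "upper_jet u x p A \<longleftrightarrow> linear A \<and> (\<exists>d>0. \<forall>h. norm h < d \<longrightarrow> u (x + h) \<le> u x + p \<bullet> h + A h \<bullet> h / 2)"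

text \<open>The point \<open>k\<close> where the sup-convolution at \<open>x\<close> is attained inherits the jet from \<open>x\<close>.\<close>

lemma upper_jet_of_sup_convolution:
  fixes u :: "'a::euclidean_space \<Rightarrow> real"
  assumes above: "\<And>x k. k \<in> cball 0 r \<Longrightarrow> u k - \<mu> / 2 * (norm k)\<^sup>2 + \<mu> * (x \<bullet> k) \<le> f x"
    and eq: "f x = u k - \<mu> / 2 * (norm k)\<^sup>2 + \<mu> * (x \<bullet> k)"
    and P: "peano2 f x (\<mu> *\<^sub>R k) A" and "\<eta> > 0" and "norm k < r"
  shows "upper_jet u k (\<mu> *\<^sub>R k - \<mu> *\<^sub>R x) (\<lambda>h. A h + (\<eta> - \<mu>) *\<^sub>R h)"
proof -
  obtain d where d: "d > 0" "\<And>h. norm h < d \<Longrightarrow> \<bar>f (x + h) - f x - (\<mu> *\<^sub>R k) \<bullet> h - A h \<bullet> h / 2\<bar> \<le> \<eta> / 2 * (norm h)\<^sup>2"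
    using P \<open>\<eta> > 0\<close> unfolding peano2_def by (meson half_gt_zero)
  have "u (k + h) \<le> u k + (\<mu> *\<^sub>R k - \<mu> *\<^sub>R x) \<bullet> h + (A h + (\<eta> - \<mu>) *\<^sub>R h) \<bullet> h / 2"
    if h: "norm h < min d (r - norm k)" for h
  proof -
    \<comment> \<open>Shifting \<open>x\<close> and \<open>k\<close> by the same \<open>h\<close>
      keeps their distance, so the expansion of the convolution at \<open>x + h\<close> bounds
      \<open>u\<close> at \<open>k + h\<close>.\<close>
    have "k + h \<in> cball 0 r" using h norm_triangle_ineq[of k h] by simp
    from above[OF this, of "x + h"]
    have "u (k + h) \<le> f (x + h) + \<mu> / 2 * (norm (k + h))\<^sup>2 - \<mu> * ((x + h) \<bullet> (k + h))" by linarith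
    also have "\<dots> \<le> f x + (\<mu> *\<^sub>R k) \<bullet> h + A h \<bullet> h / 2 + \<eta> / 2 * (norm h)\<^sup>2
        + \<mu> / 2 * (norm (k + h))\<^sup>2 - \<mu> * ((x + h) \<bullet> (k + h))"
    proof -
      have "\<bar>f (x + h) - f x - (\<mu> *\<^sub>R k) \<bullet> h - A h \<bullet> h / 2\<bar> \<le> \<eta> / 2 * (norm h)\<^sup>2"
        using h by (intro d(2)) simp
      then show ?thesis by linarith
    qed
    also have "\<dots> = u k + (\<mu> *\<^sub>R k - \<mu> *\<^sub>R x) \<bullet> h + (A h + (\<eta> - \<mu>) *\<^sub>R h) \<bullet> h / 2"
      unfolding eq power2_norm_eq_inner by (simp add: inner_simps inner_commute field_simps)
    finally show ?thesis .
  qed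
  moreover have "linear (\<lambda>h. A h + (\<eta> - \<mu>) *\<^sub>R h)"
    using P by (intro linear_compose_add linear_scaleR) (simp add: peano2_def)
  moreover have "min d (r - norm k) > 0" using d(1) \<open>norm k < r\<close> by simp
  ultimately show ?thesis unfolding upper_jet_def by blast
qed

text \<open>Sup-convolution adds \<mu> to the Hessian bound, and passing back to the jets of
  \<open>u1\<close> and \<open>u2\<close> removes it. What remains is at most \<open>e\<close>:
  \<tau> \<Lambda> from Young's inequality, 2\<eta> for the strict gap in Jensen's argument, \<eta>
  for turning Peano expansions into jets.\<close>

lemma theorem_on_sums_centered:
  fixes u1 u2 :: "'a::euclidean_space \<Rightarrow> real"
  assumes cont: "continuous_on (cball 0 r) u1" "continuous_on (cball 0 r) u2"
    and pos: "r > 0" "e > 0" "k \<ge> 0" "c1 \<ge> 0" "c2 \<ge> 0"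
    and max: "\<And>x y. x \<in> cball 0 r \<Longrightarrow> y \<in> cball 0 r \<Longrightarrow> u1 x + u2 y \<le> u1 0 + u2 0 + sum_form k c1 c2 x y / 2"
  obtains x y p1 p2 A1 A2 where "norm x < e" "norm y < e" "norm p1 < e" "norm p2 < e"
    "upper_jet u1 x p1 A1" "upper_jet u2 y p2 A2"
    "\<And>h1 h2. A1 h1 \<bullet> h1 + A2 h2 \<bullet> h2 \<le> sum_form k c1 c2 h1 h2 + e * ((norm h1)\<^sup>2 + (norm h2)\<^sup>2)"
proof -
  define \<Lambda> where "\<Lambda> = 2 * k + c1 + c2"
  have "\<Lambda> \<ge> 0" using pos by (simp add: \<Lambda>_def)
  define \<tau> where "\<tau> = e / (4 * (\<Lambda> + 1))"
  have "\<tau> > 0" using pos \<open>\<Lambda> \<ge> 0\<close> by (simp add: \<tau>_def)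
  have \<tau>\<Lambda>: "\<tau> * \<Lambda> \<le> e / 4"
    using pos \<open>\<Lambda> \<ge> 0\<close> by (simp add: \<tau>_def divide_simps)
  define \<eta> where "\<eta> = e / 4"
  have "\<eta> > 0" using pos by (simp add: \<eta>_def)
  \<comment> \<open>Large enough for the quadratic term of the convolution to absorb the
    displacement \<open>D\<close> left by Young's inequality; the extra 1 gives
    \<open>\<mu> \<ge> 1\<close>, used to bound the maximisers.\<close>
  define \<mu> where "\<mu> = (1 + 1 / \<tau>) * \<Lambda> + 1"
  have "(1 + 1 / \<tau>) * \<Lambda> \<ge> 0" using \<open>\<Lambda> \<ge> 0\<close> \<open>\<tau> > 0\<close> by simp
  then have "\<mu> \<ge> 1" by (simp add: \<mu>_def)
  have r0: "0 \<le> r" "0 \<le> \<mu>" using pos \<open>\<mu> \<ge> 1\<close> by auto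
  obtain f1 m1 where f1: "\<And>x. m1 x \<in> cball 0 r"
    "\<And>x k. k \<in> cball 0 r \<Longrightarrow> u1 k - \<mu> / 2 * (norm k)\<^sup>2 + \<mu> * (x \<bullet> k) \<le> f1 x"
    "\<And>x. f1 x = u1 (m1 x) - \<mu> / 2 * (norm (m1 x))\<^sup>2 + \<mu> * (x \<bullet> m1 x)"
    "\<And>x. subgradient f1 x (\<mu> *\<^sub>R m1 x)" "continuous_on UNIV f1"
    by (rule sup_convolution_exists[OF cont(1) r0]) (rule that)
  obtain f2 m2 where f2: "\<And>x. m2 x \<in> cball 0 r"
    "\<And>x k. k \<in> cball 0 r \<Longrightarrow> u2 k - \<mu> / 2 * (norm k)\<^sup>2 + \<mu> * (x \<bullet> k) \<le> f2 x"
    "\<And>x. f2 x = u2 (m2 x) - \<mu> / 2 * (norm (m2 x))\<^sup>2 + \<mu> * (x \<bullet> m2 x)"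
    "\<And>x. subgradient f2 x (\<mu> *\<^sub>R m2 x)" "continuous_on UNIV f2"
    by (rule sup_convolution_exists[OF cont(2) r0]) (rule that)
  define \<kappa> where "\<kappa> = (1 + \<tau>) * k"
  define d1 where "d1 = (1 + \<tau>) * c1 + (\<mu> + 2 * \<eta>)"
  define d2 where "d2 = (1 + \<tau>) * c2 + (\<mu> + 2 * \<eta>)"
  have dpos: "\<kappa> \<ge> 0" "d1 > 0" "d2 > 0"
    using pos \<open>\<tau> > 0\<close> \<open>\<mu> \<ge> 1\<close> \<open>\<eta> > 0\<close> by (auto simp: \<kappa>_def d1_def d2_def intro!: add_nonneg_pos)
  have form: "sum_form \<kappa> d1 d2 x y = (1 + \<tau>) * sum_form k c1 c2 x y + (\<mu> + 2 * \<eta>) * ((norm x)\<^sup>2 + (norm y)\<^sup>2)" for x y :: 'a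
    by (simp add: sum_form_def \<kappa>_def d1_def d2_def algebra_simps)
  have max': "f1 x + f2 y \<le> f1 0 + f2 0 + sum_form \<kappa> d1 d2 x y / 2 - \<eta> * ((norm x)\<^sup>2 + (norm y)\<^sup>2)" for x y
  proof -
    define D where "D = (norm (m1 x - x))\<^sup>2 + (norm (m2 y - y))\<^sup>2"
    have "D \<ge> 0" by (simp add: D_def)
    have sq: "- \<mu> / 2 * (norm (m :: 'a))\<^sup>2 + \<mu> * (w \<bullet> m) = \<mu> / 2 * (norm w)\<^sup>2 - \<mu> / 2 * (norm (m - w))\<^sup>2" for m w
      unfolding power2_norm_eq_inner by (simp add: inner_simps inner_commute field_simps)
    have "f1 x + f2 y = u1 (m1 x) + u2 (m2 y) + \<mu> / 2 * ((norm x)\<^sup>2 + (norm y)\<^sup>2) - \<mu> / 2 * D"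
      using sq[of "m1 x" x] sq[of "m2 y" y] unfolding f1(3)[of x] f2(3)[of y] D_def by (simp add: algebra_simps)
    moreover have "u1 (m1 x) + u2 (m2 y) \<le> u1 0 + u2 0 + sum_form k c1 c2 (m1 x) (m2 y) / 2"
      by (rule max[OF f1(1) f2(1)])
    moreover have "sum_form k c1 c2 (m1 x) (m2 y) \<le> (1 + \<tau>) * sum_form k c1 c2 x y + (1 + 1 / \<tau>) * (\<Lambda> * D)"
      unfolding \<Lambda>_def D_def by (rule sum_form_young[OF \<open>\<tau> > 0\<close> pos(3-5)])
    moreover have "(1 + 1 / \<tau>) * (\<Lambda> * D) \<le> \<mu> * D"
      using \<open>D \<ge> 0\<close> by (simp add: \<mu>_def algebra_simps)
    moreover have "u1 0 \<le> f1 0" "u2 0 \<le> f2 0"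
      using f1(2)[of 0 0] f2(2)[of 0 0] pos by auto
    ultimately have "f1 x + f2 y \<le> f1 0 + f2 0 + (1 + \<tau>) * sum_form k c1 c2 x y / 2 + \<mu> / 2 * ((norm x)\<^sup>2 + (norm y)\<^sup>2)"
      by linarith
    then show ?thesis unfolding form by (simp add: algebra_simps add_divide_distrib)
  qed
  \<comment> \<open>Collects the factors of \<delta> in \<open>tri\<close>, which bounds a
    subgradient plus \<mu> times its base point; this sum controls both the maximisers and the
    slopes of the jets.\<close>
  define M where "M = 1 + 2 * \<kappa> + d1 + d2 + \<mu>"
  have "M > 0" using dpos \<open>\<mu> \<ge> 1\<close> by (simp add: M_def)
  define \<delta> where "\<delta> = min e r / (2 * M)"
  have "\<delta> > 0" using pos \<open>M > 0\<close> by (simp add: \<delta>_def)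
  have M\<delta>: "M * \<delta> < e" "M * \<delta> < r"
    using pos \<open>M > 0\<close> by (auto simp: \<delta>_def)
  obtain x y g1 g2 A1 A2 where xy: "norm x \<le> \<delta>" "norm y \<le> \<delta>"
    and g: "norm (g1 - (\<kappa> *\<^sub>R (x - y) + d1 *\<^sub>R x)) \<le> \<delta>" "norm (g2 - (\<kappa> *\<^sub>R (y - x) + d2 *\<^sub>R y)) \<le> \<delta>"
    and uniq: "\<And>y'. subgradient f1 x y' \<Longrightarrow> y' = g1" "\<And>y'. subgradient f2 y y' \<Longrightarrow> y' = g2"
    and P: "peano2 f1 x g1 A1" "peano2 f2 y g2 A2"
    and A: "\<And>h1 h2. A1 h1 \<bullet> h1 + A2 h2 \<bullet> h2 \<le> sum_form \<kappa> d1 d2 h1 h2"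
    using sum_of_convex_touched[OF f1(5) f2(5) _ _ dpos \<open>\<eta> > 0\<close> \<open>\<delta> > 0\<close> max'] f1(4) f2(4) by blast
  \<comment> \<open>A touched convex function has only one subgradient, so the maximisers are
    g1/\<mu> and g2/\<mu>: small, hence interior to the ball, where jets can be transferred.\<close>
  have m: "\<mu> *\<^sub>R m1 x = g1" "\<mu> *\<^sub>R m2 y = g2"
    using uniq f1(4) f2(4) by auto
  have tri: "norm g + \<mu> * norm v \<le> M * \<delta>"
    if "norm (g - (\<kappa> *\<^sub>R (v - w) + d *\<^sub>R v)) \<le> \<delta>" "norm v \<le> \<delta>" "norm w \<le> \<delta>" "0 \<le> d" "d \<le> d1 + d2" for g v w :: 'a and d
  proof -
    have "norm (v - w) \<le> 2 * \<delta>" using norm_triangle_ineq4[of v w] that by linarith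
    then have 1: "\<kappa> * norm (v - w) \<le> \<kappa> * (2 * \<delta>)" using dpos by (intro mult_left_mono)
    have 2: "d * norm v \<le> (d1 + d2) * \<delta>" using that dpos by (intro mult_mono) auto
    have 3: "\<mu> * norm v \<le> \<mu> * \<delta>" using that \<open>\<mu> \<ge> 1\<close> by (intro mult_left_mono) auto
    have "norm g \<le> norm (g - (\<kappa> *\<^sub>R (v - w) + d *\<^sub>R v)) + norm (\<kappa> *\<^sub>R (v - w) + d *\<^sub>R v)"
      by (metis diff_add_cancel norm_triangle_ineq)
    also have "norm (\<kappa> *\<^sub>R (v - w) + d *\<^sub>R v) \<le> \<kappa> * norm (v - w) + d * norm v"
      using norm_triangle_ineq[of "\<kappa> *\<^sub>R (v - w)" "d *\<^sub>R v"] dpos that by simp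
    finally show ?thesis using 1 2 3 that by (simp add: M_def algebra_simps)
  qed
  have t1: "norm g1 + \<mu> * norm x \<le> M * \<delta>" and t2: "norm g2 + \<mu> * norm y \<le> M * \<delta>"
    using tri[OF g(1) xy] tri[OF g(2) xy(2,1)] dpos by auto
  have small: "norm k' < e \<and> norm k' < r \<and> norm (\<mu> *\<^sub>R k' - \<mu> *\<^sub>R v) < e"
    if "norm (\<mu> *\<^sub>R k') + \<mu> * norm v \<le> M * \<delta>" for k' v :: 'a
  proof -
    have "norm k' \<le> \<mu> * norm k'" using \<open>\<mu> \<ge> 1\<close> by (simp add: mult_le_cancel_right1)
    also have "\<dots> \<le> M * \<delta>" using that \<open>\<mu> \<ge> 1\<close> by (simp add: add_nonneg_nonneg order_trans[of _ "\<mu> * norm k' + \<mu> * norm v"])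
    finally have "norm k' \<le> M * \<delta>" .
    moreover have "norm (\<mu> *\<^sub>R k' - \<mu> *\<^sub>R v) \<le> M * \<delta>"
      using norm_triangle_ineq4[of "\<mu> *\<^sub>R k'" "\<mu> *\<^sub>R v"] that \<open>\<mu> \<ge> 1\<close> by simp
    ultimately show ?thesis using M\<delta> by linarith
  qed
  have s1: "norm (m1 x) < e \<and> norm (m1 x) < r \<and> norm (\<mu> *\<^sub>R m1 x - \<mu> *\<^sub>R x) < e"
    by (rule small) (use m t1 in simp)
  have s2: "norm (m2 y) < e \<and> norm (m2 y) < r \<and> norm (\<mu> *\<^sub>R m2 y - \<mu> *\<^sub>R y) < e"
    by (rule small) (use m t2 in simp)
  have jet1: "upper_jet u1 (m1 x) (\<mu> *\<^sub>R m1 x - \<mu> *\<^sub>R x) (\<lambda>h. A1 h + (\<eta> - \<mu>) *\<^sub>R h)"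
    by (rule upper_jet_of_sup_convolution[OF f1(2) f1(3) _ \<open>\<eta> > 0\<close>]) (use P(1) m s1 in auto)
  have jet2: "upper_jet u2 (m2 y) (\<mu> *\<^sub>R m2 y - \<mu> *\<^sub>R y) (\<lambda>h. A2 h + (\<eta> - \<mu>) *\<^sub>R h)"
    by (rule upper_jet_of_sup_convolution[OF f2(2) f2(3) _ \<open>\<eta> > 0\<close>]) (use P(2) m s2 in auto)
  have final: "(A1 h1 + (\<eta> - \<mu>) *\<^sub>R h1) \<bullet> h1 + (A2 h2 + (\<eta> - \<mu>) *\<^sub>R h2) \<bullet> h2
      \<le> sum_form k c1 c2 h1 h2 + e * ((norm h1)\<^sup>2 + (norm h2)\<^sup>2)" for h1 h2
  proof -
    define S where "S = (norm h1)\<^sup>2 + (norm h2)\<^sup>2"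
    have "S \<ge> 0" by (simp add: S_def)
    have "(A1 h1 + (\<eta> - \<mu>) *\<^sub>R h1) \<bullet> h1 + (A2 h2 + (\<eta> - \<mu>) *\<^sub>R h2) \<bullet> h2
        = A1 h1 \<bullet> h1 + A2 h2 \<bullet> h2 + (\<eta> - \<mu>) * S"
      by (simp add: S_def inner_add_left power2_norm_eq_inner algebra_simps)
    also have "\<dots> \<le> (1 + \<tau>) * sum_form k c1 c2 h1 h2 + (\<mu> + 2 * \<eta>) * S + (\<eta> - \<mu>) * S"
      using A[of h1 h2] unfolding form S_def by simp
    also have "\<dots> = sum_form k c1 c2 h1 h2 + \<tau> * sum_form k c1 c2 h1 h2 + 3 * \<eta> * S"
      by (simp add: algebra_simps)
    also have "\<tau> * sum_form k c1 c2 h1 h2 \<le> \<tau> * (\<Lambda> * S)"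
      unfolding \<Lambda>_def S_def using pos \<open>\<tau> > 0\<close> by (intro mult_left_mono sum_form_bound) auto
    also have "\<tau> * (\<Lambda> * S) \<le> e / 4 * S"
      unfolding mult.assoc[symmetric] by (rule mult_right_mono[OF \<tau>\<Lambda> \<open>S \<ge> 0\<close>])
    finally show ?thesis by (simp add: S_def[symmetric] \<eta>_def mult.commute)
  qed
  show thesis
    using that[OF _ _ _ _ jet1 jet2 final] s1 s2 by blast
qed

text \<open>Subtracting the linear parts reduces to the centred case; the jets regain the slopes
  \<open>l1\<close> and \<open>l2\<close>.\<close>

theorem theorem_on_sums:
  fixes u1 u2 :: "'a::euclidean_space \<Rightarrow> real"
  assumes cont: "continuous_on (cball 0 r) u1" "continuous_on (cball 0 r) u2"
    and pos: "r > 0" "e > 0" "k \<ge> 0" "c1 \<ge> 0" "c2 \<ge> 0"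
    and max: "\<And>x y. x \<in> cball 0 r \<Longrightarrow> y \<in> cball 0 r \<Longrightarrow>
        u1 x + u2 y \<le> u1 0 + u2 0 + l1 \<bullet> x + l2 \<bullet> y + sum_form k c1 c2 x y / 2"
  obtains x y p1 p2 A1 A2 where "norm x < e" "norm y < e" "norm (p1 - l1) < e" "norm (p2 - l2) < e"
    "upper_jet u1 x p1 A1" "upper_jet u2 y p2 A2"
    "\<And>h1 h2. A1 h1 \<bullet> h1 + A2 h2 \<bullet> h2 \<le> sum_form k c1 c2 h1 h2 + e * ((norm h1)\<^sup>2 + (norm h2)\<^sup>2)"
proof -
  have c: "continuous_on (cball 0 r) (\<lambda>x. u1 x - l1 \<bullet> x)" "continuous_on (cball 0 r) (\<lambda>x. u2 x - l2 \<bullet> x)"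
    by (intro continuous_intros cont)+
  have jet: "upper_jet u x (p + l) A" if "upper_jet (\<lambda>x. u x - l \<bullet> x) x p A" for u x p l and A :: "'a \<Rightarrow> 'a"
    using that unfolding upper_jet_def by (auto simp: inner_add_left inner_add_right algebra_simps)
  show thesis
  proof (rule theorem_on_sums_centered[OF c pos])
    show "u1 x - l1 \<bullet> x + (u2 y - l2 \<bullet> y) \<le> u1 0 - l1 \<bullet> 0 + (u2 0 - l2 \<bullet> 0) + sum_form k c1 c2 x y / 2"
      if "x \<in> cball 0 r" "y \<in> cball 0 r" for x y
      using max[OF that] by simp
    fix x y p1 p2 A1 A2
    assume "norm x < e" "norm y < e" "norm p1 < e" "norm p2 < e"
      "upper_jet (\<lambda>x. u1 x - l1 \<bullet> x) x p1 A1" "upper_jet (\<lambda>x. u2 x - l2 \<bullet> x) y p2 A2"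
      "\<And>h1 h2. A1 h1 \<bullet> h1 + A2 h2 \<bullet> h2 \<le> sum_form k c1 c2 h1 h2 + e * ((norm h1)\<^sup>2 + (norm h2)\<^sup>2)"
    then show thesis
      using that[of x y "p1 + l1" "p2 + l2" A1 A2] jet by simp
  qed
qed

section \<open>Jets and matrices\<close>

text \<open>The linear maps obtained from the resolvent have not been shown symmetric, while the
  structure condition takes symmetric matrices. The symmetric part has the same quadratic
  form.\<close>

lemma symmetrize_linear:
  fixes A :: "real^'n \<Rightarrow> real^'n"
  assumes "linear A"
  obtains X where "X \<in> sym_matrices" "\<And>h. h \<bullet> (X *v h) = A h \<bullet> h"
proof
  define X where "X = (1 / 2) *\<^sub>R (matrix A + transpose (matrix A))"
  show "X \<in> sym_matrices"
    by (simp add: X_def sym_matrices_def transpose_def vec_eq_iff add.commute)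
  show "h \<bullet> (X *v h) = A h \<bullet> h" for h
  proof -
    have 1: "matrix A *v h = A h" using assms by (simp add: matrix_works)
    have 2: "h \<bullet> (transpose (matrix A) *v h) = A h \<bullet> h"
      by (simp add: inner_commute[of h] dot_lmul_matrix 1)
    have "X *v h = (1 / 2) *\<^sub>R (matrix A *v h + transpose (matrix A) *v h)"
      unfolding X_def by (simp add: scaleR_matrix_vector_assoc[symmetric] matrix_vector_mult_add_rdistrib del: transpose_matrix_vector)
    then show ?thesis by (simp add: inner_add_right 1 2 inner_commute[of h "A h"] del: transpose_matrix_vector)
  qed
qed

lemma sym_matrices_inner: "X \<in> sym_matrices \<Longrightarrow> (X *v a) \<bullet> b = a \<bullet> (X *v b)"
  using dot_lmul_matrix[of a X b] transpose_matrix_vector[of X a] by (simp add: sym_matrices_def)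

section \<open>Quadratic test functions\<close>

definition quadratic :: "real^'n \<Rightarrow> real^'n \<Rightarrow> real^'n^'n \<Rightarrow> real^'n \<Rightarrow> real" where
  "quadratic x p X y = p \<bullet> (y - x) + (y - x) \<bullet> (X *v (y - x)) / 2"

lemma gradient_quadratic:
  assumes "X \<in> sym_matrices"
  shows "quadratic x p X differentiable (at y)" "gradient (quadratic x p X) y = p + X *v (y - x)"
proof -
  have lin: "bounded_linear ((*v) X)" by (rule matrix_vector_mul_bounded_linear)
  have der: "(quadratic x p X has_derivative (\<lambda>h. (p + X *v (y - x)) \<bullet> h)) (at y)"
  proof (rule has_derivative_eq_rhs)
    show "(quadratic x p X has_derivative (\<lambda>h. p \<bullet> h + ((y - x) \<bullet> (X *v h) + h \<bullet> (X *v (y - x))) / 2)) (at y)"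
      unfolding quadratic_def
      by (auto intro!: derivative_eq_intros bounded_linear.has_derivative[OF lin])
    show "(\<lambda>h. p \<bullet> h + ((y - x) \<bullet> (X *v h) + h \<bullet> (X *v (y - x))) / 2) = (\<lambda>h. (p + X *v (y - x)) \<bullet> h)"
    proof
      fix h
      have "h \<bullet> (X *v (y - x)) = (y - x) \<bullet> (X *v h)"
        by (metis inner_commute sym_matrices_inner[OF assms])
      then show "p \<bullet> h + ((y - x) \<bullet> (X *v h) + h \<bullet> (X *v (y - x))) / 2 = (p + X *v (y - x)) \<bullet> h"
        by (simp add: inner_add_left sym_matrices_inner[OF assms])
    qed
  qed
  then show "quadratic x p X differentiable (at y)" by (auto simp: differentiable_def)
  show "gradient (quadratic x p X) y = p + X *v (y - x)"
    unfolding gradient_def frechet_derivative_at[OF der, symmetric]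
    by (simp add: vec_eq_iff inner_axis)
qed

lemma hessian_quadratic:
  assumes "X \<in> sym_matrices"
  shows "gradient (quadratic x p X) differentiable (at y)" "hessian (quadratic x p X) y = X"
proof -
  have lin: "bounded_linear ((*v) X)" by (rule matrix_vector_mul_bounded_linear)
  have "gradient (quadratic x p X) = (\<lambda>y. p + X *v (y - x))"
    using gradient_quadratic(2)[OF assms] by blast
  moreover have "((\<lambda>y. p + X *v (y - x)) has_derivative (\<lambda>h. X *v h)) (at y)"
    by (rule derivative_eq_intros bounded_linear.has_derivative[OF lin] refl | simp)+
  ultimately have der: "(gradient (quadratic x p X) has_derivative (\<lambda>h. X *v h)) (at y)" by simp
  then show "gradient (quadratic x p X) differentiable (at y)" by (auto simp: differentiable_def)
  show "hessian (quadratic x p X) y = X"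
    unfolding hessian_def jacobian_def frechet_derivative_at[OF der, symmetric] by simp
qed

lemma C2_on_quadratic:
  assumes "X \<in> sym_matrices"
  shows "C2_on \<Omega> (quadratic x p X)"
proof -
  have "hessian (quadratic x p X) = (\<lambda>_. X)"
    by (rule ext) (rule hessian_quadratic[OF assms])
  then show ?thesis
    using gradient_quadratic(1)[OF assms] hessian_quadratic(1)[OF assms] by (simp add: C2_on_def)
qed

lemma subsolution_jet:
  assumes sub: "viscosity_subsolution \<Omega> F u" and "x \<in> \<Omega>" and X: "X \<in> sym_matrices" and "d > 0"
    and jet: "\<And>h. norm h < d \<Longrightarrow> u (x + h) \<le> u x + p \<bullet> h + h \<bullet> (X *v h) / 2"
  shows "u x + F x p X \<le> 0"
proof -
  have "u y - quadratic x p X y \<le> u x - quadratic x p X x" if "dist y x < d" for y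
    using jet[of "y - x"] that by (simp add: quadratic_def dist_norm)
  then have "local_max_at \<Omega> (\<lambda>y. u y - quadratic x p X y) x"
    unfolding local_max_at_def eventually_at using \<open>d > 0\<close> by blast
  then have "u x + F x (gradient (quadratic x p X) x) (hessian (quadratic x p X) x) \<le> 0"
    using sub \<open>x \<in> \<Omega>\<close> C2_on_quadratic[OF X] unfolding viscosity_subsolution_def by blast
  then show ?thesis using gradient_quadratic(2)[OF X] hessian_quadratic(2)[OF X] by simp
qed

lemma supersolution_jet:
  assumes sub: "viscosity_supersolution \<Omega> F u" and "x \<in> \<Omega>" and X: "X \<in> sym_matrices" and "d > 0"
    and jet: "\<And>h. norm h < d \<Longrightarrow> u (x + h) \<ge> u x + p \<bullet> h + h \<bullet> (X *v h) / 2"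
  shows "u x + F x p X \<ge> 0"
proof -
  have "u y - quadratic x p X y \<ge> u x - quadratic x p X x" if "dist y x < d" for y
    using jet[of "y - x"] that by (simp add: quadratic_def dist_norm)
  then have "local_min_at \<Omega> (\<lambda>y. u y - quadratic x p X y) x"
    unfolding local_min_at_def eventually_at using \<open>d > 0\<close> by blast
  then have "u x + F x (gradient (quadratic x p X) x) (hessian (quadratic x p X) x) \<ge> 0"
    using sub \<open>x \<in> \<Omega>\<close> C2_on_quadratic[OF X] unfolding viscosity_supersolution_def by blast
  then show ?thesis using gradient_quadratic(2)[OF X] hessian_quadratic(2)[OF X] by simp
qed

section \<open>Block matrices and the structure condition\<close>

lemma sum_UNIV_Plus:
  fixes f :: "'a::finite + 'b::finite \<Rightarrow> 'c::comm_monoid_add"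
  shows "sum f UNIV = (\<Sum>a\<in>UNIV. f (Inl a)) + (\<Sum>b\<in>UNIV. f (Inr b))"
  by (subst UNIV_Plus_UNIV[symmetric], subst sum.Plus) auto

lemma block_matrix_inner:
  fixes \<xi> :: "real^('n::finite + 'n)"
  defines "a \<equiv> \<chi> i. \<xi> $ Inl i" and "b \<equiv> \<chi> i. \<xi> $ Inr i"
  shows "\<xi> \<bullet> (block_matrix A B C D *v \<xi>) = a \<bullet> (A *v a + B *v b) + b \<bullet> (C *v a + D *v b)"
  unfolding inner_vec_def matrix_vector_mult_def
  by (simp add: sum_UNIV_Plus block_matrix_def a_def b_def)

lemma inner_split_Plus:
  fixes \<xi> :: "real^('n::finite + 'n)"
  shows "\<xi> \<bullet> \<xi> = (\<chi> i. \<xi> $ Inl i) \<bullet> (\<chi> i. \<xi> $ Inl i) + (\<chi> i. \<xi> $ Inr i) \<bullet> (\<chi> i. \<xi> $ Inr i)"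
  unfolding inner_vec_def by (simp add: sum_UNIV_Plus)

text \<open>Applied with A = kI, the largest admissible choice. The second jet will belong to
  \<open>- u\<close>, so its matrix \<open>Z\<close> enters the sum with a plus sign and the
  operator as \<open>- Z\<close>.\<close>

lemma structure_conditionD:
  fixes x y p q :: "real^'n" and a \<alpha> :: real
  defines "k \<equiv> \<alpha> * a * norm (x - y) powr (\<alpha> - 2)"
  assumes struct: "structure_condition \<Omega> F M a L \<alpha> \<beta>"
    and xy: "x \<in> \<Omega>" "y \<in> \<Omega>" "x \<noteq> y" and "\<delta> > 0"
    and XZ: "X \<in> sym_matrices" "Z \<in> sym_matrices"
    and FM: "F x p X \<le> M" "F y q (- Z) \<ge> - M"
    and pq: "norm (p - k *\<^sub>R (x - y)) \<le> \<delta> / bdist \<Omega> x" "norm (q - k *\<^sub>R (x - y)) \<le> \<delta> / bdist \<Omega> y"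
    and le: "\<And>h1 h2. h1 \<bullet> (X *v h1) + h2 \<bullet> (Z *v h2)
       \<le> sum_form k (\<delta> / (bdist \<Omega> x)\<^sup>2 + \<delta>) (\<delta> / (bdist \<Omega> y)\<^sup>2 + \<delta>) h1 h2"
  shows "F y q (- Z) - F x p X \<le> \<beta> * a * norm (x - y) powr \<alpha> + L * \<delta>"
proof -
  have sym: "- Z \<in> sym_matrices" "k *\<^sub>R mat 1 \<in> (sym_matrices :: (real^'n^'n) set)"
    using XZ by (auto simp: sym_matrices_def transpose_def vec_eq_iff mat_def)
  have smul: "(c *\<^sub>R mat 1) *v h = c *\<^sub>R h" for c and h :: "real^'m"
    by (simp add: scaleR_matrix_vector_assoc[symmetric])
  have neg: "(- B) *v h = - (B *v h)" for B :: "real^'n^'n" and h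
    by (simp add: vec_eq_iff matrix_vector_mult_def sum_negf)
  have "block_matrix X 0 0 (- (- Z)) \<preceq> block_matrix (k *\<^sub>R mat 1) (- (k *\<^sub>R mat 1)) (- (k *\<^sub>R mat 1)) (k *\<^sub>R mat 1)
     + \<delta> *\<^sub>R block_matrix ((1 / (bdist \<Omega> x)\<^sup>2) *\<^sub>R mat 1) 0 0 ((1 / (bdist \<Omega> y)\<^sup>2) *\<^sub>R mat 1) + \<delta> *\<^sub>R mat 1"
    unfolding matrix_le_def
  proof
    fix \<xi> :: "real^('n::finite + 'n)"
    define h1 where "h1 = (\<chi> i. \<xi> $ Inl i)"
    define h2 where "h2 = (\<chi> i. \<xi> $ Inr i)"
    have "\<xi> \<bullet> (block_matrix X 0 0 (- (- Z)) *v \<xi>) = h1 \<bullet> (X *v h1) + h2 \<bullet> (Z *v h2)"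
      by (simp add: block_matrix_inner h1_def h2_def)
    also have "\<dots> \<le> sum_form k (\<delta> / (bdist \<Omega> x)\<^sup>2 + \<delta>) (\<delta> / (bdist \<Omega> y)\<^sup>2 + \<delta>) h1 h2" by (rule le)
    also have "\<dots> = (k * ((h1 - h2) \<bullet> (h1 - h2))) + \<delta> * (1 / (bdist \<Omega> x)\<^sup>2 * (h1 \<bullet> h1) + 1 / (bdist \<Omega> y)\<^sup>2 * (h2 \<bullet> h2)) + \<delta> * (h1 \<bullet> h1 + h2 \<bullet> h2)"
      unfolding sum_form_def power2_norm_eq_inner by (simp add: algebra_simps)
    also have "\<dots> = \<xi> \<bullet> ((block_matrix (k *\<^sub>R mat 1) (- (k *\<^sub>R mat 1)) (- (k *\<^sub>R mat 1)) (k *\<^sub>R mat 1)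
     + \<delta> *\<^sub>R block_matrix ((1 / (bdist \<Omega> x)\<^sup>2) *\<^sub>R mat 1) 0 0 ((1 / (bdist \<Omega> y)\<^sup>2) *\<^sub>R mat 1) + \<delta> *\<^sub>R mat 1) *v \<xi>)"
      unfolding matrix_vector_mult_add_rdistrib scaleR_matrix_vector_assoc[symmetric, of \<delta>] inner_add_right inner_scaleR_right
        block_matrix_inner h1_def[symmetric] h2_def[symmetric] smul neg matrix_vector_mul_lid inner_split_Plus[of \<xi>]
      by (simp add: inner_simps inner_commute algebra_simps)
    finally show "\<xi> \<bullet> (block_matrix X 0 0 (- (- Z)) *v \<xi>) \<le> \<xi> \<bullet> ((block_matrix (k *\<^sub>R mat 1) (- (k *\<^sub>R mat 1)) (- (k *\<^sub>R mat 1)) (k *\<^sub>R mat 1)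
     + \<delta> *\<^sub>R block_matrix ((1 / (bdist \<Omega> x)\<^sup>2) *\<^sub>R mat 1) 0 0 ((1 / (bdist \<Omega> y)\<^sup>2) *\<^sub>R mat 1) + \<delta> *\<^sub>R mat 1) *v \<xi>)" .
  qed
  moreover have "k *\<^sub>R mat 1 \<preceq> (k *\<^sub>R mat 1 :: real^'n^'n)" by (simp add: matrix_le_def)
  ultimately have "\<exists>A\<in>sym_matrices. A \<preceq> k *\<^sub>R mat 1 \<and> block_matrix X 0 0 (- (- Z)) \<preceq> block_matrix A (- A) (- A) A
     + \<delta> *\<^sub>R block_matrix ((1 / (bdist \<Omega> x)\<^sup>2) *\<^sub>R mat 1) 0 0 ((1 / (bdist \<Omega> y)\<^sup>2) *\<^sub>R mat 1) + \<delta> *\<^sub>R mat 1"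
    using sym(2) by (intro bexI[of _ "k *\<^sub>R mat 1"] conjI)
  from struct[unfolded structure_condition_def, rule_format, OF \<open>\<delta> > 0\<close> xy(1,2) XZ(1) sym(1) xy(3) FM
      pq[unfolded k_def] this[unfolded k_def]]
  show ?thesis .
qed

section \<open>The doubling argument\<close>

lemma bdist_le_add: "bdist \<Omega> x \<le> bdist \<Omega> y + norm (x - y)"
  unfolding bdist_def using infdist_triangle[of x "frontier \<Omega>" y] by (simp add: dist_norm)

lemma bdist_pos:
  assumes "open \<Omega>" "bounded \<Omega>" "x \<in> \<Omega>"
  shows "bdist \<Omega> x > 0"
proof -
  \<comment> \<open>\<open>infdist\<close> to the empty set is 0 by convention, so the boundary must
    first be shown nonempty: a bounded set is not the whole space.\<close>
  have "frontier \<Omega> \<noteq> {}"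
    using assms not_bounded_UNIV by (auto simp: frontier_eq_empty)
  moreover have "x \<notin> frontier \<Omega>" using assms by (simp add: frontier_def interior_open)
  ultimately show ?thesis
    unfolding bdist_def by (intro infdist_pos_not_in_closed) auto
qed

lemma mem_if_bdist_pos:
  assumes "open \<Omega>" "x \<in> closure \<Omega>" "bdist \<Omega> x > 0"
  shows "x \<in> \<Omega>"
proof (rule ccontr)
  assume "x \<notin> \<Omega>"
  then have "x \<in> frontier \<Omega>" using assms by (simp add: frontier_def interior_open)
  then show False using assms(3) by (simp add: bdist_def)
qed

text \<open>The supremum over \<open>c\<close> of \<open>barrier \<Omega> c x\<close> lies between the distance to the boundary and twice
  that distance; the maximisation below runs over \<open>c\<close> as well.\<close>

definition barrier :: "(real^'n) set \<Rightarrow> real^'n \<Rightarrow> real^'n \<Rightarrow> real" where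
  "barrier \<Omega> c x = bdist \<Omega> c - (norm (x - c))\<^sup>2 / bdist \<Omega> c"

lemma barrier_self [simp]: "barrier \<Omega> x x = bdist \<Omega> x"
  by (simp add: barrier_def)

lemma barrier_le_bdist_center: "bdist \<Omega> c > 0 \<Longrightarrow> barrier \<Omega> c x \<le> bdist \<Omega> c"
  by (simp add: barrier_def)

text \<open>With \<open>D = bdist \<Omega> c\<close> and \<open>n = norm (x - c)\<close> the barrier
  is (D - n)(1 + n/D). Positivity means n < D, so the second factor is below 2, and the first is at
  most the distance of \<open>x\<close>.\<close>

lemma barrier_le_bdist:
  assumes c: "bdist \<Omega> c > 0" and pos: "barrier \<Omega> c x > 0"
  shows "barrier \<Omega> c x \<le> 2 * bdist \<Omega> x"
proof -
  define D where "D = bdist \<Omega> c"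
  define n where "n = norm (x - c)"
  have "D > 0" "n \<ge> 0" using c by (auto simp: D_def n_def)
  have eq: "barrier \<Omega> c x = (D - n) * (1 + n / D)"
    using \<open>D > 0\<close> by (simp add: barrier_def D_def[symmetric] n_def[symmetric] power2_eq_square field_simps)
  have "1 + n / D > 0" using \<open>D > 0\<close> \<open>n \<ge> 0\<close> by (simp add: add_pos_nonneg)
  then have "D - n > 0" using pos unfolding eq by (simp add: zero_less_mult_iff)
  then have "(D - n) * (1 + n / D) \<le> (D - n) * 2"
    using \<open>D > 0\<close> by (intro mult_left_mono) (auto simp: divide_le_eq)
  moreover have "(D - n) * 2 \<le> 2 * bdist \<Omega> x"
    using bdist_le_add[of \<Omega> c x] by (simp add: D_def n_def norm_minus_commute)
  ultimately show ?thesis unfolding eq by (rule order_trans)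
qed

text \<open>The slope of the barrier is at most 2 and its curvature adds at most |h|, so its change
  \<open>s\<close> is within 3|h| and |h| \<le> d/6 keeps the relative change \<open>t\<close>
  within 1/2. Then ln (1 + t) \<ge> t - 2t^2 costs 18|h|^2/d^2, and the curvature inside
  \<open>t\<close> costs one more. A lower bound suffices because the logarithm is added to the
  function being maximised.\<close>

lemma ln_barrier_ge:
  assumes d: "0 < d" "d \<le> barrier \<Omega> c x" and c: "bdist \<Omega> c > 0"
  obtains b where "norm b \<le> 2 / d"
    "\<And>h. norm h \<le> d / 6 \<Longrightarrow> barrier \<Omega> c (x + h) > 0"
    "\<And>h. norm h \<le> d / 6 \<Longrightarrow> ln (barrier \<Omega> c (x + h)) \<ge> ln (barrier \<Omega> c x) + b \<bullet> h - 19 / d\<^sup>2 * (norm h)\<^sup>2"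
proof -
  define D where "D = bdist \<Omega> c"
  define \<pi> where "\<pi> = barrier \<Omega> c x"
  have pos: "D > 0" "\<pi> > 0" "d \<le> \<pi>" using assms by (auto simp: D_def \<pi>_def)
  have "\<pi> \<le> D" unfolding \<pi>_def D_def by (rule barrier_le_bdist_center[OF c])
  then have "d \<le> D" using pos by simp
  have "(norm (x - c))\<^sup>2 \<le> D\<^sup>2"
    using pos(1,2) by (simp add: \<pi>_def barrier_def D_def[symmetric] power2_eq_square field_simps)
  then have xc: "norm (x - c) \<le> D" using pos(1) by (simp add: power2_le_iff_abs_le)
  define b where "b = (- 2 / D) *\<^sub>R (x - c)"
  have "norm b = 2 / D * norm (x - c)" using pos(1) by (simp add: b_def)
  also have "\<dots> \<le> 2" using xc pos(1) by (simp add: divide_le_eq)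
  finally have b2: "norm b \<le> 2" .
  have bar: "barrier \<Omega> c (x + h) = \<pi> + (b \<bullet> h - (norm h)\<^sup>2 / D)" for h
  proof -
    have "(norm (x + h - c))\<^sup>2 = (norm (x - c))\<^sup>2 + 2 * ((x - c) \<bullet> h) + (norm h)\<^sup>2"
      unfolding power2_norm_eq_inner by (simp add: inner_simps inner_commute)
    then show ?thesis
      by (simp add: barrier_def \<pi>_def D_def[symmetric] b_def add_divide_distrib)
  qed
  have main: "barrier \<Omega> c (x + h) > 0 \<and>
     ln (barrier \<Omega> c (x + h)) \<ge> ln \<pi> + (b /\<^sub>R \<pi>) \<bullet> h - 19 / d\<^sup>2 * (norm h)\<^sup>2" if h: "norm h \<le> d / 6" for h
  proof -
    define s where "s = b \<bullet> h - (norm h)\<^sup>2 / D"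
    define t where "t = s / \<pi>"
    have "\<bar>b \<bullet> h\<bar> \<le> 2 * norm h"
      using Cauchy_Schwarz_ineq2[of b h] mult_right_mono[OF b2, of "norm h"] by simp
    moreover have "(norm h)\<^sup>2 / D \<le> norm h"
    proof -
      have "norm h * norm h \<le> norm h * D" using h d(1) \<open>d \<le> D\<close> by (intro mult_left_mono) auto
      then show ?thesis using pos(1) by (simp add: divide_le_eq power2_eq_square)
    qed
    moreover have "(norm h)\<^sup>2 / D \<ge> 0" using pos(1) by simp
    ultimately have "\<bar>s\<bar> \<le> 3 * norm h" unfolding s_def by linarith
    then have "\<bar>t\<bar> \<le> 3 * norm h / d"
      unfolding t_def abs_divide using pos d by (intro frac_le) auto
    moreover have "3 * norm h / d \<le> 1 / 2" using h d(1) by (simp add: divide_le_eq)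
    ultimately have t: "\<bar>t\<bar> \<le> 1 / 2" "\<bar>t\<bar> \<le> 3 * norm h / d" by linarith+
    have "\<bar>ln (1 + t) - t\<bar> \<le> 2 * t\<^sup>2"
      by (rule abs_ln_one_plus_x_minus_x_bound[OF t(1)])
    moreover have "t\<^sup>2 \<le> (3 * norm h / d)\<^sup>2"
      using t(2) by (metis abs_ge_zero power2_abs power_mono)
    moreover have "(3 * norm h / d)\<^sup>2 = 9 / d\<^sup>2 * (norm h)\<^sup>2" by (simp add: power_mult_distrib power_divide)
    ultimately have ln1: "ln (1 + t) \<ge> t - 18 / d\<^sup>2 * (norm h)\<^sup>2" by linarith
    have "t = (b /\<^sub>R \<pi>) \<bullet> h - (norm h)\<^sup>2 / (D * \<pi>)"
      using pos by (simp add: t_def s_def right_diff_distrib divide_inverse mult_ac)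
    moreover have "(norm h)\<^sup>2 / (D * \<pi>) \<le> (norm h)\<^sup>2 / d\<^sup>2"
      using pos d \<open>d \<le> D\<close> by (intro divide_left_mono) (auto simp: power2_eq_square intro!: mult_mono)
    ultimately have ln2: "ln (1 + t) \<ge> (b /\<^sub>R \<pi>) \<bullet> h - 19 / d\<^sup>2 * (norm h)\<^sup>2"
      using ln1 by (simp add: field_simps)
    have eq: "barrier \<Omega> c (x + h) = \<pi> * (1 + t)"
      unfolding bar s_def[symmetric] t_def using pos by (simp add: distrib_left)
    have "1 + t > 0" using t(1) by linarith
    then show ?thesis using ln2 pos unfolding eq by (simp add: ln_mult)
  qed
  show thesis
  proof
    have "norm (b /\<^sub>R \<pi>) = norm b / \<pi>" using pos by (simp add: divide_inverse mult.commute)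
    also have "\<dots> \<le> 2 / d" using b2 pos d by (intro frac_le) auto
    finally show "norm (b /\<^sub>R \<pi>) \<le> 2 / d" .
  qed (use main in \<open>auto simp: \<pi>_def\<close>)
qed

section \<open>The penalised maximum\<close>

text \<open>With \<open>t\<close> the ratio of |w + h|^2 to |w|^2, the power t^(\<alpha>/2) lies
  below its tangent at t = 1, an instance of Young's inequality. The case t = 0, that is w + h = 0,
  is included.\<close>

lemma norm_powr_add_le:
  fixes w h :: "'a::real_inner"
  assumes "w \<noteq> 0" and \<alpha>: "0 < \<alpha>" "\<alpha> \<le> 1"
  shows "norm (w + h) powr \<alpha> \<le> norm w powr \<alpha> + \<alpha> * norm w powr (\<alpha> - 2) * (w \<bullet> h + (norm h)\<^sup>2 / 2)"
proof -
  define n where "n = norm w"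
  have "n > 0" using assms by (simp add: n_def)
  define Q where "Q = w \<bullet> h + (norm h)\<^sup>2 / 2"
  define t where "t = (norm (w + h))\<^sup>2 / n\<^sup>2"
  have t_nonneg: "t \<ge> 0" by (simp add: t_def)
  have t: "t = 1 + 2 * Q / n\<^sup>2"
  proof -
    have "(norm (w + h))\<^sup>2 = n\<^sup>2 + 2 * Q"
      unfolding n_def Q_def power2_norm_eq_inner by (simp add: inner_simps inner_commute)
    then show ?thesis using \<open>n > 0\<close> by (simp add: t_def add_divide_distrib)
  qed
  have pw: "t powr (\<alpha> / 2) \<le> \<alpha> / 2 * t + (1 - \<alpha> / 2)"
  proof (cases "t > 0")
    case True
    then show ?thesis
      using Youngs_inequality_0[of "\<alpha> / 2" "1 - \<alpha> / 2" t 1] \<alpha> by simp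
  next
    case False
    then have "t = 0" by (auto simp: t_def not_less divide_le_0_iff)
    then show ?thesis using \<alpha> by simp
  qed
  have "n powr \<alpha> * t powr (\<alpha> / 2) = norm (w + h) powr \<alpha>"
  proof -
    have sq: "v powr \<alpha> = (v\<^sup>2) powr (\<alpha> / 2)" if "v \<ge> 0" for v :: real
      using that by (cases "v = 0") (simp_all add: powr_powr flip: powr_numeral)
    have "n powr \<alpha> * t powr (\<alpha> / 2) = (n\<^sup>2 * t) powr (\<alpha> / 2)"
      using sq[of n] \<open>n > 0\<close> t_nonneg by (simp add: powr_mult)
    also have "n\<^sup>2 * t = (norm (w + h))\<^sup>2" using \<open>n > 0\<close> by (simp add: t_def)
    finally show ?thesis using sq[of "norm (w + h)"] by simp
  qed
  moreover have "n powr \<alpha> * t powr (\<alpha> / 2) \<le> n powr \<alpha> * (\<alpha> / 2 * t + (1 - \<alpha> / 2))"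
    using pw by (intro mult_left_mono) auto
  moreover have "n powr \<alpha> * (\<alpha> / 2 * t + (1 - \<alpha> / 2)) = n powr \<alpha> + \<alpha> * (n powr \<alpha> / n\<^sup>2) * Q"
    unfolding t using \<open>n > 0\<close> by (simp add: field_simps)
  moreover have "n powr (\<alpha> - 2) = n powr \<alpha> / n\<^sup>2"
    using \<open>n > 0\<close> by (simp add: powr_diff)
  ultimately show ?thesis by (simp add: n_def Q_def)
qed

text \<open>Maximising over the centres as well makes \<open>c\<close> at least as good as the
  centre \<open>x\<close>, whose barrier at \<open>x\<close> is \<open>bdist \<Omega> x\<close>;
  with \<open>c\<close> and \<open>e\<close> frozen, a smooth penalty remains. Dividing by
  \<open>R\<close> makes the logarithms nonpositive, so dropping them preserves the gap
  \<theta>.\<close>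

lemma penalised_maximum:
  fixes \<Omega> :: "(real^'n) set"
  assumes \<Omega>: "open \<Omega>" "bounded \<Omega>" and u: "continuous_on \<Omega> u" "bounded (u ` \<Omega>)"
    and pos: "\<alpha> > 0" "\<epsilon> > 0" "\<theta> > 0" "R > 0" and a: "a \<ge> 0"
    and R: "\<And>z. z \<in> closure \<Omega> \<Longrightarrow> bdist \<Omega> z \<le> R"
    and x0: "x0 \<in> \<Omega>" "y0 \<in> \<Omega>"
    and start: "u x0 - u y0 - a * norm (x0 - y0) powr \<alpha> + \<epsilon> * (ln (bdist \<Omega> x0 / R) + ln (bdist \<Omega> y0 / R)) \<ge> \<theta>"
  obtains x y c e where "x \<in> \<Omega>" "y \<in> \<Omega>" "c \<in> \<Omega>" "e \<in> \<Omega>"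
    "bdist \<Omega> x \<le> barrier \<Omega> c x" "bdist \<Omega> y \<le> barrier \<Omega> e y"
    "u x - u y - a * norm (x - y) powr \<alpha> \<ge> \<theta>"
    "\<And>x' y'. x' \<in> \<Omega> \<Longrightarrow> y' \<in> \<Omega> \<Longrightarrow> barrier \<Omega> c x' > 0 \<Longrightarrow> barrier \<Omega> e y' > 0 \<Longrightarrow>
       u x' - u y' - a * norm (x' - y') powr \<alpha> + \<epsilon> * (ln (barrier \<Omega> c x') + ln (barrier \<Omega> e y'))
       \<le> u x - u y - a * norm (x - y) powr \<alpha> + \<epsilon> * (ln (barrier \<Omega> c x) + ln (barrier \<Omega> e y))"
proof -
  obtain m where m: "\<And>x. x \<in> \<Omega> \<Longrightarrow> \<bar>u x\<bar> \<le> m" using u(2) by (auto simp: bounded_iff)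
  have dpos: "bdist \<Omega> z > 0" if "z \<in> \<Omega>" for z using bdist_pos[OF \<Omega> that] .
  define \<Phi> where "\<Phi> x c y e = u x - u y - a * norm (x - y) powr \<alpha> + \<epsilon> * (ln (barrier \<Omega> c x / R) + ln (barrier \<Omega> e y / R))" for x c y e
  \<comment> \<open>As \<open>u x - u y \<le> 2 * m\<close> and both logarithms are nonpositive, a
    value of \<open>\<Phi>\<close> at least \<theta> forces each logarithm above -2m/\<epsilon>, so
    each barrier is at least \<kappa>.\<close>
  define \<kappa> where "\<kappa> = R * exp (- 2 * m / \<epsilon>)"
  have "\<kappa> > 0" using pos by (simp add: \<kappa>_def)
  \<comment> \<open>The last condition is \<kappa> \<le> barrier multiplied by the distance of the
    centre, which is closed up to the boundary; the two lower bounds on distances keep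
    \<open>S\<close> inside the domain.\<close>
  define S where "S = {w \<in> closure \<Omega> \<times> closure \<Omega>. \<kappa> \<le> bdist \<Omega> (snd w) \<and> \<kappa> / 2 \<le> bdist \<Omega> (fst w) \<and>
      \<kappa> * bdist \<Omega> (snd w) \<le> (bdist \<Omega> (snd w))\<^sup>2 - (norm (fst w - snd w))\<^sup>2}"
  have lnneg: "ln (barrier \<Omega> c x / R) \<le> 0" if "c \<in> \<Omega>" "barrier \<Omega> c x > 0" for c x
  proof -
    have "barrier \<Omega> c x \<le> R"
      using barrier_le_bdist_center[OF dpos[OF that(1)], of x] R[of c] that(1) closure_subset[of \<Omega>] by auto
    then show ?thesis using that(2) pos by simp
  qed
  have in_S: "(x, c) \<in> S" if "x \<in> \<Omega>" "c \<in> \<Omega>" "\<kappa> \<le> barrier \<Omega> c x" for x c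
  proof -
    have "barrier \<Omega> c x > 0" using that \<open>\<kappa> > 0\<close> by simp
    then have "barrier \<Omega> c x \<le> 2 * bdist \<Omega> x" "barrier \<Omega> c x \<le> bdist \<Omega> c"
      using barrier_le_bdist barrier_le_bdist_center dpos that by blast+
    moreover have "barrier \<Omega> c x * bdist \<Omega> c = (bdist \<Omega> c)\<^sup>2 - (norm (x - c))\<^sup>2"
      using dpos[OF that(2)] by (simp add: barrier_def field_simps power2_eq_square)
    moreover have "\<kappa> * bdist \<Omega> c \<le> barrier \<Omega> c x * bdist \<Omega> c"
      using that dpos[OF that(2)] by (intro mult_right_mono) auto
    ultimately show ?thesis using that closure_subset[of \<Omega>] by (auto simp: S_def)
  qed
  have S_D: "fst w \<in> \<Omega>" "snd w \<in> \<Omega>" "barrier \<Omega> (snd w) (fst w) > 0" if "w \<in> S" for w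
  proof -
    have pos': "bdist \<Omega> (snd w) > 0" "bdist \<Omega> (fst w) > 0" using that \<open>\<kappa> > 0\<close> by (auto simp: S_def)
    then show "fst w \<in> \<Omega>" "snd w \<in> \<Omega>"
      using that mem_if_bdist_pos[OF \<Omega>(1)] by (auto simp: S_def)
    have "barrier \<Omega> (snd w) (fst w) = ((bdist \<Omega> (snd w))\<^sup>2 - (norm (fst w - snd w))\<^sup>2) / bdist \<Omega> (snd w)"
      using pos' by (simp add: barrier_def diff_divide_distrib power2_eq_square)
    moreover have "0 < \<kappa> * bdist \<Omega> (snd w)" using \<open>\<kappa> > 0\<close> pos'(1) by simp
    moreover have "\<kappa> * bdist \<Omega> (snd w) \<le> (bdist \<Omega> (snd w))\<^sup>2 - (norm (fst w - snd w))\<^sup>2"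
      using that by (simp add: S_def)
    ultimately show "barrier \<Omega> (snd w) (fst w) > 0"
      using pos' by (metis divide_pos_pos less_le_trans)
  qed
  have S_of_\<Phi>: "(x, c) \<in> S \<and> (y, e) \<in> S"
    if "x \<in> \<Omega>" "c \<in> \<Omega>" "y \<in> \<Omega>" "e \<in> \<Omega>" "barrier \<Omega> c x > 0" "barrier \<Omega> e y > 0" "\<Phi> x c y e \<ge> \<theta>" for x c y e
  proof -
    have "u x - u y \<le> 2 * m" using m[of x] m[of y] that by linarith
    moreover have "a * norm (x - y) powr \<alpha> \<ge> 0" using a by simp
    ultimately have "\<epsilon> * (ln (barrier \<Omega> c x / R) + ln (barrier \<Omega> e y / R)) \<ge> - 2 * m"
      using that(7) pos unfolding \<Phi>_def by linarith
    then have sum: "ln (barrier \<Omega> c x / R) + ln (barrier \<Omega> e y / R) \<ge> - 2 * m / \<epsilon>"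
      using pos by (subst pos_divide_le_eq) (simp_all add: mult.commute)
    have neg: "ln (barrier \<Omega> c x / R) \<le> 0" "ln (barrier \<Omega> e y / R) \<le> 0"
      using lnneg that by auto
    have lower: "\<kappa> \<le> b" if "- 2 * m / \<epsilon> \<le> ln (b / R)" "b > 0" for b
    proof -
      have "exp (- 2 * m / \<epsilon>) \<le> b / R" using that pos by (metis divide_pos_pos exp_le_cancel_iff exp_ln)
      then show ?thesis using pos by (simp add: \<kappa>_def le_divide_eq mult.commute)
    qed
    have "\<kappa> \<le> barrier \<Omega> c x" "\<kappa> \<le> barrier \<Omega> e y"
      by (rule lower; use sum neg that in linarith)+
    then show ?thesis using in_S that by blast
  qed
  have contd: "continuous_on A (\<lambda>w. bdist \<Omega> (f w))" if "continuous_on A f" for A and f :: "'b::topological_space \<Rightarrow> real^'n"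
    unfolding bdist_def using that by (rule continuous_on_infdist)
  have "compact S"
  proof -
    have "closed {w. \<kappa> \<le> bdist \<Omega> (snd w) \<and> \<kappa> / 2 \<le> bdist \<Omega> (fst w) \<and>
      \<kappa> * bdist \<Omega> (snd w) \<le> (bdist \<Omega> (snd w))\<^sup>2 - (norm (fst w - snd w))\<^sup>2}"
      by (intro closed_Collect_conj closed_Collect_le continuous_intros contd)
    moreover have "compact (closure \<Omega> \<times> closure \<Omega>)"
      using \<Omega>(2) by (intro compact_Times) (simp_all add: compact_closure)
    moreover have "S = (closure \<Omega> \<times> closure \<Omega>) \<inter> {w. \<kappa> \<le> bdist \<Omega> (snd w) \<and> \<kappa> / 2 \<le> bdist \<Omega> (fst w) \<and>
      \<kappa> * bdist \<Omega> (snd w) \<le> (bdist \<Omega> (snd w))\<^sup>2 - (norm (fst w - snd w))\<^sup>2}"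
      by (auto simp: S_def)
    ultimately show ?thesis by (simp add: compact_Int_closed)
  qed
  then have "compact (S \<times> S)" by (intro compact_Times)
  moreover have start_S: "(x0, x0) \<in> S \<and> (y0, y0) \<in> S" and start_\<Phi>: "\<Phi> x0 x0 y0 y0 \<ge> \<theta>"
    using S_of_\<Phi>[of x0 x0 y0 y0] x0 dpos start by (auto simp: \<Phi>_def)
  moreover have "continuous_on (S \<times> S) (\<lambda>w. \<Phi> (fst (fst w)) (snd (fst w)) (fst (snd w)) (snd (snd w)))"
  proof -
    have cu: "continuous_on (S \<times> S) (\<lambda>w. u (fst (fst w)))" "continuous_on (S \<times> S) (\<lambda>w. u (fst (snd w)))"
      by (rule continuous_on_compose2[OF u(1)]; use S_D in \<open>force intro!: continuous_intros\<close>)+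
    have dne: "bdist \<Omega> (snd (fst w)) \<noteq> 0" "bdist \<Omega> (snd (snd w)) \<noteq> 0" if "w \<in> S \<times> S" for w
      using that S_D(2)[of "fst w"] S_D(2)[of "snd w"] dpos by force+
    have cb: "continuous_on (S \<times> S) (\<lambda>w. barrier \<Omega> (snd (fst w)) (fst (fst w)) / R)"
        "continuous_on (S \<times> S) (\<lambda>w. barrier \<Omega> (snd (snd w)) (fst (snd w)) / R)"
      unfolding barrier_def using dne pos by (auto intro!: continuous_intros contd)
    have bne: "barrier \<Omega> (snd (fst w)) (fst (fst w)) / R \<noteq> 0" "barrier \<Omega> (snd (snd w)) (fst (snd w)) / R \<noteq> 0"
      if "w \<in> S \<times> S" for w
      using that S_D(3)[of "fst w"] S_D(3)[of "snd w"] pos by (auto simp: mem_Times_iff)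
    have "continuous_on (S \<times> S) (\<lambda>w. norm (fst (fst w) - fst (snd w)) powr \<alpha>)"
      using pos by (intro continuous_on_powr' continuous_intros) auto
    moreover have "continuous_on (S \<times> S) (\<lambda>w. ln (barrier \<Omega> (snd (fst w)) (fst (fst w)) / R))"
      by (rule continuous_on_ln[OF cb(1)]) (use bne(1) in blast)
    moreover have "continuous_on (S \<times> S) (\<lambda>w. ln (barrier \<Omega> (snd (snd w)) (fst (snd w)) / R))"
      by (rule continuous_on_ln[OF cb(2)]) (use bne(2) in blast)
    ultimately show ?thesis
      unfolding \<Phi>_def by (intro continuous_on_add continuous_on_diff continuous_on_mult continuous_on_const cu)
  qed
  ultimately obtain w where w: "w \<in> S \<times> S" and wmax: "\<And>w'. w' \<in> S \<times> S \<Longrightarrow>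
      \<Phi> (fst (fst w')) (snd (fst w')) (fst (snd w')) (snd (snd w')) \<le> \<Phi> (fst (fst w)) (snd (fst w)) (fst (snd w)) (snd (snd w))"
    using continuous_attains_sup[of "S \<times> S"] by blast
  define x where "x = fst (fst w)"
  define c where "c = snd (fst w)"
  define y where "y = fst (snd w)"
  define e where "e = snd (snd w)"
  have mem: "x \<in> \<Omega>" "c \<in> \<Omega>" "y \<in> \<Omega>" "e \<in> \<Omega>" and bpos: "barrier \<Omega> c x > 0" "barrier \<Omega> e y > 0"
    using S_D[of "fst w"] S_D[of "snd w"] w by (auto simp: x_def c_def y_def e_def mem_Times_iff)
  have max_S: "\<Phi> x' c' y' e' \<le> \<Phi> x c y e" if "(x', c') \<in> S" "(y', e') \<in> S" for x' c' y' e'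
    using wmax[of "((x', c'), (y', e'))"] that by (simp add: x_def c_def y_def e_def)
  have "\<Phi> x c y e \<ge> \<theta>" using max_S[of x0 x0 y0 y0] start_S start_\<Phi> by linarith
  \<comment> \<open>Where a pair leaves \<open>S\<close>, the value of \<open>\<Phi>\<close> is
    below \<theta>, so the maximum over the compact set is global.\<close>
  then have max: "\<Phi> x' c' y' e' \<le> \<Phi> x c y e"
    if "x' \<in> \<Omega>" "c' \<in> \<Omega>" "y' \<in> \<Omega>" "e' \<in> \<Omega>" "barrier \<Omega> c' x' > 0" "barrier \<Omega> e' y' > 0" for x' c' y' e'
    using max_S S_of_\<Phi>[OF that] by (cases "\<Phi> x' c' y' e' \<ge> \<theta>") auto
  have ln_eq: "ln (b / R) = ln b - ln R" if "b > 0" for b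
    using that pos by (simp add: ln_div)
  show thesis
  proof (rule that[OF mem(1,3,2,4)])
    \<comment> \<open>Only the centre is varied, from \<open>c\<close> to \<open>x\<close>; all
      other terms cancel.\<close>
    have "ln (bdist \<Omega> x / R) \<le> ln (barrier \<Omega> c x / R)"
      using max[of x x y e] mem bpos dpos pos by (simp add: \<Phi>_def)
    then show "bdist \<Omega> x \<le> barrier \<Omega> c x"
      using dpos[OF mem(1)] bpos(1) pos by (simp add: divide_le_cancel)
    have "ln (bdist \<Omega> y / R) \<le> ln (barrier \<Omega> e y / R)"
      using max[of x c y y] mem bpos dpos pos by (simp add: \<Phi>_def)
    then show "bdist \<Omega> y \<le> barrier \<Omega> e y"
      using dpos[OF mem(3)] bpos(2) pos by (simp add: divide_le_cancel)
    have "\<epsilon> * (ln (barrier \<Omega> c x / R) + ln (barrier \<Omega> e y / R)) \<le> 0"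
      using lnneg mem bpos pos by (intro mult_nonneg_nonpos add_nonpos_nonpos) auto
    then show "u x - u y - a * norm (x - y) powr \<alpha> \<ge> \<theta>"
      using \<open>\<Phi> x c y e \<ge> \<theta>\<close> by (simp add: \<Phi>_def)
    show "u x' - u y' - a * norm (x' - y') powr \<alpha> + \<epsilon> * (ln (barrier \<Omega> c x') + ln (barrier \<Omega> e y'))
       \<le> u x - u y - a * norm (x - y) powr \<alpha> + \<epsilon> * (ln (barrier \<Omega> c x) + ln (barrier \<Omega> e y))"
      if "x' \<in> \<Omega>" "y' \<in> \<Omega>" "barrier \<Omega> c x' > 0" "barrier \<Omega> e y' > 0" for x' y'
      using max[of x' c y' e] that mem bpos by (simp add: \<Phi>_def ln_eq algebra_simps)
  qed
qed

section \<open>The contradiction at the maximum point\<close>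

text \<open>The theorem on sums yields jets at some (x', y') near (x, y). With \<delta> = 40
  \<epsilon> there is room in every requirement of the structure condition: slopes err by
  2\<epsilon>/d from the barrier and \<epsilon>/d from \<zeta>, the diagonal blocks are
  38\<epsilon>/d^2, and \<delta> I has to absorb 21\<epsilon>. By continuity the strict inequalities
  survive at (x', y'); arguing by contradiction makes the negated conclusion one of them.\<close>

lemma doubling_estimate:
  fixes \<Omega> :: "(real^'n) set" and u :: "real^'n \<Rightarrow> real" and a \<alpha> :: real
  defines "M \<equiv> SUP x\<in>\<Omega>. \<bar>u x\<bar>"
  defines "k \<equiv> \<lambda>w :: real^'n. \<alpha> * a * norm w powr (\<alpha> - 2)"
  assumes \<Omega>: "open \<Omega>" "bounded \<Omega>" and u: "continuous_on \<Omega> u" "bounded (u ` \<Omega>)"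
    and sub: "viscosity_subsolution \<Omega> F u" and super: "viscosity_supersolution \<Omega> F u"
    and struct: "structure_condition \<Omega> F M a L \<alpha> \<beta>"
    and xy: "x \<in> \<Omega>" "y \<in> \<Omega>" "x \<noteq> y" and pos: "a > 0" "\<alpha> > 0" "\<epsilon> > 0" "r > 0"
    and b: "norm b1 \<le> 2 / bdist \<Omega> x" "norm b2 \<le> 2 / bdist \<Omega> y"
    and ball: "cball x r \<subseteq> \<Omega>" "cball y r \<subseteq> \<Omega>"
    and touch: "\<And>h1 h2. norm h1 \<le> r \<Longrightarrow> norm h2 \<le> r \<Longrightarrow>
       u (x + h1) - u (y + h2) \<le> u x - u y + (k (x - y) *\<^sub>R (x - y) - \<epsilon> *\<^sub>R b1) \<bullet> h1
         + (- (k (x - y) *\<^sub>R (x - y)) - \<epsilon> *\<^sub>R b2) \<bullet> h2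
         + sum_form (k (x - y)) (38 * \<epsilon> / (bdist \<Omega> x)\<^sup>2) (38 * \<epsilon> / (bdist \<Omega> y)\<^sup>2) h1 h2 / 2"
  shows "u x - u y \<le> \<beta> * a * norm (x - y) powr \<alpha> + L * (40 * \<epsilon>)"
proof (rule ccontr)
  assume contra: "\<not> ?thesis"
  define dx where "dx = bdist \<Omega> x"
  define dy where "dy = bdist \<Omega> y"
  have d: "dx > 0" "dy > 0" using bdist_pos[OF \<Omega>] xy by (auto simp: dx_def dy_def)
  define w where "w = x - y"
  have "w \<noteq> 0" using xy by (simp add: w_def)
  define F' where "F' = nhds (x, y)"
  have fs [tendsto_intros]: "(fst \<longlongrightarrow> x) F'" "(snd \<longlongrightarrow> y) F'"
    unfolding F'_def using tendsto_fst[OF filterlim_ident[of "nhds (x, y)"]] tendsto_snd[OF filterlim_ident[of "nhds (x, y)"]]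
    by simp_all
  have wlim [tendsto_intros]: "((\<lambda>z. fst z - snd z) \<longlongrightarrow> w) F'"
    unfolding w_def by (intro tendsto_intros)
  have klim [tendsto_intros]: "((\<lambda>z. k (fst z - snd z)) \<longlongrightarrow> k w) F'"
    unfolding k_def using \<open>w \<noteq> 0\<close> by (intro tendsto_intros) auto
  have dlim [tendsto_intros]: "((\<lambda>z. bdist \<Omega> (fst z)) \<longlongrightarrow> dx) F'" "((\<lambda>z. bdist \<Omega> (snd z)) \<longlongrightarrow> dy) F'"
    unfolding dx_def dy_def bdist_def by (intro tendsto_intros)+
  have ulim [tendsto_intros]: "((\<lambda>z. u (fst z)) \<longlongrightarrow> u x) F'" "((\<lambda>z. u (snd z)) \<longlongrightarrow> u y) F'"
    using u(1) \<Omega>(1) xy by (auto intro!: isCont_tendsto_compose[OF _ fs(1)] isCont_tendsto_compose[OF _ fs(2)] simp: continuous_on_eq_continuous_at)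
  have "\<forall>\<^sub>F z in F'. 0 < norm (fst z - snd z)"
    using \<open>w \<noteq> 0\<close> by (intro order_tendstoD(1)[OF tendsto_norm[OF wlim]]) auto
  moreover have "\<forall>\<^sub>F z in F'. 0 < 40 * \<epsilon> / bdist \<Omega> (fst z) - 3 * \<epsilon> / dx - norm (k w *\<^sub>R w - k (fst z - snd z) *\<^sub>R (fst z - snd z))"
  proof (rule order_tendstoD(1))
    show "((\<lambda>z. 40 * \<epsilon> / bdist \<Omega> (fst z) - 3 * \<epsilon> / dx - norm (k w *\<^sub>R w - k (fst z - snd z) *\<^sub>R (fst z - snd z)))
       \<longlongrightarrow> 40 * \<epsilon> / dx - 3 * \<epsilon> / dx - norm (k w *\<^sub>R w - k w *\<^sub>R w)) F'"
      using d by (intro tendsto_intros) auto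
    show "0 < 40 * \<epsilon> / dx - 3 * \<epsilon> / dx - norm (k w *\<^sub>R w - k w *\<^sub>R w)"
      using d pos by (simp add: divide_strict_right_mono)
  qed
  moreover have "\<forall>\<^sub>F z in F'. 0 < 40 * \<epsilon> / bdist \<Omega> (snd z) - 3 * \<epsilon> / dy - norm (k w *\<^sub>R w - k (fst z - snd z) *\<^sub>R (fst z - snd z))"
  proof (rule order_tendstoD(1))
    show "((\<lambda>z. 40 * \<epsilon> / bdist \<Omega> (snd z) - 3 * \<epsilon> / dy - norm (k w *\<^sub>R w - k (fst z - snd z) *\<^sub>R (fst z - snd z)))
       \<longlongrightarrow> 40 * \<epsilon> / dy - 3 * \<epsilon> / dy - norm (k w *\<^sub>R w - k w *\<^sub>R w)) F'"
      using d by (intro tendsto_intros) auto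
    show "0 < 40 * \<epsilon> / dy - 3 * \<epsilon> / dy - norm (k w *\<^sub>R w - k w *\<^sub>R w)"
      using d pos by (simp add: divide_strict_right_mono)
  qed
  moreover have "\<forall>\<^sub>F z in F'. 38 * \<epsilon> / dx\<^sup>2 < 40 * \<epsilon> / (bdist \<Omega> (fst z))\<^sup>2"
  proof (rule order_tendstoD(1))
    show "((\<lambda>z. 40 * \<epsilon> / (bdist \<Omega> (fst z))\<^sup>2) \<longlongrightarrow> 40 * \<epsilon> / dx\<^sup>2) F'"
      using d by (intro tendsto_intros) auto
    show "38 * \<epsilon> / dx\<^sup>2 < 40 * \<epsilon> / dx\<^sup>2" using d pos by (simp add: divide_strict_right_mono)
  qed
  moreover have "\<forall>\<^sub>F z in F'. 38 * \<epsilon> / dy\<^sup>2 < 40 * \<epsilon> / (bdist \<Omega> (snd z))\<^sup>2"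
  proof (rule order_tendstoD(1))
    show "((\<lambda>z. 40 * \<epsilon> / (bdist \<Omega> (snd z))\<^sup>2) \<longlongrightarrow> 40 * \<epsilon> / dy\<^sup>2) F'"
      using d by (intro tendsto_intros) auto
    show "38 * \<epsilon> / dy\<^sup>2 < 40 * \<epsilon> / dy\<^sup>2" using d pos by (simp add: divide_strict_right_mono)
  qed
  \<comment> \<open>Since |v1 - v2|^2 \<le> 2(|v1|^2 + |v2|^2), a change of \<open>k\<close> by
    10\<epsilon> costs 20\<epsilon> in the form; \<open>\<zeta> \<le> \<epsilon>\<close> adds one
    more.\<close>
  moreover have "\<forall>\<^sub>F z in F'. \<bar>k w - k (fst z - snd z)\<bar> < 10 * \<epsilon>"
  proof (rule order_tendstoD(2))
    show "((\<lambda>z. \<bar>k w - k (fst z - snd z)\<bar>) \<longlongrightarrow> \<bar>k w - k w\<bar>) F'" by (intro tendsto_intros)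
  qed (use pos in simp)
  moreover have "\<forall>\<^sub>F z in F'. L * (40 * \<epsilon>) < u (fst z) - u (snd z) - \<beta> * a * norm (fst z - snd z) powr \<alpha>"
  proof (rule order_tendstoD(1))
    show "((\<lambda>z. u (fst z) - u (snd z) - \<beta> * a * norm (fst z - snd z) powr \<alpha>) \<longlongrightarrow> u x - u y - \<beta> * a * norm w powr \<alpha>) F'"
      using \<open>w \<noteq> 0\<close> by (intro tendsto_intros) auto
  qed (use contra in \<open>simp add: w_def\<close>)
  ultimately have "\<forall>\<^sub>F z in F'. 0 < norm (fst z - snd z)
      \<and> 0 < 40 * \<epsilon> / bdist \<Omega> (fst z) - 3 * \<epsilon> / dx - norm (k w *\<^sub>R w - k (fst z - snd z) *\<^sub>R (fst z - snd z))
      \<and> 0 < 40 * \<epsilon> / bdist \<Omega> (snd z) - 3 * \<epsilon> / dy - norm (k w *\<^sub>R w - k (fst z - snd z) *\<^sub>R (fst z - snd z))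
      \<and> 38 * \<epsilon> / dx\<^sup>2 < 40 * \<epsilon> / (bdist \<Omega> (fst z))\<^sup>2 \<and> 38 * \<epsilon> / dy\<^sup>2 < 40 * \<epsilon> / (bdist \<Omega> (snd z))\<^sup>2
      \<and> \<bar>k w - k (fst z - snd z)\<bar> < 10 * \<epsilon>
      \<and> L * (40 * \<epsilon>) < u (fst z) - u (snd z) - \<beta> * a * norm (fst z - snd z) powr \<alpha>"
    by eventually_elim blast
  then obtain \<rho> where "\<rho> > 0" and near: "\<And>x' y'. dist (x', y') (x, y) < \<rho> \<Longrightarrow> 0 < norm (x' - y')
      \<and> 0 < 40 * \<epsilon> / bdist \<Omega> x' - 3 * \<epsilon> / dx - norm (k w *\<^sub>R w - k (x' - y') *\<^sub>R (x' - y'))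
      \<and> 0 < 40 * \<epsilon> / bdist \<Omega> y' - 3 * \<epsilon> / dy - norm (k w *\<^sub>R w - k (x' - y') *\<^sub>R (x' - y'))
      \<and> 38 * \<epsilon> / dx\<^sup>2 < 40 * \<epsilon> / (bdist \<Omega> x')\<^sup>2 \<and> 38 * \<epsilon> / dy\<^sup>2 < 40 * \<epsilon> / (bdist \<Omega> y')\<^sup>2
      \<and> \<bar>k w - k (x' - y')\<bar> < 10 * \<epsilon>
      \<and> L * (40 * \<epsilon>) < u x' - u y' - \<beta> * a * norm (x' - y') powr \<alpha>"
    unfolding F'_def eventually_nhds_metric by (metis fst_conv snd_conv)
  \<comment> \<open>\<open>\<rho> / 2\<close> for each of the two displacements, \<open>r\<close> to
    stay inside the domain, \<open>\<epsilon>\<close> for the Hessian error, the last two for the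
    slope errors.\<close>
  define \<zeta> where "\<zeta> = min (min (\<rho> / 2) r) (min \<epsilon> (min (\<epsilon> / dx) (\<epsilon> / dy)))"
  have \<zeta>: "\<zeta> > 0" "\<zeta> \<le> \<rho> / 2" "\<zeta> \<le> r" "\<zeta> \<le> \<epsilon>" "\<zeta> \<le> \<epsilon> / dx" "\<zeta> \<le> \<epsilon> / dy"
    using \<open>\<rho> > 0\<close> pos divide_pos_pos[OF pos(3) d(1)] divide_pos_pos[OF pos(3) d(2)]
    unfolding \<zeta>_def by linarith+
  define l1 where "l1 = k w *\<^sub>R w - \<epsilon> *\<^sub>R b1"
  define l2 where "l2 = - (k w *\<^sub>R w) - \<epsilon> *\<^sub>R b2"
  have cu: "continuous_on (cball 0 r) (\<lambda>h. u (x + h))" "continuous_on (cball 0 r) (\<lambda>h. - u (y + h))"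
    using ball by (auto intro!: continuous_intros continuous_on_compose2[OF u(1)] simp: subset_iff dist_norm)
  have coef: "0 \<le> k w" "0 \<le> 38 * \<epsilon> / dx\<^sup>2" "0 \<le> 38 * \<epsilon> / dy\<^sup>2"
    using pos by (auto simp: k_def)
  have "u (x + h1) + - u (y + h2) \<le> u (x + 0) + - u (y + 0) + l1 \<bullet> h1 + l2 \<bullet> h2
      + sum_form (k w) (38 * \<epsilon> / dx\<^sup>2) (38 * \<epsilon> / dy\<^sup>2) h1 h2 / 2" if "h1 \<in> cball 0 r" "h2 \<in> cball 0 r" for h1 h2
    using touch[of h1 h2] that by (simp add: w_def l1_def l2_def dx_def dy_def)
  from theorem_on_sums[OF cu \<open>r > 0\<close> \<zeta>(1) coef this]
  obtain h1 h2 p1 p2 A1 A2 where h: "norm h1 < \<zeta>" "norm h2 < \<zeta>" and p: "norm (p1 - l1) < \<zeta>" "norm (p2 - l2) < \<zeta>"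
    and jets: "upper_jet (\<lambda>h. u (x + h)) h1 p1 A1" "upper_jet (\<lambda>h. - u (y + h)) h2 p2 A2"
    and A: "\<And>v1 v2. A1 v1 \<bullet> v1 + A2 v2 \<bullet> v2 \<le> sum_form (k w) (38 * \<epsilon> / dx\<^sup>2) (38 * \<epsilon> / dy\<^sup>2) v1 v2
        + \<zeta> * ((norm v1)\<^sup>2 + (norm v2)\<^sup>2)"
    by blast
  define x' where "x' = x + h1"
  define y' where "y' = y + h2"
  have x'y': "x' \<in> \<Omega>" "y' \<in> \<Omega>"
    using h \<zeta>(3) ball by (auto simp: x'_def y'_def subset_iff dist_norm)
  have "dist (x', y') (x, y) \<le> norm h1 + norm h2"
    unfolding dist_norm x'_def y'_def using norm_Pair_le[of h1 h2] by simp
  then have "dist (x', y') (x, y) < \<rho>" using h \<zeta>(2) by linarith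
  note near = near[OF this]
  obtain X where X: "X \<in> sym_matrices" "\<And>h. h \<bullet> (X *v h) = A1 h \<bullet> h"
    using symmetrize_linear jets(1) unfolding upper_jet_def by metis
  obtain Z where Z: "Z \<in> sym_matrices" "\<And>h. h \<bullet> (Z *v h) = A2 h \<bullet> h"
    using symmetrize_linear jets(2) unfolding upper_jet_def by metis
  obtain d1 where d1: "d1 > 0" "\<And>h. norm h < d1 \<Longrightarrow> u (x' + h) \<le> u x' + p1 \<bullet> h + h \<bullet> (X *v h) / 2"
    using jets(1) unfolding upper_jet_def X(2) x'_def by (auto simp: add.assoc)
  have F1: "u x' + F x' p1 X \<le> 0"
    by (rule subsolution_jet[OF sub x'y'(1) X(1) d1])
  obtain d2 where d2: "d2 > 0" "\<And>h. norm h < d2 \<Longrightarrow> - u (y' + h) \<le> - u y' + p2 \<bullet> h + h \<bullet> (Z *v h) / 2"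
    using jets(2) unfolding upper_jet_def Z(2) y'_def by (auto simp: add.assoc)
  have negZ: "(- Z) *v h = - (Z *v h)" for h
    by (simp add: vec_eq_iff matrix_vector_mult_def sum_negf)
  have F2: "u y' + F y' (- p2) (- Z) \<ge> 0"
  proof (rule supersolution_jet[OF super x'y'(2) _ d2(1)])
    show "- Z \<in> sym_matrices" using Z(1) by (auto simp: sym_matrices_def transpose_def vec_eq_iff)
    show "u y' + - p2 \<bullet> h + h \<bullet> (- Z *v h) / 2 \<le> u (y' + h)" if "norm h < d2" for h
      using d2(2)[OF that] by (simp add: negZ)
  qed
  have bdd: "bdd_above ((\<lambda>x. \<bar>u x\<bar>) ` \<Omega>)"
    using u(2) by (auto simp: bounded_iff bdd_above_def)
  have uM: "\<bar>u z\<bar> \<le> M" if "z \<in> \<Omega>" for z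
    unfolding M_def using that bdd by (rule cSUP_upper)
  \<comment> \<open>The viscosity inequalities bound F by -u from above at x' and from below at y';
    this is where M = sup |u| comes from.\<close>
  have FM: "F x' p1 X \<le> M" "F y' (- p2) (- Z) \<ge> - M"
    using F1 F2 uM[OF x'y'(1)] uM[OF x'y'(2)] by linarith+
  define \<delta> where "\<delta> = 40 * \<epsilon>"
  define k' where "k' = k (x' - y')"
  have eb: "norm (\<epsilon> *\<^sub>R b1) \<le> 2 * \<epsilon> / dx" "norm (\<epsilon> *\<^sub>R b2) \<le> 2 * \<epsilon> / dy"
    using mult_left_mono[OF b(1), of \<epsilon>] mult_left_mono[OF b(2), of \<epsilon>] pos by (simp_all add: dx_def dy_def mult.commute)
  have tri: "norm (v1 + - v2 + v3) \<le> norm v1 + norm v2 + norm v3" for v1 v2 v3 :: "real^'n"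
    using norm_triangle_ineq[of "v1 + - v2" v3] norm_triangle_ineq4[of v1 v2] by simp
  have pq1: "norm (p1 - k' *\<^sub>R (x' - y')) \<le> \<delta> / bdist \<Omega> x'"
  proof -
    have "p1 - k' *\<^sub>R (x' - y') = (p1 - l1) + (- (\<epsilon> *\<^sub>R b1)) + (k w *\<^sub>R w - k' *\<^sub>R (x' - y'))"
      by (simp add: l1_def)
    then have "norm (p1 - k' *\<^sub>R (x' - y')) \<le> norm (p1 - l1) + norm (\<epsilon> *\<^sub>R b1) + norm (k w *\<^sub>R w - k' *\<^sub>R (x' - y'))"
      by (simp only: tri)
    moreover have "3 * \<epsilon> / dx = \<epsilon> / dx + 2 * \<epsilon> / dx" by (simp add: add_divide_distrib[symmetric])
    ultimately show ?thesis
      using p(1) eb(1) \<zeta>(5) near unfolding \<delta>_def k'_def by linarith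
  qed
  have pq2: "norm (- p2 - k' *\<^sub>R (x' - y')) \<le> \<delta> / bdist \<Omega> y'"
  proof -
    have "- p2 - k' *\<^sub>R (x' - y') = (l2 - p2) + - (- (\<epsilon> *\<^sub>R b2)) + (k w *\<^sub>R w - k' *\<^sub>R (x' - y'))"
      by (simp add: l2_def)
    then have "norm (- p2 - k' *\<^sub>R (x' - y')) \<le> norm (l2 - p2) + norm (- (\<epsilon> *\<^sub>R b2)) + norm (k w *\<^sub>R w - k' *\<^sub>R (x' - y'))"
      by (simp only: tri)
    moreover have "3 * \<epsilon> / dy = \<epsilon> / dy + 2 * \<epsilon> / dy" by (simp add: add_divide_distrib[symmetric])
    ultimately show ?thesis
      using p(2)[unfolded norm_minus_commute[of p2]] eb(2)[folded norm_minus_cancel[of "\<epsilon> *\<^sub>R b2"]] \<zeta>(6) near unfolding \<delta>_def k'_def by linarith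
  qed
  have le: "v1 \<bullet> (X *v v1) + v2 \<bullet> (Z *v v2)
     \<le> sum_form k' (\<delta> / (bdist \<Omega> x')\<^sup>2 + \<delta>) (\<delta> / (bdist \<Omega> y')\<^sup>2 + \<delta>) v1 v2" for v1 v2
  proof -
    define n1 where "n1 = (norm v1)\<^sup>2"
    define n2 where "n2 = (norm v2)\<^sup>2"
    define m where "m = (norm (v1 - v2))\<^sup>2"
    have n: "0 \<le> n1" "0 \<le> n2" "0 \<le> m" by (simp_all add: n1_def n2_def m_def)
    have m2: "m \<le> 2 * (n1 + n2)"
      using sum_form_bound[of 1 0 0 v1 v2] by (simp add: sum_form_def m_def n1_def n2_def)
    have "(k w - k') * m \<le> 10 * \<epsilon> * m" using near n(3) unfolding k'_def by (intro mult_right_mono) auto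
    also have "\<dots> \<le> 10 * \<epsilon> * (2 * (n1 + n2))" using m2 pos by (intro mult_left_mono) auto
    finally have 1: "k w * m \<le> k' * m + 20 * \<epsilon> * (n1 + n2)" by (simp add: algebra_simps)
    have 2: "\<zeta> * (n1 + n2) \<le> \<epsilon> * (n1 + n2)" using \<zeta>(4) n by (intro mult_right_mono) auto
    have 3: "38 * \<epsilon> / dx\<^sup>2 * n1 \<le> \<delta> / (bdist \<Omega> x')\<^sup>2 * n1" "38 * \<epsilon> / dy\<^sup>2 * n2 \<le> \<delta> / (bdist \<Omega> y')\<^sup>2 * n2"
      using near n unfolding \<delta>_def by (auto intro!: mult_right_mono simp del: times_divide_eq_left)
    have 4: "21 * \<epsilon> * (n1 + n2) \<le> \<delta> * (n1 + n2)" using pos n by (intro mult_right_mono) (auto simp: \<delta>_def)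
    have "v1 \<bullet> (X *v v1) + v2 \<bullet> (Z *v v2) \<le> k w * m + 38 * \<epsilon> / dx\<^sup>2 * n1 + 38 * \<epsilon> / dy\<^sup>2 * n2 + \<zeta> * (n1 + n2)"
      using A[of v1 v2] by (simp add: X(2) Z(2) sum_form_def n1_def n2_def m_def)
    also have "\<dots> \<le> k' * m + \<delta> / (bdist \<Omega> x')\<^sup>2 * n1 + \<delta> / (bdist \<Omega> y')\<^sup>2 * n2 + \<delta> * (n1 + n2)"
    proof -
      have "21 * \<epsilon> * (n1 + n2) = 20 * \<epsilon> * (n1 + n2) + \<epsilon> * (n1 + n2)" by (simp add: algebra_simps)
      then show ?thesis using 1 2 3 4 by linarith
    qed
    also have "\<dots> = sum_form k' (\<delta> / (bdist \<Omega> x')\<^sup>2 + \<delta>) (\<delta> / (bdist \<Omega> y')\<^sup>2 + \<delta>) v1 v2"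
      by (simp add: sum_form_def n1_def n2_def m_def algebra_simps)
    finally show ?thesis .
  qed
  have "x' \<noteq> y'" "\<delta> > 0" using near pos by (auto simp: \<delta>_def)
  from structure_conditionD[OF struct x'y' this X(1) Z(1) FM pq1[unfolded k'_def k_def] pq2[unfolded k'_def k_def] le[unfolded k'_def k_def]]
  have "F y' (- p2) (- Z) - F x' p1 X \<le> \<beta> * a * norm (x' - y') powr \<alpha> + L * \<delta>" .
  \<comment> \<open>Subtracting the viscosity inequalities bounds u x' - u y' by the difference of
    the two values of F, against the last clause of \<open>near\<close>.\<close>
  then show False using F1 F2 near unfolding \<delta>_def by linarith
qed

text \<open>At the penalised maximum the excess over a |x - y|^\<alpha> is at least \<theta>,
  whereas \<open>doubling_estimate\<close> and \<beta> < 1 allow at most 40 L \<epsilon>.\<close>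

lemma holder_one_sided:
  fixes \<Omega> :: "(real^'n) set" and a \<alpha> :: real
  assumes \<Omega>: "open \<Omega>" "bounded \<Omega>" and u: "continuous_on \<Omega> u" "bounded (u ` \<Omega>)"
    and sub: "viscosity_subsolution \<Omega> F u" and super: "viscosity_supersolution \<Omega> F u"
    and struct: "structure_condition \<Omega> F (SUP x\<in>\<Omega>. \<bar>u x\<bar>) a L \<alpha> \<beta>"
    and pos: "a > 0" "0 < \<alpha>" "\<alpha> \<le> 1" "L > 0" "\<beta> < 1"
    and x0: "x0 \<in> \<Omega>" "y0 \<in> \<Omega>"
  shows "u x0 - u y0 \<le> a * norm (x0 - y0) powr \<alpha>"
proof (rule ccontr)
  assume contra: "\<not> ?thesis"
  \<comment> \<open>Half of the excess; the other half pays for the penalty at the starting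
    pair.\<close>
  define \<theta> where "\<theta> = (u x0 - u y0 - a * norm (x0 - y0) powr \<alpha>) / 2"
  have "\<theta> > 0" using contra by (simp add: \<theta>_def)
  have "compact (bdist \<Omega> ` closure \<Omega>)"
    unfolding bdist_def using \<Omega>(2) by (intro compact_continuous_image continuous_intros) (simp add: compact_closure)
  then obtain R0 where R0: "\<And>z. z \<in> closure \<Omega> \<Longrightarrow> \<bar>bdist \<Omega> z\<bar> \<le> R0"
    using compact_imp_bounded by (force simp: bounded_iff)
  define R where "R = \<bar>R0\<bar> + 1"
  have R: "R > 0" "\<And>z. z \<in> closure \<Omega> \<Longrightarrow> bdist \<Omega> z \<le> R"
    using R0 by (force simp: R_def)+
  define l where "l = ln (bdist \<Omega> x0 / R) + ln (bdist \<Omega> y0 / R)"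
  \<comment> \<open>The first bound keeps the penalty at \<open>x0\<close>, \<open>y0\<close> within
    \<theta>, the second makes \<open>L * (40 * \<epsilon>)\<close> at most \<theta>/2.\<close>
  define \<epsilon> where "\<epsilon> = min (\<theta> / (\<bar>l\<bar> + 1)) (\<theta> / (80 * L))"
  have \<epsilon>: "\<epsilon> > 0" "\<epsilon> \<le> \<theta> / (\<bar>l\<bar> + 1)" "\<epsilon> \<le> \<theta> / (80 * L)"
    using \<open>\<theta> > 0\<close> pos by (auto simp: \<epsilon>_def)
  have "\<epsilon> * \<bar>l\<bar> \<le> \<theta> / (\<bar>l\<bar> + 1) * (\<bar>l\<bar> + 1)"
    using \<epsilon> \<open>\<theta> > 0\<close> by (intro mult_mono) auto
  then have "\<epsilon> * \<bar>l\<bar> \<le> \<theta>" by simp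
  moreover have "- (\<epsilon> * \<bar>l\<bar>) \<le> \<epsilon> * l" using \<epsilon>(1) by (simp add: abs_if)
  moreover have "u x0 - u y0 - a * norm (x0 - y0) powr \<alpha> = 2 * \<theta>" by (simp add: \<theta>_def)
  ultimately have start: "u x0 - u y0 - a * norm (x0 - y0) powr \<alpha> + \<epsilon> * (ln (bdist \<Omega> x0 / R) + ln (bdist \<Omega> y0 / R)) \<ge> \<theta>"
    unfolding l_def[symmetric] by linarith
  have "a \<ge> 0" using pos by simp
  from penalised_maximum[OF \<Omega> u pos(2) \<epsilon>(1) \<open>\<theta> > 0\<close> R(1) this R(2) x0 start]
  obtain x y c e where xy: "x \<in> \<Omega>" "y \<in> \<Omega>" and ce: "c \<in> \<Omega>" "e \<in> \<Omega>"
    and bar: "bdist \<Omega> x \<le> barrier \<Omega> c x" "bdist \<Omega> y \<le> barrier \<Omega> e y"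
    and gap: "u x - u y - a * norm (x - y) powr \<alpha> \<ge> \<theta>"
    and max: "\<And>x' y'. x' \<in> \<Omega> \<Longrightarrow> y' \<in> \<Omega> \<Longrightarrow> barrier \<Omega> c x' > 0 \<Longrightarrow> barrier \<Omega> e y' > 0 \<Longrightarrow>
       u x' - u y' - a * norm (x' - y') powr \<alpha> + \<epsilon> * (ln (barrier \<Omega> c x') + ln (barrier \<Omega> e y'))
       \<le> u x - u y - a * norm (x - y) powr \<alpha> + \<epsilon> * (ln (barrier \<Omega> c x) + ln (barrier \<Omega> e y))"
    by blast
  \<comment> \<open>On the diagonal the left side of \<open>gap\<close> vanishes, as
    \<open>0 powr \<alpha> = 0\<close>.\<close>
  have "x \<noteq> y" using gap \<open>\<theta> > 0\<close> by auto
  then have "x - y \<noteq> 0" by simp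
  have d: "bdist \<Omega> x > 0" "bdist \<Omega> y > 0" "bdist \<Omega> c > 0" "bdist \<Omega> e > 0"
    using bdist_pos[OF \<Omega>] xy ce by auto
  obtain b1 where b1: "norm b1 \<le> 2 / bdist \<Omega> x" "\<And>h. norm h \<le> bdist \<Omega> x / 6 \<Longrightarrow> barrier \<Omega> c (x + h) > 0"
    "\<And>h. norm h \<le> bdist \<Omega> x / 6 \<Longrightarrow> ln (barrier \<Omega> c (x + h)) \<ge> ln (barrier \<Omega> c x) + b1 \<bullet> h - 19 / (bdist \<Omega> x)\<^sup>2 * (norm h)\<^sup>2"
    using ln_barrier_ge[OF d(1) bar(1) d(3)] by blast
  obtain b2 where b2: "norm b2 \<le> 2 / bdist \<Omega> y" "\<And>h. norm h \<le> bdist \<Omega> y / 6 \<Longrightarrow> barrier \<Omega> e (y + h) > 0"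
    "\<And>h. norm h \<le> bdist \<Omega> y / 6 \<Longrightarrow> ln (barrier \<Omega> e (y + h)) \<ge> ln (barrier \<Omega> e y) + b2 \<bullet> h - 19 / (bdist \<Omega> y)\<^sup>2 * (norm h)\<^sup>2"
    using ln_barrier_ge[OF d(2) bar(2) d(4)] by blast
  obtain r1 r2 where r12: "r1 > 0" "cball x r1 \<subseteq> \<Omega>" "r2 > 0" "cball y r2 \<subseteq> \<Omega>"
    using \<Omega>(1) xy by (meson open_contains_cball)
  define r where "r = min (min r1 r2) (min (bdist \<Omega> x / 6) (bdist \<Omega> y / 6))"
  have r: "r > 0" "r \<le> r1" "r \<le> r2" "r \<le> bdist \<Omega> x / 6" "r \<le> bdist \<Omega> y / 6"
    using r12 d by (auto simp: r_def)
  have ball: "cball x r \<subseteq> \<Omega>" "cball y r \<subseteq> \<Omega>"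
    using r12 r by (meson order_trans subset_cball)+
  define k where "k = \<alpha> * a * norm (x - y) powr (\<alpha> - 2)"
  \<comment> \<open>The 38 is twice the 19 of \<open>ln_barrier_ge\<close>, because
    \<open>sum_form\<close> enters halved.\<close>
  have "u (x + h1) - u (y + h2) \<le> u x - u y + (k *\<^sub>R (x - y) - \<epsilon> *\<^sub>R b1) \<bullet> h1
         + (- (k *\<^sub>R (x - y)) - \<epsilon> *\<^sub>R b2) \<bullet> h2
         + sum_form k (38 * \<epsilon> / (bdist \<Omega> x)\<^sup>2) (38 * \<epsilon> / (bdist \<Omega> y)\<^sup>2) h1 h2 / 2"
    if h: "norm h1 \<le> r" "norm h2 \<le> r" for h1 h2
  proof -
    have h6: "norm h1 \<le> bdist \<Omega> x / 6" "norm h2 \<le> bdist \<Omega> y / 6" using h r by auto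
    have mem: "x + h1 \<in> \<Omega>" "y + h2 \<in> \<Omega>" using ball h by (auto simp: subset_iff dist_norm)
    have "u (x + h1) - u (y + h2) - a * norm (x + h1 - (y + h2)) powr \<alpha>
        + \<epsilon> * (ln (barrier \<Omega> c (x + h1)) + ln (barrier \<Omega> e (y + h2)))
       \<le> u x - u y - a * norm (x - y) powr \<alpha> + \<epsilon> * (ln (barrier \<Omega> c x) + ln (barrier \<Omega> e y))"
      by (rule max[OF mem b1(2)[OF h6(1)] b2(2)[OF h6(2)]])
    moreover have "\<epsilon> * (ln (barrier \<Omega> c x) + b1 \<bullet> h1 - 19 / (bdist \<Omega> x)\<^sup>2 * (norm h1)\<^sup>2
        + (ln (barrier \<Omega> e y) + b2 \<bullet> h2 - 19 / (bdist \<Omega> y)\<^sup>2 * (norm h2)\<^sup>2))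
        \<le> \<epsilon> * (ln (barrier \<Omega> c (x + h1)) + ln (barrier \<Omega> e (y + h2)))"
      using b1(3)[OF h6(1)] b2(3)[OF h6(2)] \<epsilon>(1) by (intro mult_left_mono add_mono) auto
    moreover have "a * norm (x + h1 - (y + h2)) powr \<alpha>
        \<le> a * norm (x - y) powr \<alpha> + k * ((x - y) \<bullet> (h1 - h2) + (norm (h1 - h2))\<^sup>2 / 2)"
    proof -
      have eq: "x + h1 - (y + h2) = (x - y) + (h1 - h2)" by simp
      have "a * norm (x + h1 - (y + h2)) powr \<alpha>
         \<le> a * (norm (x - y) powr \<alpha> + \<alpha> * norm (x - y) powr (\<alpha> - 2) * ((x - y) \<bullet> (h1 - h2) + (norm (h1 - h2))\<^sup>2 / 2))"
        unfolding eq using pos(1) by (intro mult_left_mono norm_powr_add_le \<open>x - y \<noteq> 0\<close> pos(2,3)) auto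
      then show ?thesis by (simp add: k_def algebra_simps)
    qed
    ultimately have "u (x + h1) - u (y + h2) \<le> u x - u y + k * ((x - y) \<bullet> (h1 - h2) + (norm (h1 - h2))\<^sup>2 / 2)
        - \<epsilon> * (b1 \<bullet> h1 - 19 / (bdist \<Omega> x)\<^sup>2 * (norm h1)\<^sup>2 + (b2 \<bullet> h2 - 19 / (bdist \<Omega> y)\<^sup>2 * (norm h2)\<^sup>2))"
      unfolding distrib_left right_diff_distrib by linarith
    also have "\<dots> = u x - u y + (k *\<^sub>R (x - y) - \<epsilon> *\<^sub>R b1) \<bullet> h1
         + (- (k *\<^sub>R (x - y)) - \<epsilon> *\<^sub>R b2) \<bullet> h2
         + sum_form k (38 * \<epsilon> / (bdist \<Omega> x)\<^sup>2) (38 * \<epsilon> / (bdist \<Omega> y)\<^sup>2) h1 h2 / 2"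
      unfolding sum_form_def by (simp add: inner_diff_left inner_diff_right algebra_simps add_divide_distrib)
    finally show ?thesis .
  qed
  from doubling_estimate[OF \<Omega> u sub super struct xy \<open>x \<noteq> y\<close> pos(1,2) \<epsilon>(1) r(1) b1(1) b2(1) ball this[unfolded k_def]]
  have "u x - u y \<le> \<beta> * a * norm (x - y) powr \<alpha> + L * (40 * \<epsilon>)" .
  moreover have "\<beta> * (a * norm (x - y) powr \<alpha>) \<le> 1 * (a * norm (x - y) powr \<alpha>)"
    using pos by (intro mult_right_mono) auto
  moreover have "L * (40 * \<epsilon>) \<le> \<theta> / 2"
    using \<epsilon>(3) pos by (simp add: field_simps)
  ultimately show False using gap \<open>\<theta> > 0\<close> by (simp add: mult.assoc)
qed

theorem proposition3p3:
  fixes \<Omega> :: "(real^'n) set"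
    and F :: "real^'n \<Rightarrow> real^'n \<Rightarrow> real^'n^'n \<Rightarrow> real"
    and u :: "real^'n \<Rightarrow> real"
    and a \<alpha> :: real
  assumes domain: "bounded_C2_domain \<Omega>"
    and F_continuous: "continuous_on (\<Omega> \<times> UNIV \<times> sym_matrices) (\<lambda>(x, p, X). F x p X)"
    and F_elliptic: "\<And>x p X Y. x \<in> \<Omega> \<Longrightarrow> X \<in> sym_matrices \<Longrightarrow> Y \<in> sym_matrices \<Longrightarrow>
          Y \<preceq> X \<Longrightarrow> F x p X \<le> F x p Y"
    and F_structure: "\<And>M. M > 0 \<Longrightarrow> \<exists>a L \<alpha> \<beta>. a > 0 \<and> L > 0 \<and> 0 < \<alpha> \<and> \<alpha> \<le> 1 \<and> 0 < \<beta> \<and> \<beta> < 1 \<and>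
          structure_condition \<Omega> F M a L \<alpha> \<beta>"
    and u_bounded: "bounded (u ` \<Omega>)"
    and u_solution: "viscosity_solution \<Omega> F u"
    and a_pos: "a > 0"
    and alpha: "0 < \<alpha>" "\<alpha> \<le> 1"
    and a_alpha: "\<exists>L \<beta>. L > 0 \<and> 0 < \<beta> \<and> \<beta> < 1 \<and>
          structure_condition \<Omega> F (SUP x\<in>\<Omega>. \<bar>u x\<bar>) a L \<alpha> \<beta>"
  shows "\<forall>x\<in>\<Omega>. \<forall>y\<in>\<Omega>. \<bar>u x - u y\<bar> \<le> a * norm (x - y) powr \<alpha>"
proof (intro ballI)
  fix x y assume xy: "x \<in> \<Omega>" "y \<in> \<Omega>"
  have \<Omega>: "open \<Omega>" "bounded \<Omega>" using domain by (auto simp: bounded_C2_domain_def)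
  have u: "continuous_on \<Omega> u" "viscosity_subsolution \<Omega> F u" "viscosity_supersolution \<Omega> F u"
    using u_solution by (auto simp: viscosity_solution_def)
  obtain L \<beta> where "L > 0" "\<beta> < 1" "structure_condition \<Omega> F (SUP x\<in>\<Omega>. \<bar>u x\<bar>) a L \<alpha> \<beta>"
    using a_alpha by blast
  then have "u x' - u y' \<le> a * norm (x' - y') powr \<alpha>" if "x' \<in> \<Omega>" "y' \<in> \<Omega>" for x' y'
    using holder_one_sided[OF \<Omega> u(1) u_bounded u(2,3) _ a_pos alpha _ _ that] by blast
  from this[OF xy] this[OF xy(2,1)] show "\<bar>u x - u y\<bar> \<le> a * norm (x - y) powr \<alpha>"
    by (simp add: abs_le_iff norm_minus_commute)
qed

end
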